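(* Let $n\ge 2$ be an integer, and for $p\in(0,1)$ let $M=M^{(p,n)}$ be the limit set of Mandelbrot's fractal percolation process with parameters $p,n$. For every $d\in[0,2)$ there exists a critical probability $p_c^{(d)}=p_c^{(d,n)}\in(0,1)$ such that (1) if $p<p_c^{(d)}$ then $\dim_{tH}M\le d$ almost surely; (2) if $p>p_c^{(d)}$ then $\dim_{tH}M>d$ almost surely, provided $M\neq\emptyset$ (that is, $P(\dim_{tH}M>d\mid M\ne\emptyset)=1$).
   Context: Fractal percolation: let $p\in(0,1)$ and $n\ge2$ an integer. Set $M_0=[0,1]^2$. Divide the unit square into $n^2$ equal closed sub-squares of side-length $1/n$ in the natural way; keep each sub-square independently with probability $p$ (and erase it with probability $1-p$), and let $M_1$ be the union of the kept sub-squares. Then each square in $M_1$ is divided into $n^2$ closed squares of side-length $1/n^2$, each kept independently (also of earlier choices) with probability $p$, and so on. After $k$ steps $M_k=M_k^{(p,n)}$ is the union of the kept level-$k$ squares of side-length $1/n^k$. The limit set is $M=M^{(p,n)}=\bigcap_{k=1}^\infty M_k$. $\dim_H$ denotes Hausdorff dimension, with the convention $\dim_H\emptyset=-1$. The topological Hausdorff dimension is defined by $\dim_{tH}\emptyset=-1$ and, for a non-empty metric space $X$, $\dim_{tH}X=\inf\{d: X \text{ has a basis } \mathcal U \text{ of open sets such that } \dim_H\partial U\le d-1 \text{ for every } U\in\mathcal U\}$ (where $d=\infty$ is allowed, with $\infty-1=\infty$). *)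

theory Defs
  imports "HOL-Probability.Probability"
begin

section \<open>Hausdorff dimension\<close>

text \<open>
  The power \<open>(diam U)\<^sup>s\<close> for bounded \<open>U\<close> and \<open>s \<ge> 0\<close>, with the conventions that the empty set
  contributes \<open>0\<close> and that \<open>0\<^sup>0 = 1\<close> for a singleton (whereas \<open>0 powr 0 = 0\<close> in the library).
\<close>

definition diam_powr :: "real \<Rightarrow> 'a::metric_space set \<Rightarrow> ennreal" where
  "diam_powr s U =
    (if U = {} then 0 else if s = 0 then 1 else ennreal (diameter U powr s))"

text \<open>
  The boundedness condition is needed because \<^const>\<open>diameter\<close> is unspecified on unbounded sets.
  Covering by subsets of the ambient space rather than of \<open>A\<close> does not change the infimum, so the
  value depends only on the metric space \<open>A\<close>.
\<close>

definition hausdorff_premeasure :: "real \<Rightarrow> real \<Rightarrow> 'a::metric_space set \<Rightarrow> ennreal" where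
  "hausdorff_premeasure s \<delta> A =
    (INF C \<in> {C :: nat \<Rightarrow> 'a set.
        A \<subseteq> (\<Union>i. C i) \<and> (\<forall>i. bounded (C i) \<and> diameter (C i) \<le> \<delta>)}.
      (\<Sum>i. diam_powr s (C i)))"

text \<open>By monotonicity in \<open>\<delta>\<close>, the supremum is the limit for \<open>\<delta>\<close> tending to \<open>0\<close>.\<close>

definition hausdorff_measure :: "real \<Rightarrow> 'a::metric_space set \<Rightarrow> ennreal" where
  "hausdorff_measure s A = (SUP \<delta> \<in> {0<..}. hausdorff_premeasure s \<delta> A)"

definition hausdorff_dim :: "'a::metric_space set \<Rightarrow> ereal" where
  "hausdorff_dim A =
    (if A = {} then - 1 else Inf (ereal ` {s. 0 \<le> s \<and> hausdorff_measure s A = 0}))"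


section \<open>Topological Hausdorff dimension\<close>

definition is_open_base :: "'a topology \<Rightarrow> 'a set set \<Rightarrow> bool" where
  "is_open_base T \<U> \<longleftrightarrow>
    (\<forall>U\<in>\<U>. openin T U) \<and> (\<forall>W. openin T W \<longrightarrow> (\<exists>\<V>\<subseteq>\<U>. W = \<Union>\<V>))"

text \<open>
  A set \<open>X\<close> stands for the metric space \<open>X\<close> with the restricted metric: openness and boundary are
  taken in \<open>X\<close>, not in the ambient space. The library has \<open>\<infinity> - 1 = \<infinity>\<close> on \<^typ>\<open>ereal\<close>. Negative
  \<open>d\<close> never satisfy the condition, as \<^const>\<open>hausdorff_dim\<close> is at least \<open>- 1\<close> and a base of a
  non-empty space is non-empty.
\<close>

definition topological_hausdorff_dim :: "'a::metric_space set \<Rightarrow> ereal" where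
  "topological_hausdorff_dim X =
    (if X = {} then - 1
     else Inf {d :: ereal. \<exists>\<U>. is_open_base (top_of_set X) \<U> \<and>
                 (\<forall>U\<in>\<U>. hausdorff_dim ((top_of_set X) frontier_of U) \<le> d - 1)})"


section \<open>Fractal percolation\<close>

text \<open>
  The index \<open>(k, i, j)\<close> with \<open>i, j < n ^ k\<close> denotes the closed level-\<open>k\<close> square of side length
  \<open>1 / n ^ k\<close> whose lower left corner is \<open>(i / n ^ k, j / n ^ k)\<close>; its parent is the square
  \<open>(k - 1, i div n, j div n)\<close>.
\<close>

definition percolation_square :: "nat \<Rightarrow> nat \<Rightarrow> nat \<Rightarrow> nat \<Rightarrow> (real \<times> real) set" where
  "percolation_square n k i j =
    {real i / real n ^ k .. (real i + 1) / real n ^ k} \<times>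
    {real j / real n ^ k .. (real j + 1) / real n ^ k}"

definition percolation_indices :: "nat \<Rightarrow> (nat \<times> nat \<times> nat) set" where
  "percolation_indices n = {(k, i, j). 1 \<le> k \<and> i < n ^ k \<and> j < n ^ k}"

text \<open>
  One independent Bernoulli(\<open>p\<close>) decision for every square of every level \<open>k \<ge> 1\<close>. Decisions are
  also drawn for squares whose parent has been erased; \<open>percolation_kept\<close> ignores them.
\<close>

definition percolation_space :: "real \<Rightarrow> nat \<Rightarrow> (nat \<times> nat \<times> nat \<Rightarrow> bool) measure" where
  "percolation_space p n =
    (\<Pi>\<^sub>M q\<in>percolation_indices n. measure_pmf (bernoulli_pmf p))"

fun percolation_kept ::
    "nat \<Rightarrow> (nat \<times> nat \<times> nat \<Rightarrow> bool) \<Rightarrow> nat \<Rightarrow> (nat \<times> nat) set" where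
  "percolation_kept n \<omega> 0 = {(0, 0)}"
| "percolation_kept n \<omega> (Suc k) =
    {(i, j). (i div n, j div n) \<in> percolation_kept n \<omega> k \<and> \<omega> (Suc k, i, j)}"

definition percolation_step ::
    "nat \<Rightarrow> (nat \<times> nat \<times> nat \<Rightarrow> bool) \<Rightarrow> nat \<Rightarrow> (real \<times> real) set" where
  "percolation_step n \<omega> k = (\<Union>(i, j)\<in>percolation_kept n \<omega> k. percolation_square n k i j)"

definition percolation_limit ::
    "nat \<Rightarrow> (nat \<times> nat \<times> nat \<Rightarrow> bool) \<Rightarrow> (real \<times> real) set" where
  "percolation_limit n \<omega> = (\<Inter>k\<in>{1..}. percolation_step n \<omega> k)"

end

theory Submission
  imports Defs
begin

text \<open>
  Call a compact set \<open>K\<close> \<open>t\<close>-cuttable if every compact set can be separated in \<open>K\<close> from the complement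
  of any of its neighbourhoods by a cut that is covered by finitely many balls with arbitrarily small sum
  of \<open>t\<close>-th powers of the radii. Then \<open>topological_hausdorff_dim K \<le> d\<close> if and only if \<open>K\<close> is \<open>t\<close>-cuttable for all rational
  \<open>t \<ge> 0\<close> with \<open>t > d - 1\<close>: cuts of small cost can be refined to a cut of measure zero. In contrast to the
  definition of the dimension, cuttability only quantifies over countably many configurations, hence it is
  a measurable event; it is inherited by subsets and invariant under similarities.

  By self-similarity the probability \<open>x\<close> that the limit set is cuttable satisfies \<open>x \<le> f(x)\<close> for the
  generating function \<open>f(x) = (1 - p + p x)\<close> to the power \<open>n\<^sup>2\<close>, and the extinction probability is a fixed
  point of \<open>f\<close>. As \<open>f\<close> is strictly convex, either \<open>x = 1\<close> or \<open>x\<close> is the extinction probability. Together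
  with a monotone coupling this gives the threshold. It is positive because the limit set is empty for
  \<open>p < 1/n\<^sup>2\<close>.

  The threshold is below \<open>1\<close> by renormalization with squares of side \<open>1/N\<close>, \<open>N = n\<^sup>k\<close>. For \<open>p\<close> close to
  \<open>1\<close>, with positive probability every surviving square of a suitable subtree has at most one defective
  child. Given a cover of a cut of total cost below \<open>1\<close>, with \<open>t < 1\<close>, declare a square blocked if it is
  defective, belongs to the cover or has many blocked children; then the unit square is not blocked, and
  the rows and columns of unblocked squares contain a crossing that avoids the cut.
\<close>

section \<open>Finite covers by balls and Hausdorff null sets\<close>

text \<open>The dimension is an infimum over all bases, from which measurability cannot be read off.
  Restricting covers to finitely many open balls is possible because cuts in a compact set are
  compact, and it pays twice: the balls can be taken from a countable collection, and meeting the
  cut only inside the balls means missing a closed set, which a percolation limit decides at a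
  finite level. The exponent \<open>0\<close> serves the case \<open>d < 1\<close>, where boundaries
  have to be empty. Passing from the limit set to its first-level pieces gives an inequality only.
  It is enough because \<open>x\<close> also dominates the extinction probability, the empty set
  being cuttable. For the upper bound, \<open>t < 1\<close> leaves room for an integer
  \<open>b\<close> with \<open>N powr t \<le> b < N / 2\<close>: the lower inequality makes the
  blocked children together at least as expensive as their parent, the upper one leaves a majority
  of free rows and columns. One defective child per square is tolerated because two independent
  failures have quadratically small probability, which closes the recursion over the levels.\<close>

definition ball_union :: "('a::metric_space \<times> real) set \<Rightarrow> 'a set" where
  "ball_union F = (\<Union>(x, r)\<in>F. ball x r)"

text \<open>For \<open>t = 0\<close> the cost counts the balls, because only positive radii occur in
  covers and \<open>r powr 0 = 1\<close> for them.\<close>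

definition ball_cost :: "real \<Rightarrow> ('a::metric_space \<times> real) set \<Rightarrow> real" where
  "ball_cost t F = (\<Sum>(x, r)\<in>F. r powr t)"

text \<open>No bound on the radii is imposed: for \<open>t > 0\<close> a small cost forces small
  radii, for \<open>t = 0\<close> a cost below \<open>1\<close> forces the empty family.\<close>

definition coverable :: "real \<Rightarrow> real \<Rightarrow> 'a::metric_space set \<Rightarrow> bool" where
  "coverable t \<epsilon> S \<longleftrightarrow>
    (\<exists>F. finite F \<and> (\<forall>(x, r)\<in>F. 0 < r) \<and> S \<subseteq> ball_union F \<and> ball_cost t F < \<epsilon>)"

lemma open_ball_union [intro, simp]: "open (ball_union F)"
  by (auto simp: ball_union_def)

lemma coverable_mono: "coverable t \<epsilon> S \<Longrightarrow> S' \<subseteq> S \<Longrightarrow> \<epsilon> \<le> \<epsilon>' \<Longrightarrow> coverable t \<epsilon>' S'"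
  unfolding coverable_def by (meson dual_order.trans order_less_le_trans)

lemma coverable_empty: "0 < \<epsilon> \<Longrightarrow> coverable t \<epsilon> {}"
  unfolding coverable_def by (rule exI[of _ "{}"]) (simp add: ball_cost_def)

lemma coverable_Un:
  assumes "coverable t \<epsilon> S" "coverable t \<epsilon>' S'"
  shows "coverable t (\<epsilon> + \<epsilon>') (S \<union> S')"
proof -
  obtain F F' where F: "finite F" "\<forall>(x, r)\<in>F. 0 < r" "S \<subseteq> ball_union F" "ball_cost t F < \<epsilon>"
    and F': "finite F'" "\<forall>(x, r)\<in>F'. 0 < r" "S' \<subseteq> ball_union F'" "ball_cost t F' < \<epsilon>'"
    using assms unfolding coverable_def by metis
  have "ball_cost t (F \<union> F') \<le> ball_cost t F + ball_cost t F'"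
    unfolding ball_cost_def using F(1) F'(1)
    by (subst sum_Un) (auto intro!: sum_nonneg)
  moreover have "S \<union> S' \<subseteq> ball_union (F \<union> F')"
    using F(3) F'(3) by (auto simp: ball_union_def)
  ultimately show ?thesis
    unfolding coverable_def using F F' by (intro exI[of _ "F \<union> F'"]) auto
qed

lemma coverable_UN:
  assumes "finite I" "\<And>i \<epsilon>. i \<in> I \<Longrightarrow> 0 < \<epsilon> \<Longrightarrow> coverable t \<epsilon> (S i)" "0 < \<epsilon>"
  shows "coverable t \<epsilon> (\<Union>i\<in>I. S i)"
  using assms
proof (induction I arbitrary: \<epsilon> rule: finite_induct)
  case empty
  then show ?case by (simp add: coverable_empty)
next
  case (insert i I)
  have "coverable t (\<epsilon>/2 + \<epsilon>/2) (S i \<union> (\<Union>i\<in>I. S i))"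
    by (rule coverable_Un) (use insert in auto)
  then show ?case by simp
qed

lemma radius_powr_le_cost:
  assumes "finite F" "(x, r) \<in> F"
  shows "r powr t \<le> ball_cost t F"
  unfolding ball_cost_def
  using member_le_sum[OF assms(2) _ assms(1), of "\<lambda>(x, r). r powr t"] by auto

text \<open>A cover of cost less than \<open>1\<close> only uses radii below \<open>1\<close>, and is empty if \<open>s = 0\<close>.\<close>

lemma coverable_exponent_mono:
  assumes "coverable s \<epsilon> S" "0 \<le> s" "s \<le> t" "\<epsilon> \<le> 1"
  shows "coverable t \<epsilon> S"
proof -
  obtain F where F: "finite F" "\<forall>(x, r)\<in>F. 0 < r" "S \<subseteq> ball_union F" "ball_cost s F < \<epsilon>"
    using assms unfolding coverable_def by metis
  have "ball_cost t F \<le> ball_cost s F"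
    unfolding ball_cost_def
  proof (intro sum_mono, clarify)
    fix x r assume xr: "(x, r) \<in> F"
    have "0 < r" using F xr by auto
    have "r powr s < 1" using radius_powr_le_cost[OF F(1) xr, of s] F assms by simp
    then have "r < 1"
      using \<open>0 < r\<close> assms(2) ge_one_powr_ge_zero[of r s] by (cases "r < 1") auto
    then show "r powr t \<le> r powr s"
      using \<open>0 < r\<close> assms by (intro powr_mono') auto
  qed
  then show ?thesis unfolding coverable_def using F by force
qed

text \<open>A family of cost below \<open>1\<close> at exponent \<open>0\<close> contains no ball.
  This serves dimension bounds \<open>d < 1\<close>, where the boundaries must have dimension at
  most \<open>d - 1 < 0\<close> and hence be empty.\<close>

lemma coverable_zero_iff_empty: "(\<forall>\<epsilon>>0. coverable 0 \<epsilon> S) \<longleftrightarrow> S = {}"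
proof
  assume "\<forall>\<epsilon>>0. coverable 0 \<epsilon> S"
  then obtain F where F: "finite F" "\<forall>(x, r)\<in>F. 0 < r" "S \<subseteq> ball_union F" "ball_cost 0 F < 1"
    unfolding coverable_def using zero_less_one by blast
  have "F = {}"
    using radius_powr_le_cost[OF F(1), of _ _ 0] F(2,4) by force
  then show "S = {}" using F(3) by (simp add: ball_union_def)
qed (simp add: coverable_empty)

lemma closure_ball_union_subset:
  assumes "finite F" "\<forall>(x, r)\<in>F. 0 < r"
  shows "closure (ball_union F) \<subseteq> ball_union ((\<lambda>(x, r). (x, 2 * r)) ` F)"
proof -
  have "closed (\<Union>(x, r)\<in>F. cball x r)"
    using assms by (intro closed_UN) auto
  moreover have "ball_union F \<subseteq> (\<Union>(x, r)\<in>F. cball x r)"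
    unfolding ball_union_def by (intro UN_mono) auto
  ultimately have "closure (ball_union F) \<subseteq> (\<Union>(x, r)\<in>F. cball x r)"
    by (simp add: closure_minimal)
  also have "\<dots> \<subseteq> ball_union ((\<lambda>(x, r). (x, 2 * r)) ` F)"
    using assms by (force simp: ball_union_def)
  finally show ?thesis .
qed

text \<open>An inequality, because \<open>g\<close> may identify balls; \<open>g\<close> will
  rescale them or round them to a countable family.\<close>

lemma ball_cost_image_le:
  assumes "finite F" "\<forall>(x, r)\<in>F. 0 < r" "0 \<le> t" "0 \<le> c"
    and "\<And>x r. (x, r) \<in> F \<Longrightarrow> 0 \<le> snd (g (x, r)) \<and> snd (g (x, r)) \<le> c * r"
  shows "ball_cost t (g ` F) \<le> c powr t * ball_cost t F"
proof -
  have "ball_cost t (g ` F) \<le> (\<Sum>p\<in>F. snd (g p) powr t)"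
    unfolding ball_cost_def case_prod_beta
    using sum_image_le[of F "\<lambda>p. snd p powr t" g] assms(1) by (simp add: comp_def)
  also have "\<dots> \<le> (\<Sum>p\<in>F. c powr t * snd p powr t)"
  proof (intro sum_mono)
    fix p assume "p \<in> F"
    then have "0 \<le> snd (g p) \<and> snd (g p) \<le> c * snd p" "0 < snd p" using assms by (cases p; force)+
    then have "snd (g p) powr t \<le> (c * snd p) powr t" using assms(3) by (intro powr_mono2) auto
    also have "\<dots> = c powr t * snd p powr t"
      by (rule powr_mult)
    finally show "snd (g p) powr t \<le> c powr t * snd p powr t" .
  qed
  also have "\<dots> = c powr t * ball_cost t F"
    by (simp add: ball_cost_def sum_distrib_left case_prod_beta)
  finally show ?thesis .
qed

lemma coverable_closure_ball_union:
  assumes "finite F" "\<forall>(x, r)\<in>F. 0 < r" "0 \<le> t" "ball_cost t F < \<epsilon>"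
  shows "coverable t (2 powr t * \<epsilon>) (closure (ball_union F))"
proof -
  let ?G = "(\<lambda>(x, r). (x, 2 * r)) ` F"
  have "ball_cost t ?G \<le> 2 powr t * ball_cost t F"
    using assms by (intro ball_cost_image_le) auto
  also have "\<dots> < 2 powr t * \<epsilon>" using assms(4) by simp
  finally show ?thesis
    unfolding coverable_def using assms closure_ball_union_subset[OF assms(1,2)]
    by (intro exI[of _ ?G]) auto
qed

section \<open>Finite ball covers and Hausdorff null sets\<close>

lemma hausdorff_premeasure_le:
  assumes "coverable t \<epsilon> S" "0 \<le> t" "0 < \<epsilon>" "\<epsilon> \<le> 1" "t = 0 \<or> 2 * \<epsilon> powr (1 / t) \<le> \<delta>" "0 \<le> \<delta>"
  shows "hausdorff_premeasure t \<delta> S \<le> ennreal (2 powr t * \<epsilon>)"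
proof (cases "t = 0")
  case True
  obtain F where F: "finite F" "\<forall>(x, r)\<in>F. 0 < r" "S \<subseteq> ball_union F" "ball_cost t F < \<epsilon>"
    using assms unfolding coverable_def by metis
  have "F = {}"
    using radius_powr_le_cost[OF F(1), of _ _ 0] F(2,4) True assms(4) by force
  then have "S = {}" using F(3) by (simp add: ball_union_def)
  then have "hausdorff_premeasure t \<delta> S \<le> (\<Sum>i. diam_powr t ((\<lambda>_::nat. {}::'a set) i))"
    unfolding hausdorff_premeasure_def using assms
    by (intro INF_lower) (auto simp: diameter_def)
  then show ?thesis by (simp add: diam_powr_def)
next
  case False
  then have "0 < t" using assms by simp
  obtain F where F: "finite F" "\<forall>(x, r)\<in>F. 0 < r" "S \<subseteq> ball_union F" "ball_cost t F < \<epsilon>"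
    using assms unfolding coverable_def by metis
  \<comment> \<open>The premeasure ranges over sequences of sets, so the finite family is enumerated
    and padded with empty sets, which cost \<open>0\<close>.\<close>
  obtain h and m :: nat where h: "F = h ` {i. i < m}" "inj_on h {i. i < m}"
    using finite_imp_nat_seg_image_inj_on[OF F(1)] by metis
  define C where "C i = (if i < m then (case h i of (x, r) \<Rightarrow> ball x r) else {})" for i
  have rad: "diameter (C i) \<le> 2 * snd (h i)" "bounded (C i)" "0 < snd (h i)" "2 * snd (h i) \<le> \<delta>" if "i < m" for i
  proof -
    have hi: "(fst (h i), snd (h i)) \<in> F" using h that by auto
    then show pos: "0 < snd (h i)" using F by auto
    show "bounded (C i)" by (auto simp: C_def case_prod_beta)
    show "diameter (C i) \<le> 2 * snd (h i)"
    proof -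
      have "dist x y \<le> 2 * snd (h i)" if "x \<in> C i" "y \<in> C i" for x y
      proof -
        have "dist (fst (h i)) x < snd (h i)" "dist (fst (h i)) y < snd (h i)"
          using that \<open>i < m\<close> by (auto simp: C_def case_prod_beta)
        then show ?thesis
          using dist_triangle3[of x y "fst (h i)"] by linarith
      qed
      then show ?thesis
        using pos by (auto simp: diameter_def intro!: cSUP_least)
    qed
    \<comment> \<open>A single radius is at most \<open>\<epsilon> powr (1 / t)\<close>, so the
      hypothesis relating \<open>\<epsilon>\<close> and \<open>\<delta>\<close> bounds all diameters
      by \<open>\<delta>\<close>.\<close>
    have "snd (h i) powr t \<le> \<epsilon>"
      using radius_powr_le_cost[OF F(1) hi, of t] F(4) by simp
    then have "(snd (h i) powr t) powr (1/t) \<le> \<epsilon> powr (1/t)"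
      using \<open>0 < t\<close> by (intro powr_mono2) auto
    then show "2 * snd (h i) \<le> \<delta>"
      using \<open>0 < t\<close> pos assms(5) by (simp add: powr_powr)
  qed
  have "hausdorff_premeasure t \<delta> S \<le> (\<Sum>i. diam_powr t (C i))"
    unfolding hausdorff_premeasure_def
  proof (intro INF_lower CollectI conjI allI)
    show "S \<subseteq> (\<Union>i. C i)"
    proof
      fix x assume "x \<in> S"
      then obtain p where "p \<in> F" "x \<in> ball (fst p) (snd p)"
        using F(3) by (force simp: ball_union_def)
      then obtain i where "i < m" "h i = p" using h by auto
      then show "x \<in> (\<Union>i. C i)"
        using \<open>x \<in> ball _ _\<close> by (auto simp: C_def case_prod_beta intro!: exI[of _ i])
    qed
    fix i
    show "bounded (C i)" using rad(2)[of i] by (cases "i < m") (auto simp: C_def)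
    show "diameter (C i) \<le> \<delta>"
      using rad[of i] assms(6) by (cases "i < m") (auto simp: C_def diameter_def)
  qed
  also have "\<dots> = (\<Sum>i<m. diam_powr t (C i))"
    by (intro suminf_finite) (auto simp: C_def diam_powr_def)
  also have "\<dots> \<le> (\<Sum>i<m. ennreal ((2 * snd (h i)) powr t))"
  proof (intro sum_mono)
    fix i assume "i \<in> {..<m}"
    then show "diam_powr t (C i) \<le> ennreal ((2 * snd (h i)) powr t)"
      using rad[of i] \<open>0 < t\<close> diameter_ge_0[of "C i"]
      by (auto simp: diam_powr_def intro!: ennreal_leI powr_mono2)
  qed
  also have "\<dots> = ennreal (\<Sum>i<m. (2 * snd (h i)) powr t)"
    by (simp add: sum_ennreal)
  also have "(\<Sum>i<m. (2 * snd (h i)) powr t) = 2 powr t * (\<Sum>i<m. snd (h i) powr t)"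
    unfolding sum_distrib_left
    using rad(3) by (intro sum.cong) (auto simp: powr_mult less_imp_le)
  also have "(\<Sum>i<m. snd (h i) powr t) = ball_cost t F"
    unfolding ball_cost_def h(1) case_prod_beta
    using h(2) by (subst sum.reindex) (auto simp: lessThan_def)
  also have "ennreal (2 powr t * ball_cost t F) \<le> ennreal (2 powr t * \<epsilon>)"
    using F(4) by (intro ennreal_leI mult_left_mono) auto
  finally show ?thesis .
qed

lemma hausdorff_measure_0_if_coverable:
  assumes "\<And>\<epsilon>. 0 < \<epsilon> \<Longrightarrow> coverable t \<epsilon> S" "0 \<le> t"
  shows "hausdorff_measure t S = 0"
proof -
  have "hausdorff_premeasure t \<delta> S \<le> 0" if "0 < \<delta>" for \<delta>
  proof (rule ennreal_le_epsilon)
    fix e :: real assume "0 < e"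
    \<comment> \<open>The inner minimum bounds the final cost by \<open>e\<close>, the last entry
      bounds the diameters by \<open>\<delta>\<close>; for \<open>t = 0\<close> no ball occurs and
      the entry \<open>1\<close> is a dummy.\<close>
    define \<epsilon> where "\<epsilon> = min (min 1 (e / 2 powr t)) (if t = 0 then 1 else (\<delta> / 2) powr t)"
    have "0 < \<epsilon>" using \<open>0 < e\<close> \<open>0 < \<delta>\<close> by (auto simp: \<epsilon>_def)
    have "hausdorff_premeasure t \<delta> S \<le> ennreal (2 powr t * \<epsilon>)"
    proof (rule hausdorff_premeasure_le)
      show "t = 0 \<or> 2 * \<epsilon> powr (1 / t) \<le> \<delta>"
      proof (cases "t = 0")
        case False
        have "\<epsilon> powr (1/t) \<le> ((\<delta> / 2) powr t) powr (1/t)"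
          using \<open>0 < \<epsilon>\<close> assms(2) False by (intro powr_mono2) (auto simp: \<epsilon>_def)
        then show ?thesis using False \<open>0 < \<delta>\<close> by (simp add: powr_powr)
      qed simp
    qed (use \<open>0 < \<epsilon>\<close> assms that in \<open>auto simp: \<epsilon>_def\<close>)
    also have "\<dots> \<le> ennreal e"
    proof (rule ennreal_leI)
      have "\<epsilon> \<le> e / 2 powr t" by (simp add: \<epsilon>_def)
      then show "2 powr t * \<epsilon> \<le> e" by (simp add: field_simps)
    qed
    finally show "hausdorff_premeasure t \<delta> S \<le> 0 + ennreal e" by simp
  qed
  then have "hausdorff_measure t S \<le> 0"
    unfolding hausdorff_measure_def by (intro SUP_least) auto
  then show ?thesis by simp
qed

text \<open>Each covering set lies in an open ball about one of its points with radius slightly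
  above its diameter; compactness then leaves finitely many balls.\<close>

lemma coverable_if_hausdorff_measure_0:
  fixes S :: "'a::metric_space set"
  assumes S: "compact S" and "hausdorff_measure t S = 0" "0 \<le> t" "0 < \<epsilon>"
  shows "coverable t \<epsilon> S"
proof -
  \<comment> \<open>One half of the budget pays for the given cover, the other for the enlargements
    \<open>e / 2 ^ Suc i\<close>.\<close>
  define e where "e = min \<epsilon> 1 / 2"
  have e: "0 < e" "e < 1" "e + e \<le> \<epsilon>" using \<open>0 < \<epsilon>\<close> by (auto simp: e_def)
  have "hausdorff_premeasure t 1 S \<le> hausdorff_measure t S"
    unfolding hausdorff_measure_def by (intro SUP_upper) simp
  then have "hausdorff_premeasure t 1 S < ennreal e"
    using assms(2) e by (simp add: order_le_less_trans)
  then obtain C :: "nat \<Rightarrow> 'a set" where C: "S \<subseteq> (\<Union>i. C i)" "\<And>i. bounded (C i)"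
    and sC: "(\<Sum>i. diam_powr t (C i)) < ennreal e"
    unfolding hausdorff_premeasure_def INF_less_iff by auto
  have "\<exists>r. 0 < r \<and> diameter (C i) < r \<and> r powr t \<le> (if t = 0 then 1 else diameter (C i) powr t) + e / 2 ^ Suc i" for i
  proof (cases "t = 0")
    case True
    have "0 \<le> diameter (C i)" using C by (simp add: diameter_ge_0)
    then show ?thesis using True e by (intro exI[of _ "diameter (C i) + 1"]) auto
  next
    case False
    then have "0 < t" using assms by simp
    have d: "0 \<le> diameter (C i)" using C by (simp add: diameter_ge_0)
    \<comment> \<open>Right continuity of \<open>r powr t\<close> at the diameter holds also for
      diameter \<open>0\<close>, since \<open>t > 0\<close>.\<close>
    have "((\<lambda>r. r powr t) \<longlongrightarrow> diameter (C i) powr t) (at_right (diameter (C i)))"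
      using d \<open>0 < t\<close>
      by (intro tendsto_powr' tendsto_intros disjI2 conjI)
        (auto intro!: eventually_at_rightI[of "diameter (C i)" "diameter (C i) + 1"])
    then have "eventually (\<lambda>r. r powr t < diameter (C i) powr t + e / 2 ^ Suc i) (at_right (diameter (C i)))"
      using e by (intro order_tendstoD) auto
    moreover have "eventually (\<lambda>r. diameter (C i) < r) (at_right (diameter (C i)))"
      by (simp add: eventually_at_right_less)
    ultimately have "eventually (\<lambda>r. r powr t < diameter (C i) powr t + e / 2 ^ Suc i \<and> diameter (C i) < r) (at_right (diameter (C i)))"
      by eventually_elim auto
    then obtain r where "r powr t < diameter (C i) powr t + e / 2 ^ Suc i" "diameter (C i) < r"
      using eventually_happens trivial_limit_at_right_real by blast
    then show ?thesis using False d by (intro exI[of _ r]) auto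
  qed
  then obtain r where r: "\<And>i. 0 < r i" "\<And>i. diameter (C i) < r i"
    "\<And>i. r i powr t \<le> (if t = 0 then 1 else diameter (C i) powr t) + e / 2 ^ Suc i"
    by metis
  define c where "c i = (SOME x. x \<in> C i)" for i
  have c: "c i \<in> C i" if "C i \<noteq> {}" for i using that by (auto simp: c_def intro: someI)
  let ?J = "{i. C i \<noteq> {}}"
  have cov: "S \<subseteq> (\<Union>i\<in>?J. ball (c i) (r i))"
  proof
    fix x assume "x \<in> S"
    then obtain i where i: "x \<in> C i" using C by auto
    then have "dist (c i) x \<le> diameter (C i)"
      using c[of i] C(2)[of i] diameter_bounded_bound by blast
    then have "x \<in> ball (c i) (r i)" using r(2)[of i] by simp
    then show "x \<in> (\<Union>i\<in>?J. ball (c i) (r i))" using i by auto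
  qed
  obtain J where J: "J \<subseteq> ?J" "finite J" "S \<subseteq> (\<Union>i\<in>J. ball (c i) (r i))"
    using compactE_image[OF S _ cov] by auto
  let ?F = "(\<lambda>i. (c i, r i)) ` J"
  have "ball_cost t ?F \<le> (\<Sum>i\<in>J. r i powr t)"
    unfolding ball_cost_def case_prod_beta
    using sum_image_le[of J "\<lambda>p. snd p powr t" "\<lambda>i. (c i, r i)"] J by (simp add: comp_def)
  also have "\<dots> \<le> (\<Sum>i\<in>J. (if t = 0 then 1 else diameter (C i) powr t)) + (\<Sum>i\<in>J. e / 2 ^ Suc i)"
    unfolding sum.distrib[symmetric] by (intro sum_mono r)
  also have "(\<Sum>i\<in>J. e / 2 ^ Suc i) \<le> e"
  proof -
    have "(\<lambda>i. e * (1/2) ^ Suc i) sums (e * 1)" by (intro sums_mult power_half_series)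
    then have s: "(\<lambda>i. e / 2 ^ Suc i) sums e" by (simp add: power_divide)
    then have "(\<Sum>i\<in>J. e / 2 ^ Suc i) \<le> (\<Sum>i. e / 2 ^ Suc i)"
      using J e by (intro sum_le_suminf) (auto simp: sums_iff)
    then show ?thesis using s by (simp add: sums_iff)
  qed
  also have "(\<Sum>i\<in>J. (if t = 0 then 1 else diameter (C i) powr t)) < e"
  proof -
    have "ennreal (\<Sum>i\<in>J. (if t = 0 then 1 else diameter (C i) powr t)) =
        (\<Sum>i\<in>J. ennreal (if t = 0 then 1 else diameter (C i) powr t))"
      by (rule sum_ennreal[symmetric]) auto
    also have "\<dots> = (\<Sum>i\<in>J. diam_powr t (C i))"
      using J(1) by (intro sum.cong) (auto simp: diam_powr_def)
    also have "\<dots> \<le> (\<Sum>i. diam_powr t (C i))"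
      using J by (intro sum_le_suminf) auto
    also have "\<dots> < ennreal e" by (fact sC)
    finally show ?thesis
      by (subst (asm) ennreal_less_iff) (auto intro!: sum_nonneg)
  qed
  finally have "ball_cost t ?F < e + e" by simp
  moreover have "S \<subseteq> ball_union ?F" using J(3) by (auto simp: ball_union_def)
  ultimately show ?thesis
    unfolding coverable_def using J r e by (intro exI[of _ ?F]) auto
qed

section \<open>Cutting compact sets\<close>

text \<open>Centres come from a countable dense set, radii from the rationals. Interpolation between
  compact and open sets, and replacement of a cover at bounded cost, are what later turns
  cuttability into a countable condition.\<close>

lemma countable_ball_families:
  obtains \<F> :: "('a::euclidean_space \<times> real) set set" where
    "countable \<F>" "\<And>F. F \<in> \<F> \<Longrightarrow> finite F \<and> (\<forall>(x, r)\<in>F. 0 < r)"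
    "\<And>A V. compact A \<Longrightarrow> open V \<Longrightarrow> A \<subseteq> V \<Longrightarrow>
      \<exists>F\<in>\<F>. A \<subseteq> ball_union F \<and> closure (ball_union F) \<subseteq> V"
    "\<And>F t. finite F \<Longrightarrow> (\<forall>(x, r)\<in>F. 0 < r) \<Longrightarrow> 0 \<le> t \<Longrightarrow>
      \<exists>G\<in>\<F>. ball_union F \<subseteq> ball_union G \<and> ball_cost t G \<le> 2 powr t * ball_cost t F"
proof -
  obtain D :: "'a set" where D: "countable D" "\<And>X. open X \<Longrightarrow> X \<noteq> {} \<Longrightarrow> \<exists>d\<in>D. d \<in> X"
    using countable_dense_setE by blast
  define B where "B = D \<times> (\<rat> \<inter> {0<..} :: real set)"
  define \<F> where "\<F> = {F. finite F \<and> F \<subseteq> B}"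
  have cB: "countable B"
    using D(1) countable_rat by (auto simp: B_def intro!: countable_SIGMA countable_Int1)
  \<comment> \<open>The centre satisfies \<open>dist x c < a / 2\<close> and the radius lies between
    \<open>3 * a / 2\<close> and \<open>2 * a\<close>: then \<open>a + a / 2 < r\<close> gives the
    first inclusion and \<open>r + a / 2 < 3 * a\<close> the second.\<close>
  have near: "\<exists>c r. (c, r) \<in> B \<and> x \<in> ball c r \<and> ball x a \<subseteq> ball c r \<and> 0 \<le> r \<and> r \<le> 2 * a
      \<and> cball c r \<subseteq> ball x (3 * a)" if a: "0 < a" for x :: 'a and a :: real
  proof -
    obtain c where c: "c \<in> D" "dist x c < a / 2"
    proof -
      have "x \<in> ball x (a / 2)" using a by simp
      then have "ball x (a / 2) \<noteq> {}" by blast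
      then obtain d where "d \<in> D" "d \<in> ball x (a / 2)" using D(2)[of "ball x (a / 2)"] by auto
      then show ?thesis using that(1)[of d] by simp
    qed
    obtain r where r: "r \<in> \<rat>" "3 * a / 2 < r" "r < 2 * a"
      using Rats_dense_in_real[of "3 * a / 2" "2 * a"] a by auto
    have "ball x a \<subseteq> ball c r"
    proof
      fix y assume "y \<in> ball x a"
      then show "y \<in> ball c r" using c r dist_triangle[of c y x] by (simp add: dist_commute)
    qed
    moreover have "cball c r \<subseteq> ball x (3 * a)"
    proof
      fix y assume "y \<in> cball c r"
      then show "y \<in> ball x (3 * a)" using c r dist_triangle[of x y c] by (simp add: dist_commute)
    qed
    ultimately show ?thesis
      using c r a by (intro exI[of _ c] exI[of _ r] conjI) (simp_all add: B_def dist_commute)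
  qed
  show thesis
  proof
    show "countable \<F>"
      unfolding \<F>_def using cB by (rule countable_Collect_finite_subset)
    show "finite F \<and> (\<forall>(x, r)\<in>F. 0 < r)" if "F \<in> \<F>" for F
      using that by (auto simp: \<F>_def B_def)
    show "\<exists>F\<in>\<F>. A \<subseteq> ball_union F \<and> closure (ball_union F) \<subseteq> V"
      if A: "compact A" and "open V" "A \<subseteq> V" for A V :: "'a set"
    proof -
      let ?B = "{p\<in>B. cball (fst p) (snd p) \<subseteq> V}"
      have cov: "A \<subseteq> (\<Union>p\<in>?B. ball (fst p) (snd p))"
      proof
        fix x assume "x \<in> A"
        then obtain e where e: "0 < e" "ball x e \<subseteq> V"
          using \<open>open V\<close> \<open>A \<subseteq> V\<close> by (meson open_contains_ball subsetD)
        obtain c r where "(c, r) \<in> B" "x \<in> ball c r" "cball c r \<subseteq> ball x e"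
          using near[of "e / 3" x] e by auto
        then show "x \<in> (\<Union>p\<in>?B. ball (fst p) (snd p))" using e by force
      qed
      obtain F where F: "F \<subseteq> ?B" "finite F" "A \<subseteq> (\<Union>p\<in>F. ball (fst p) (snd p))"
        using compactE_image[OF A _ cov] by auto
      have "closure (ball_union F) \<subseteq> (\<Union>p\<in>F. cball (fst p) (snd p))"
        using F(2) by (intro closure_minimal closed_UN)
          (auto simp: ball_union_def case_prod_beta intro: less_imp_le)
      then show ?thesis
        using F by (intro bexI[of _ F]) (auto simp: \<F>_def ball_union_def case_prod_beta)
    qed
    show "\<exists>G\<in>\<F>. ball_union F \<subseteq> ball_union G \<and> ball_cost t G \<le> 2 powr t * ball_cost t F"
      if F: "finite F" "\<forall>(x, r)\<in>F. 0 < r" and t: "0 \<le> t" for F :: "('a \<times> real) set" and t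
    proof -
      have "\<exists>q. q \<in> B \<and> ball (fst p) (snd p) \<subseteq> ball (fst q) (snd q) \<and> 0 \<le> snd q \<and> snd q \<le> 2 * snd p"
        if "p \<in> F" for p
        using near[of "snd p" "fst p"] F that by fastforce
      then obtain g where g: "\<And>p. p \<in> F \<Longrightarrow> g p \<in> B \<and> ball (fst p) (snd p) \<subseteq> ball (fst (g p)) (snd (g p)) \<and>
          0 \<le> snd (g p) \<and> snd (g p) \<le> 2 * snd p" by metis
      have "ball_union F \<subseteq> ball_union (g ` F)"
        using g by (force simp: ball_union_def case_prod_beta)
      moreover have "ball_cost t (g ` F) \<le> 2 powr t * ball_cost t F"
        using F t g by (intro ball_cost_image_le) force+
      moreover have "g ` F \<in> \<F>" using F g by (auto simp: \<F>_def)
      ultimately show ?thesis by blast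
    qed
  qed
qed

lemma compact_open_interpolate:
  fixes A :: "'a::euclidean_space set"
  assumes "compact A" "open V" "A \<subseteq> V"
  obtains U where "open U" "A \<subseteq> U" "closure U \<subseteq> V"
proof -
  obtain \<F> :: "('a \<times> real) set set" where
    "\<And>A V. compact A \<Longrightarrow> open V \<Longrightarrow> A \<subseteq> V \<Longrightarrow>
      \<exists>F\<in>\<F>. A \<subseteq> ball_union F \<and> closure (ball_union F) \<subseteq> V"
    by (rule countable_ball_families) (rule that, blast)
  then obtain F where "A \<subseteq> ball_union F \<and> closure (ball_union F) \<subseteq> V"
    using assms by blast
  then show thesis using that by blast
qed

text \<open>\<open>U\<close> is open in the ambient space and \<open>K\<close> enters only through
  \<open>K \<inter> frontier U\<close>; this makes the property pass to subsets of
  \<open>K\<close>.\<close>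

definition cuttable :: "real \<Rightarrow> 'a::metric_space set \<Rightarrow> bool" where
  "cuttable t K \<longleftrightarrow> (\<forall>A V \<epsilon>. compact A \<and> open V \<and> A \<subseteq> V \<and> 0 < \<epsilon> \<longrightarrow>
    (\<exists>U. open U \<and> A \<subseteq> U \<and> closure U \<subseteq> V \<and> coverable t \<epsilon> (K \<inter> frontier U)))"

lemma cuttableD:
  assumes "cuttable t K" "compact A" "open V" "A \<subseteq> V" "0 < \<epsilon>"
  obtains U where "open U" "A \<subseteq> U" "closure U \<subseteq> V" "coverable t \<epsilon> (K \<inter> frontier U)"
  using assms unfolding cuttable_def by metis

lemma cuttable_empty: "cuttable t ({} :: 'a::euclidean_space set)"
  unfolding cuttable_def
proof (intro allI impI, elim conjE)
  fix A V :: "'a set" and \<epsilon> :: real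
  assume "compact A" "open V" "A \<subseteq> V" "0 < \<epsilon>"
  then show "\<exists>U. open U \<and> A \<subseteq> U \<and> closure U \<subseteq> V \<and> coverable t \<epsilon> ({} \<inter> frontier U)"
    using compact_open_interpolate[of A V] coverable_empty[of \<epsilon> t] by (metis Int_empty_left)
qed

lemma cuttable_subset: "cuttable t K \<Longrightarrow> K' \<subseteq> K \<Longrightarrow> cuttable t K'"
  unfolding cuttable_def by (meson coverable_mono Int_mono order_refl)

text \<open>Once cuts of small cost exist at every position, the cut \<open>frontier U\<close> can be pushed into smaller
  and smaller neighbourhoods \<open>W\<close> of the previous cut, and the limit is a cut of measure zero.\<close>

lemma cuttable_imp_null_frontier:
  fixes K :: "'a::euclidean_space set"
  assumes K: "compact K" "cuttable t K" "0 \<le> t" and x: "x \<in> K" "open V" "x \<in> V"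
  obtains U where "open U" "x \<in> U" "K \<inter> U \<subseteq> V" "\<And>\<epsilon>. 0 < \<epsilon> \<Longrightarrow> coverable t \<epsilon> (K \<inter> closure (K \<inter> U) - U)"
proof -
  \<comment> \<open>A state is a compact core, contained in all open sets chosen from then on,
    together with an open bound that contains them.\<close>
  define P where "P = (\<lambda>p :: 'a set \<times> 'a set. compact (fst p) \<and> open (snd p) \<and> fst p \<subseteq> snd p)"
  define R where "R i p q U F \<longleftrightarrow> open U \<and> fst p \<subseteq> U \<and> closure U \<subseteq> snd p \<and>
      finite F \<and> (\<forall>(x, r)\<in>F. 0 < r) \<and> K \<inter> frontier U \<subseteq> ball_union F \<and> ball_cost t F < 1 / real (Suc i) \<and>
      fst q = K \<inter> closure U \<and> snd q = (U \<union> ball_union F) \<inter> snd p"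
    for i :: nat and p q :: "'a set \<times> 'a set" and U F
  have "\<exists>f. \<forall>n. (P (f n) \<and> (n = 0 \<longrightarrow> f n = ({x}, V))) \<and> (\<exists>U F. R n (f n) (f (Suc n)) U F)"
  proof (rule dependent_nat_choice)
    show "\<exists>p. P p \<and> (0 = (0::nat) \<longrightarrow> p = ({x}, V))" using x by (auto simp: P_def)
    fix p and n :: nat assume p: "P p \<and> (n = 0 \<longrightarrow> p = ({x}, V))"
    then obtain U where U: "open U" "fst p \<subseteq> U" "closure U \<subseteq> snd p" "coverable t (1 / real (Suc n)) (K \<inter> frontier U)"
      using cuttableD[OF K(2), of "fst p" "snd p" "1 / real (Suc n)"] unfolding P_def by auto
    then obtain F where F: "finite F" "\<forall>(x, r)\<in>F. 0 < r" "K \<inter> frontier U \<subseteq> ball_union F" "ball_cost t F < 1 / real (Suc n)"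
      unfolding coverable_def by metis
    let ?q = "(K \<inter> closure U, (U \<union> ball_union F) \<inter> snd p)"
    have "closure U - U = frontier U" using U(1) by (simp add: frontier_def interior_open)
    then have "K \<inter> closure U \<subseteq> (U \<union> ball_union F) \<inter> snd p" using U(3) F(3) by blast
    then have "P ?q"
      using U(1) p K(1) by (auto simp: P_def intro: compact_Int_closed)
    moreover have "R n p ?q U F" using U F by (simp add: R_def)
    ultimately show "\<exists>q. (P q \<and> (Suc n = 0 \<longrightarrow> q = ({x}, V))) \<and> (\<exists>U F. R n p q U F)" by blast
  qed
  then obtain f where f: "\<And>n. P (f n)" "f 0 = ({x}, V)" "\<And>n. \<exists>U F. R n (f n) (f (Suc n)) U F"
    by metis
  then obtain U F where "\<And>n. R n (f n) (f (Suc n)) (U n) (F n)" by metis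
  then have U: "open (U n)" "fst (f n) \<subseteq> U n" "closure (U n) \<subseteq> snd (f n)"
      "finite (F n)" "\<forall>(x, r)\<in>F n. 0 < r" "ball_cost t (F n) < 1 / real (Suc n)"
      "fst (f (Suc n)) = K \<inter> closure (U n)" "snd (f (Suc n)) = (U n \<union> ball_union (F n)) \<inter> snd (f n)" for n
    unfolding R_def by simp_all
  have "snd (f m) \<subseteq> snd (f n)" if "n \<le> m" for m n
    using that by (rule lift_Suc_antimono_le[rotated]) (simp add: U)
  then have anti: "U m \<subseteq> snd (f n)" if "n \<le> m" for m n
    using that U(3)[of m] closure_subset[of "U m"] by (meson subset_trans)
  have step: "K \<inter> closure (U n) \<subseteq> U (Suc n)" for n using U(2)[of "Suc n"] U(7) by simp
  have mono: "K \<inter> U m \<subseteq> U n" if "m \<le> n" for m n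
    using that
  proof (induction n rule: dec_induct)
    case (step n)
    then show ?case using closure_subset[of "U n"] \<open>\<And>n. K \<inter> closure (U n) \<subseteq> U (Suc n)\<close>[of n] by blast
  qed auto
  let ?U = "\<Union>n. U n"
  \<comment> \<open>Within \<open>K\<close>, the sets chosen before stage \<open>n\<close> lie in
    \<open>U n\<close>, and those chosen later lie in the bound of stage
    \<open>Suc n\<close>.\<close>
  have sub: "K \<inter> ?U \<subseteq> U n \<union> ball_union (F n)" for n
  proof
    fix y assume "y \<in> K \<inter> ?U"
    then obtain m where m: "y \<in> K" "y \<in> U m" by auto
    show "y \<in> U n \<union> ball_union (F n)"
    proof (cases "m \<le> n")
      case True
      then show ?thesis using mono m by blast
    next
      case False
      then have "y \<in> snd (f (Suc n))" using anti[of "Suc n" m] m by auto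
      then show ?thesis using U(8) by auto
    qed
  qed
  \<comment> \<open>Points of \<open>K\<close> in \<open>closure (U n)\<close> belong to
    \<open>U (Suc n)\<close> and so to the union. Hence the boundary is carried by the balls of
    stage \<open>n\<close>, for every \<open>n\<close>.\<close>
  have null: "K \<inter> closure (K \<inter> ?U) - ?U \<subseteq> closure (ball_union (F n))" for n
  proof -
    have "closure (K \<inter> ?U) \<subseteq> closure (U n) \<union> closure (ball_union (F n))"
      using closure_mono[OF sub[of n]] by (simp add: closure_Un)
    then show ?thesis using step[of n] by blast
  qed
  show thesis
  proof
    show "open ?U" using U(1) by auto
    show "x \<in> ?U" using U(2)[of 0] f(2) by auto
    show "K \<inter> ?U \<subseteq> V" using anti[of 0] f(2) by auto
    fix \<epsilon> :: real assume "0 < \<epsilon>"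
    then obtain n where n: "1 / real (Suc n) < \<epsilon> / 2 powr t"
      using nat_approx_posE[of "\<epsilon> / 2 powr t"] by auto
    have "coverable t (2 powr t * (\<epsilon> / 2 powr t)) (closure (ball_union (F n)))"
      using U(4-6)[of n] n assms(3) by (intro coverable_closure_ball_union) auto
    then show "coverable t \<epsilon> (K \<inter> closure (K \<inter> ?U) - ?U)"
      using null[of n] by (auto intro: coverable_mono)
  qed
qed

lemma frontier_of_top_of_set:
  assumes "openin (top_of_set K) U"
  shows "(top_of_set K) frontier_of U = K \<inter> closure U - U"
  using assms openin_imp_subset[OF assms]
  by (simp add: frontier_of_def interior_of_openin closure_of_subtopology Int_absorb1)

text \<open>Finitely many base sets with closure in \<open>V\<close> cover
  \<open>K \<inter> A\<close>. The boundary of their union \<open>W\<close> relative to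
  \<open>K\<close> lies in cheap balls; what remains is to extend this relative cut to the ambient
  space.\<close>

lemma cuttable_if_base:
  fixes K :: "'a::euclidean_space set"
  assumes K: "compact K" and base: "is_open_base (top_of_set K) \<U>"
    and null: "\<And>U \<epsilon>. U \<in> \<U> \<Longrightarrow> 0 < \<epsilon> \<Longrightarrow> coverable t \<epsilon> ((top_of_set K) frontier_of U)"
  shows "cuttable t K"
  unfolding cuttable_def
proof (intro allI impI, elim conjE)
  fix A V :: "'a set" and \<epsilon> :: real
  assume A: "compact A" "open V" "A \<subseteq> V" and "0 < \<epsilon>"
  have "\<exists>U T. U \<in> \<U> \<and> x \<in> U \<and> closure U \<subseteq> V \<and> open T \<and> U = K \<inter> T" if "x \<in> K \<inter> A" for x
  proof -
    have "x \<in> V" using that A by auto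
    then obtain e where e: "0 < e" "cball x e \<subseteq> V"
      using A(2) open_contains_cball by blast
    have "openin (top_of_set K) (K \<inter> ball x e)" by (simp add: openin_open_Int)
    then obtain \<V> where "\<V> \<subseteq> \<U>" "K \<inter> ball x e = \<Union>\<V>"
      using base unfolding is_open_base_def by metis
    moreover have "x \<in> K \<inter> ball x e" using that e by simp
    ultimately obtain U where U: "U \<in> \<U>" "x \<in> U" "U \<subseteq> ball x e" by blast
    have "closure U \<subseteq> cball x e"
      using U(3) by (meson ball_subset_cball closed_cball closure_minimal order_trans)
    moreover obtain T where "open T" "U = K \<inter> T"
      using U(1) base unfolding is_open_base_def openin_open by metis
    ultimately show ?thesis using U e by blast
  qed
  then obtain U T where UT: "\<And>x. x \<in> K \<inter> A \<Longrightarrow> U x \<in> \<U> \<and> x \<in> U x \<and> closure (U x) \<subseteq> V \<and> open (T x) \<and> U x = K \<inter> T x"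
    by metis
  have cov: "K \<inter> A \<subseteq> (\<Union>x\<in>K \<inter> A. T x)" using UT by blast
  obtain J where J: "J \<subseteq> K \<inter> A" "finite J" "K \<inter> A \<subseteq> (\<Union>x\<in>J. T x)"
    using compactE_image[OF compact_Int[OF K A(1)] _ cov] UT by metis
  have UJ: "U x \<in> \<U>" "closure (U x) \<subseteq> V" "open (T x)" "U x = K \<inter> T x" if "x \<in> J" for x
    using UT[of x] J(1) that by blast+
  define W where "W = (\<Union>x\<in>J. U x)"
  define Y where "Y = (\<Union>x\<in>J. T x)"
  have WY: "W = K \<inter> Y" "open Y" using UJ(3,4) by (auto simp: W_def Y_def)
  have clW: "closure W = (\<Union>x\<in>J. closure (U x))" 
    unfolding W_def using J(2) by (induction J rule: finite_induct) auto
  have "coverable t \<epsilon> (\<Union>x\<in>J. (top_of_set K) frontier_of U x)"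
  proof (rule coverable_UN[OF J(2) _ \<open>0 < \<epsilon>\<close>])
    show "coverable t e ((top_of_set K) frontier_of U x)" if "x \<in> J" "0 < e" for x e
      using null[of "U x" e] UT[of x] J(1) that by blast
  qed
  then obtain F where F: "finite F" "\<forall>(x, r)\<in>F. 0 < r"
      "(\<Union>x\<in>J. (top_of_set K) frontier_of U x) \<subseteq> ball_union F" "ball_cost t F < \<epsilon>"
    unfolding coverable_def by metis
  have fr: "K \<inter> closure W - W \<subseteq> ball_union F"
  proof -
    have "(top_of_set K) frontier_of U x = K \<inter> closure (U x) - U x" if "x \<in> J" for x
      using UJ(1)[OF that] base by (intro frontier_of_top_of_set) (simp add: is_open_base_def)
    then have "(\<Union>x\<in>J. K \<inter> closure (U x) - U x) \<subseteq> ball_union F" using F(3) by simp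
    then show ?thesis unfolding clW by (force simp: W_def)
  qed
  \<comment> \<open>Off the balls, \<open>K\<close> splits into the part in \<open>W\<close>, which
    \<open>?P\<close> contains, and \<open>?R\<close>. An open set that contains \<open>?P\<close>
    and whose closure misses \<open>?R\<close> can have boundary points in \<open>K\<close> only
    inside the balls.\<close>
  let ?P = "(K \<inter> closure W - ball_union F) \<union> A" and ?R = "K - Y - ball_union F"
  have "compact ?P"
    by (intro compact_Un A compact_diff compact_Int_closed K) auto
  moreover have "closed ?R"
    using K WY by (intro closed_Diff compact_imp_closed) auto
  moreover have "?P \<subseteq> V - ?R"
  proof -
    have "closure W \<subseteq> V" using UJ(2) clW by blast
    moreover have "K \<inter> A \<subseteq> Y" using J(3) by (simp add: Y_def)
    moreover have "K \<inter> closure W - ball_union F \<subseteq> Y" using fr WY(1) by blast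
    ultimately show ?thesis using A(3) by blast
  qed
  ultimately obtain U' where U': "open U'" "?P \<subseteq> U'" "closure U' \<subseteq> V - ?R"
    using compact_open_interpolate[of ?P "V - ?R"] A(2) by (metis open_Diff)
  have "K \<inter> frontier U' \<subseteq> ball_union F"
  proof
    fix x assume x: "x \<in> K \<inter> frontier U'"
    then have "x \<in> closure U'" "x \<notin> U'" using U'(1) by (auto simp: frontier_def interior_open)
    show "x \<in> ball_union F"
    proof (rule ccontr)
      assume "x \<notin> ball_union F"
      then have "x \<in> W" using \<open>x \<in> closure U'\<close> U'(3) x WY by auto
      then have "x \<in> ?P" using x \<open>x \<notin> ball_union F\<close> closure_subset by auto
      then show False using U' \<open>x \<notin> U'\<close> by auto
    qed
  qed
  then have "coverable t \<epsilon> (K \<inter> frontier U')" using F unfolding coverable_def by blast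
  then show "\<exists>U. open U \<and> A \<subseteq> U \<and> closure U \<subseteq> V \<and> coverable t \<epsilon> (K \<inter> frontier U)"
    using U' by blast
qed

text \<open>Exponents strictly above \<open>d - 1\<close> absorb the infima in both notions of
  dimension: in one direction there is a measure-zero exponent below \<open>t\<close>, in the other
  \<open>t + 1\<close> is an admissible bound for each such \<open>t\<close>.\<close>

theorem topological_hausdorff_dim_le_iff:
  fixes K :: "'a::euclidean_space set"
  assumes K: "compact K" and d: "0 \<le> d"
  shows "topological_hausdorff_dim K \<le> ereal d \<longleftrightarrow> (\<forall>t\<in>{t\<in>\<rat>. 0 \<le> t \<and> d - 1 < t}. cuttable t K)"
proof (cases "K = {}")
  case True
  have "- 1 \<le> ereal d" using d by (simp add: one_ereal_def)
  then show ?thesis using True by (simp add: topological_hausdorff_dim_def cuttable_empty)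
next
  case False
  define S where "S = {d :: ereal. \<exists>\<U>. is_open_base (top_of_set K) \<U> \<and>
                 (\<forall>U\<in>\<U>. hausdorff_dim ((top_of_set K) frontier_of U) \<le> d - 1)}"
  have dim: "topological_hausdorff_dim K = Inf S"
    using False by (simp add: topological_hausdorff_dim_def S_def)
  have comp: "compact ((top_of_set K) frontier_of U)" for U
    using closedin_compact[OF K closedin_frontier_of] .
  show ?thesis
  proof (intro iffI ballI)
    fix t assume le: "topological_hausdorff_dim K \<le> ereal d" and "t \<in> {t\<in>\<rat>. 0 \<le> t \<and> d - 1 < t}"
    then have t: "0 \<le> t" "d < t + 1" by auto
    then have "Inf S < ereal (t + 1)"
      using le dim by (metis less_ereal.simps(1) order_le_less_trans)
    then obtain d' where "d' \<in> S" and d': "d' < ereal (t + 1)" by (meson Inf_less_iff)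
    then obtain \<U> where \<U>: "is_open_base (top_of_set K) \<U>"
      "\<forall>U\<in>\<U>. hausdorff_dim ((top_of_set K) frontier_of U) \<le> d' - 1" by (auto simp: S_def)
    have d't: "d' - 1 < ereal t" using d' by (cases d') (auto simp: one_ereal_def)
    show "cuttable t K"
    proof (rule cuttable_if_base[OF K \<U>(1)])
      fix U and \<epsilon> :: real assume "U \<in> \<U>" "0 < \<epsilon>"
      let ?D = "(top_of_set K) frontier_of U"
      show "coverable t \<epsilon> ?D"
      proof (cases "?D = {}")
        case True
        then show ?thesis using \<open>0 < \<epsilon>\<close> by (simp add: coverable_empty)
      next
        case False
        have "hausdorff_dim ?D < ereal t" using \<U>(2) \<open>U \<in> \<U>\<close> d't by (meson order_le_less_trans)
        then have "Inf (ereal ` {s. 0 \<le> s \<and> hausdorff_measure s ?D = 0}) < ereal t"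
          using False by (simp only: hausdorff_dim_def if_False)
        then obtain s where s: "0 \<le> s" "s < t" "hausdorff_measure s ?D = 0"
          unfolding Inf_less_iff by auto
        \<comment> \<open>The cap at \<open>1\<close> is what allows raising the exponent from
          \<open>s\<close> to \<open>t\<close>.\<close>
        have "coverable s (min \<epsilon> 1) ?D"
          using \<open>0 < \<epsilon>\<close> s by (intro coverable_if_hausdorff_measure_0 comp) auto
        then have "coverable t (min \<epsilon> 1) ?D"
          by (rule coverable_exponent_mono) (use s in auto)
        then show ?thesis by (rule coverable_mono) auto
      qed
    qed
  next
    assume cut: "\<forall>t\<in>{t\<in>\<rat>. 0 \<le> t \<and> d - 1 < t}. cuttable t K"
    define B where
      "B t = {U. openin (top_of_set K) U \<and> (\<forall>\<epsilon>>0. coverable t \<epsilon> ((top_of_set K) frontier_of U))}" for t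
    have base: "is_open_base (top_of_set K) (B t)" if t: "t \<in> \<rat>" "0 \<le> t" "d - 1 < t" for t
      unfolding is_open_base_def
    proof (intro conjI allI impI)
      show "\<forall>U\<in>B t. openin (top_of_set K) U" by (simp add: B_def)
      fix W assume W: "openin (top_of_set K) W"
      then obtain V where V: "open V" "W = K \<inter> V" by (auto simp: openin_open)
      have ex: "\<exists>U\<in>B t. x \<in> U \<and> U \<subseteq> W" if "x \<in> W" for x
      proof -
        have x: "cuttable t K" "x \<in> K" "x \<in> V" using cut t that V by auto
        obtain U where U: "open U" "x \<in> U" "K \<inter> U \<subseteq> V"
            "\<And>\<epsilon>. 0 < \<epsilon> \<Longrightarrow> coverable t \<epsilon> (K \<inter> closure (K \<inter> U) - U)"
          by (rule cuttable_imp_null_frontier[OF K x(1) t(2) x(2) V(1) x(3)]) blast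
        have o: "openin (top_of_set K) (K \<inter> U)" using U(1) by (simp add: openin_open_Int)
        have "K \<inter> closure (K \<inter> U) - K \<inter> U = K \<inter> closure (K \<inter> U) - U" by auto
        then have "K \<inter> U \<in> B t" using U(4) o by (simp add: frontier_of_top_of_set B_def)
        moreover have "x \<in> K \<inter> U" "K \<inter> U \<subseteq> W" using U(2,3) x(2) V(2) by auto
        ultimately show ?thesis by blast
      qed
      show "\<exists>\<V>\<subseteq>B t. W = \<Union>\<V>"
      proof (intro exI conjI)
        show "{U\<in>B t. U \<subseteq> W} \<subseteq> B t" by auto
        show "W = \<Union>{U\<in>B t. U \<subseteq> W}" using ex by auto
      qed
    qed
    have S: "ereal (t + 1) \<in> S" if t: "t \<in> \<rat>" "0 \<le> t" "d - 1 < t" for t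
    proof -
      have "hausdorff_dim ((top_of_set K) frontier_of U) \<le> ereal (t + 1) - 1" if "U \<in> B t" for U
      proof -
        have "hausdorff_measure t ((top_of_set K) frontier_of U) = 0"
          using that t(2) by (intro hausdorff_measure_0_if_coverable) (auto simp: B_def)
        then have "hausdorff_dim ((top_of_set K) frontier_of U) \<le> ereal t"
          using t(2) by (auto simp: hausdorff_dim_def one_ereal_def intro!: Inf_lower)
        then show ?thesis by (simp add: one_ereal_def)
      qed
      then show ?thesis using base[OF t] unfolding S_def by blast
    qed
    have "Inf S \<le> ereal d"
    \<comment> \<open>For \<open>d < 1\<close> the exponent \<open>0\<close> is admissible, and its
      null boundaries are empty, of dimension \<open>- 1 \<le> d - 1\<close>. Bounds of the form
      \<open>t + 1\<close> with \<open>t \<ge> 0\<close> could not go below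
      \<open>1\<close>.\<close>
    proof (cases "d < 1")
      case True
      have "hausdorff_dim ((top_of_set K) frontier_of U) \<le> ereal d - 1" if "U \<in> B 0" for U
      proof -
        have "(top_of_set K) frontier_of U = {}"
          using that by (simp add: B_def coverable_zero_iff_empty)
        then show ?thesis using d by (simp add: hausdorff_dim_def one_ereal_def)
      qed
      then have "ereal d \<in> S" using base[of 0] True unfolding S_def by auto
      then show ?thesis by (rule Inf_lower)
    next
      case False
      show ?thesis
      proof (rule ereal_le_epsilon2)
        fix e :: real assume "0 < e"
        then obtain t where t: "t \<in> \<rat>" "d - 1 < t" "t < d - 1 + e"
          using Rats_dense_in_real[of "d - 1" "d - 1 + e"] by auto
        then have "Inf S \<le> ereal (t + 1)" using S False by (intro Inf_lower) auto
        also have "\<dots> \<le> ereal d + ereal e" using t by simp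
        finally show "Inf S \<le> ereal d + ereal e" .
      qed
    qed
    then show "topological_hausdorff_dim K \<le> ereal d" using dim by simp
  qed
qed

section \<open>Invariance of cuttability under similarities\<close>

lemma coverable_affine:
  fixes c :: "'a::real_normed_vector"
  assumes "0 < s" "0 \<le> t" and cov: "coverable t (s powr t * \<epsilon>) ((\<lambda>x. c + s *\<^sub>R x) ` S)"
  shows "coverable t \<epsilon> S"
proof -
  obtain F where F: "finite F" "\<forall>(x, r)\<in>F. 0 < r" "(\<lambda>x. c + s *\<^sub>R x) ` S \<subseteq> ball_union F"
      "ball_cost t F < s powr t * \<epsilon>"
    using cov unfolding coverable_def by metis
  let ?g = "\<lambda>(x, r). ((x - c) /\<^sub>R s, r / s)"
  have "ball_cost t (?g ` F) \<le> (1 / s) powr t * ball_cost t F"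
    using F assms by (intro ball_cost_image_le) auto
  also have "\<dots> < (1 / s) powr t * (s powr t * \<epsilon>)" using F(4) assms by simp
  also have "\<dots> = \<epsilon>" using assms by (simp add: powr_divide)
  finally have "ball_cost t (?g ` F) < \<epsilon>" .
  moreover have "S \<subseteq> ball_union (?g ` F)"
  proof
    fix x assume "x \<in> S"
    then obtain y r where yr: "(y, r) \<in> F" "dist y (c + s *\<^sub>R x) < r"
      using F(3) by (force simp: ball_union_def)
    have "(y - c) /\<^sub>R s - x = (y - (c + s *\<^sub>R x)) /\<^sub>R s"
      using assms(1) by (simp add: algebra_simps)
    then have "dist ((y - c) /\<^sub>R s) x = dist y (c + s *\<^sub>R x) / s"
      using assms(1) by (simp add: dist_norm divide_inverse)
    also have "\<dots> < r / s" using yr assms by (simp add: divide_strict_right_mono)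
    finally show "x \<in> ball_union (?g ` F)"
      using yr(1) by (force simp: ball_union_def)
  qed
  ultimately show ?thesis
    unfolding coverable_def using F assms by (intro exI[of _ "?g ` F"]) auto
qed

lemma cuttable_affine:
  fixes c :: "'a::euclidean_space"
  assumes s: "0 < s" and t: "0 \<le> t" and cut: "cuttable t ((\<lambda>x. c + s *\<^sub>R x) ` K)"
  shows "cuttable t K"
  unfolding cuttable_def
proof (intro allI impI, elim conjE)
  fix A V :: "'a set" and \<epsilon> :: real
  assume A: "compact A" "open V" "A \<subseteq> V" and "0 < \<epsilon>"
  let ?f = "\<lambda>x. c + s *\<^sub>R x"
  have cont: "continuous_on UNIV ?f" by (intro continuous_intros)
  have inj: "inj ?f" using s by (auto simp: inj_def)
  have "open (?f ` V)" using open_affinity[OF A(2), of s c] s by simp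
  moreover have "compact (?f ` A)" using A(1) cont by (meson compact_continuous_image continuous_on_subset subset_UNIV)
  moreover have "?f ` A \<subseteq> ?f ` V" using A(3) by auto
  moreover have "0 < s powr t * \<epsilon>" using s \<open>0 < \<epsilon>\<close> by simp
  ultimately obtain U where U: "open U" "?f ` A \<subseteq> U" "closure U \<subseteq> ?f ` V"
      "coverable t (s powr t * \<epsilon>) (?f ` K \<inter> frontier U)"
    using cuttableD[OF cut] by metis
  let ?U = "?f -` U"
  have o: "open ?U" using U(1) cont by (simp add: open_vimage)
  have cl: "closure ?U \<subseteq> ?f -` closure U"
    using closure_subset cont by (intro closure_minimal closed_vimage) auto
  have "closure ?U \<subseteq> V"
    using cl U(3) inj by (auto simp: inj_def)
  moreover have "coverable t \<epsilon> (K \<inter> frontier ?U)"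
  proof (rule coverable_affine[OF s t])
    have "?f ` (K \<inter> frontier ?U) \<subseteq> ?f ` K \<inter> frontier U"
      using cl o U(1) by (auto simp: frontier_def interior_open)
    then show "coverable t (s powr t * \<epsilon>) (?f ` (K \<inter> frontier ?U))"
      using U(4) by (auto intro: coverable_mono)
  qed
  ultimately show "\<exists>U. open U \<and> A \<subseteq> U \<and> closure U \<subseteq> V \<and> coverable t \<epsilon> (K \<inter> frontier U)"
    using o U(2) by (intro exI[of _ ?U]) auto
qed

section \<open>Self-similarity of the percolation\<close>

text \<open>The configuration seen from inside the level-\<open>k\<close> square \<open>q\<close>.
  The restriction keeps it extensional, as points of the product space are.\<close>

definition percolation_shift ::
    "nat \<Rightarrow> nat \<Rightarrow> nat \<times> nat \<Rightarrow> (nat \<times> nat \<times> nat \<Rightarrow> bool) \<Rightarrow> nat \<times> nat \<times> nat \<Rightarrow> bool" where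
  "percolation_shift n k q \<omega> =
    (\<lambda>(l, i, j)\<in>percolation_indices n. \<omega> (k + l, fst q * n ^ l + i, snd q * n ^ l + j))"

definition percolation_embed :: "nat \<Rightarrow> nat \<Rightarrow> nat \<times> nat \<Rightarrow> real \<times> real \<Rightarrow> real \<times> real" where
  "percolation_embed n k q =
    (\<lambda>x. (real (fst q) / real n ^ k, real (snd q) / real n ^ k) + (1 / real n ^ k) *\<^sub>R x)"

lemma percolation_kept_bound:
  assumes "1 \<le> n"
  shows "(i, j) \<in> percolation_kept n \<omega> k \<Longrightarrow> i < n ^ k \<and> j < n ^ k"
proof (induction k arbitrary: i j)
  case (Suc k)
  then have "i div n < n ^ k" "j div n < n ^ k" by auto
  then show ?case using assms by (simp add: div_less_iff_less_mult mult.commute)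
qed simp

lemma percolation_kept_subset:
  assumes "1 \<le> n"
  shows "percolation_kept n \<omega> k \<subseteq> {..<n ^ k} \<times> {..<n ^ k}"
proof (rule subrelI)
  show "(i, j) \<in> {..<n ^ k} \<times> {..<n ^ k}" if "(i, j) \<in> percolation_kept n \<omega> k" for i j
    using percolation_kept_bound[OF assms that] by simp
qed

lemma finite_percolation_kept:
  assumes "1 \<le> n"
  shows "finite (percolation_kept n \<omega> k)"
  by (rule finite_subset[OF percolation_kept_subset[OF assms]]) simp

lemma percolation_kept_ancestor:
  "(i, j) \<in> percolation_kept n \<omega> (k + l) \<Longrightarrow> (i div n ^ l, j div n ^ l) \<in> percolation_kept n \<omega> k"
proof (induction l arbitrary: i j)
  case (Suc l)
  then have "(i div n, j div n) \<in> percolation_kept n \<omega> (k + l)" by simp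
  from Suc.IH[OF this] show ?case by (simp add: div_mult2_eq)
qed simp

lemma percolation_kept_shift:
  assumes n: "1 \<le> n" and q: "q \<in> percolation_kept n \<omega> k"
  shows "i < n ^ l \<Longrightarrow> j < n ^ l \<Longrightarrow>
    (fst q * n ^ l + i, snd q * n ^ l + j) \<in> percolation_kept n \<omega> (k + l) \<longleftrightarrow>
    (i, j) \<in> percolation_kept n (percolation_shift n k q \<omega>) l"
proof (induction l arbitrary: i j)
  case 0
  then show ?case using q by (cases q) auto
next
  case (Suc l)
  have div: "(a * n ^ Suc l + i) div n = a * n ^ l + i div n" for a i
    using n div_mult_self2[of n i "a * n ^ l"] by (simp add: algebra_simps)
  have "i div n < n ^ l" "j div n < n ^ l"
    using Suc.prems n by (simp_all add: div_less_iff_less_mult mult.commute)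
  then show ?case
    using Suc.IH[of "i div n" "j div n"] Suc.prems
    by (simp add: div percolation_shift_def percolation_indices_def del: power_Suc)
qed

lemma percolation_embed_square:
  assumes "1 \<le> n"
  shows "percolation_embed n k q ` percolation_square n l i j =
    percolation_square n (k + l) (fst q * n ^ l + i) (snd q * n ^ l + j)"
proof -
  have n: "0 < real n ^ k" "0 < real n ^ l" using assms by auto
  have seg: "(\<lambda>x. a / real n ^ k + x / real n ^ k) ` {i / real n ^ l..(i + 1) / real n ^ l} =
      {(a * n ^ l + i) / real n ^ (k + l)..((a * n ^ l + i) + 1) / real n ^ (k + l)}" for a i :: real
  proof -
    have "(\<lambda>x. a / real n ^ k + x / real n ^ k) = (\<lambda>x. (1 / real n ^ k) *\<^sub>R x + a / real n ^ k)" by auto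
    then show ?thesis
      using n by (simp only: image_affinity_atLeastAtMost real_scaleR_def)
        (auto simp: field_simps power_add)
  qed
  have "percolation_embed n k q =
      (\<lambda>(x, y). (real (fst q) / real n ^ k + x / real n ^ k, real (snd q) / real n ^ k + y / real n ^ k))"
    by (auto simp: percolation_embed_def fun_eq_iff)
  then have "percolation_embed n k q ` percolation_square n l i j =
    ((\<lambda>x. real (fst q) / real n ^ k + x / real n ^ k) ` {real i / real n ^ l..(real i + 1) / real n ^ l}) \<times>
    ((\<lambda>x. real (snd q) / real n ^ k + x / real n ^ k) ` {real j / real n ^ l..(real j + 1) / real n ^ l})"
    unfolding percolation_square_def by (simp only: image_paired_Times)
  then show ?thesis unfolding seg by (simp add: percolation_square_def)
qed

lemma percolation_square_child_subset:
  assumes "1 \<le> n"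
  shows "percolation_square n (k + l) i j \<subseteq> percolation_square n k (i div n ^ l) (j div n ^ l)"
proof -
  have "percolation_square n l (i mod n ^ l) (j mod n ^ l) \<subseteq> {0..1} \<times> {0..1}"
  proof -
    have "i mod n ^ l + 1 \<le> n ^ l" for i using assms by (simp add: Suc_leI)
    then have "real (i mod n ^ l + 1) \<le> real (n ^ l)" for i by (simp only: of_nat_le_iff)
    then have "(real (i mod n ^ l) + 1) / real n ^ l \<le> 1" for i using assms by (simp add: divide_le_eq add.commute)
    moreover have "0 \<le> real (i mod n ^ l) / real n ^ l" for i by simp
    ultimately show ?thesis
      unfolding percolation_square_def by (intro Sigma_mono) (simp_all only: atLeastatMost_subset_iff simp_thms)
  qed
  moreover have "percolation_square n 0 0 0 = {0..1} \<times> {0..1}" by (simp add: percolation_square_def)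
  ultimately have "percolation_embed n k (i div n ^ l, j div n ^ l) ` percolation_square n l (i mod n ^ l) (j mod n ^ l) \<subseteq>
      percolation_embed n k (i div n ^ l, j div n ^ l) ` percolation_square n 0 0 0"
    by (metis image_mono)
  then show ?thesis unfolding percolation_embed_square[OF assms] by (simp add: div_mult_mod_eq)
qed

section \<open>Compactness of the limit set\<close>

lemma percolation_step_antimono:
  assumes "1 \<le> n" "k \<le> m"
  shows "percolation_step n \<omega> m \<subseteq> percolation_step n \<omega> k"
proof -
  obtain l where l: "m = k + l" using assms(2) le_Suc_ex by blast
  show ?thesis
    unfolding percolation_step_def l
    using percolation_kept_ancestor percolation_square_child_subset[OF assms(1)] by fast
qed

lemma compact_percolation_square: "compact (percolation_square n k i j)"
  by (simp add: percolation_square_def compact_Times)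

lemma compact_percolation_step: "1 \<le> n \<Longrightarrow> compact (percolation_step n \<omega> k)"
  unfolding percolation_step_def
  by (intro compact_UN finite_percolation_kept) (auto simp: compact_percolation_square)

lemma percolation_limit_eq_INT:
  assumes "1 \<le> n"
  shows "percolation_limit n \<omega> = (\<Inter>k. percolation_step n \<omega> (m + k))"
proof
  show "percolation_limit n \<omega> \<subseteq> (\<Inter>k. percolation_step n \<omega> (m + k))"
  proof
    fix x assume x: "x \<in> percolation_limit n \<omega>"
    have "x \<in> percolation_step n \<omega> (m + k)" for k
    proof -
      have "x \<in> percolation_step n \<omega> (Suc (m + k))"
        using x by (auto simp: percolation_limit_def)
      then show ?thesis using percolation_step_antimono[OF assms, of "m + k" "Suc (m + k)"] by auto
    qed
    then show "x \<in> (\<Inter>k. percolation_step n \<omega> (m + k))" by simp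
  qed
  show "(\<Inter>k. percolation_step n \<omega> (m + k)) \<subseteq> percolation_limit n \<omega>"
  proof
    fix x assume x: "x \<in> (\<Inter>k. percolation_step n \<omega> (m + k))"
    have "x \<in> percolation_step n \<omega> k" for k
      using x percolation_step_antimono[OF assms, of k "m + k" \<omega>] by auto
    then show "x \<in> percolation_limit n \<omega>" by (simp add: percolation_limit_def)
  qed
qed

lemma percolation_limit_subset_step: "1 \<le> n \<Longrightarrow> percolation_limit n \<omega> \<subseteq> percolation_step n \<omega> k"
  using percolation_limit_eq_INT[of n \<omega> k] by (metis INT_lower UNIV_I add.right_neutral)

lemma compact_percolation_limit: "1 \<le> n \<Longrightarrow> compact (percolation_limit n \<omega>)"
  by (subst percolation_limit_eq_INT[of n \<omega> 0])
    (auto intro!: compact_Inter compact_percolation_step)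

text \<open>The steps are nested compact sets, so missing a closed set is already visible at a
  finite level. The measurability of events about the limit set rests on this.\<close>

lemma percolation_limit_disjoint_iff:
  assumes "1 \<le> n" "closed S"
  shows "percolation_limit n \<omega> \<inter> S = {} \<longleftrightarrow> (\<exists>k. percolation_step n \<omega> k \<inter> S = {})"
proof
  assume disj: "percolation_limit n \<omega> \<inter> S = {}"
  have "\<Inter>(range (\<lambda>k. percolation_step n \<omega> k \<inter> S)) \<noteq> {}"
    if "\<And>k. percolation_step n \<omega> k \<inter> S \<noteq> {}"
  proof (rule compact_nest)
    show "compact (percolation_step n \<omega> k \<inter> S)" for k
      using assms by (intro compact_Int_closed compact_percolation_step)
    show "percolation_step n \<omega> m \<inter> S \<subseteq> percolation_step n \<omega> k \<inter> S" if "k \<le> m" for k m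
      using percolation_step_antimono[OF assms(1) that] by blast
  qed (rule that)
  then show "\<exists>k. percolation_step n \<omega> k \<inter> S = {}"
    using disj percolation_limit_eq_INT[OF assms(1), of \<omega> 0] by auto
next
  assume "\<exists>k. percolation_step n \<omega> k \<inter> S = {}"
  then show "percolation_limit n \<omega> \<inter> S = {}"
    using percolation_limit_subset_step[OF assms(1)] by blast
qed

section \<open>Decomposition of the limit set over the kept squares\<close>

lemma percolation_step_shift:
  assumes "1 \<le> n"
  shows "percolation_step n \<omega> (k + l) =
    (\<Union>q\<in>percolation_kept n \<omega> k. percolation_embed n k q ` percolation_step n (percolation_shift n k q \<omega>) l)"
    (is "?L = ?R")
proof
  show "?L \<subseteq> ?R"
  proof
    fix x assume "x \<in> ?L"
    then obtain i j where ij: "(i, j) \<in> percolation_kept n \<omega> (k + l)" "x \<in> percolation_square n (k + l) i j"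
      unfolding percolation_step_def by auto
    define q where "q = (i div n ^ l, j div n ^ l)"
    have q: "q \<in> percolation_kept n \<omega> k" using ij percolation_kept_ancestor by (simp add: q_def)
    have dm: "i = fst q * n ^ l + i mod n ^ l" "j = snd q * n ^ l + j mod n ^ l"
      by (simp_all only: q_def fst_conv snd_conv div_mult_mod_eq)
    have lt: "i mod n ^ l < n ^ l" "j mod n ^ l < n ^ l" using assms by auto
    have "(i mod n ^ l, j mod n ^ l) \<in> percolation_kept n (percolation_shift n k q \<omega>) l"
      using percolation_kept_shift[OF assms q lt] ij dm by simp
    moreover have "x \<in> percolation_embed n k q ` percolation_square n l (i mod n ^ l) (j mod n ^ l)"
      using ij(2) dm percolation_embed_square[OF assms] by simp
    ultimately show "x \<in> ?R" using q unfolding percolation_step_def by fast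
  qed
  show "?R \<subseteq> ?L"
  proof
    fix x assume "x \<in> ?R"
    then obtain q i j where q: "q \<in> percolation_kept n \<omega> k"
      and ij: "(i, j) \<in> percolation_kept n (percolation_shift n k q \<omega>) l"
      and x: "x \<in> percolation_embed n k q ` percolation_square n l i j"
      unfolding percolation_step_def by fast
    have "(fst q * n ^ l + i, snd q * n ^ l + j) \<in> percolation_kept n \<omega> (k + l)"
      using percolation_kept_shift[OF assms q] percolation_kept_bound[OF assms ij] ij by simp
    then show "x \<in> ?L"
      using x unfolding percolation_embed_square[OF assms] percolation_step_def by fast
  qed
qed

text \<open>A limit point lying in no piece would leave each of the finitely many pieces at some
  level, hence all of them at a common level, and so fall outside a later step.\<close>

lemma percolation_limit_shift:
  assumes "1 \<le> n"
  shows "percolation_limit n \<omega> =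
    (\<Union>q\<in>percolation_kept n \<omega> k. percolation_embed n k q ` percolation_limit n (percolation_shift n k q \<omega>))"
    (is "?L = ?R")
proof
  have inj: "inj (percolation_embed n k q)" for q
    using assms by (auto simp: inj_def percolation_embed_def)
  show "?R \<subseteq> ?L"
  proof
    fix x assume "x \<in> ?R"
    then obtain q y where q: "q \<in> percolation_kept n \<omega> k"
      and y: "y \<in> percolation_limit n (percolation_shift n k q \<omega>)" "x = percolation_embed n k q y" by auto
    have "x \<in> percolation_step n \<omega> (k + l)" for l
      using percolation_limit_subset_step[OF assms, of "percolation_shift n k q \<omega>" l] y q
      unfolding percolation_step_shift[OF assms] by blast
    then show "x \<in> ?L" using percolation_limit_eq_INT[OF assms, of \<omega> k] by auto
  qed
  show "?L \<subseteq> ?R"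
  proof (rule subsetI, rule ccontr)
    fix x assume x: "x \<in> ?L" "x \<notin> ?R"
    let ?E = "\<lambda>q l. percolation_embed n k q ` percolation_step n (percolation_shift n k q \<omega>) l"
    have "\<exists>l. x \<notin> ?E q l" if "q \<in> percolation_kept n \<omega> k" for q
    proof (rule ccontr)
      assume "\<nexists>l. x \<notin> ?E q l"
      then have "x \<in> (\<Inter>l. ?E q l)" by auto
      also have "\<dots> = percolation_embed n k q ` (\<Inter>l. percolation_step n (percolation_shift n k q \<omega>) l)"
        by (rule image_INT[symmetric, OF inj]) auto
      also have "\<dots> = percolation_embed n k q ` percolation_limit n (percolation_shift n k q \<omega>)"
        using percolation_limit_eq_INT[OF assms, of _ 0] by simp
      finally show False using x that by auto
    qed
    then obtain l where l: "\<And>q. q \<in> percolation_kept n \<omega> k \<Longrightarrow> x \<notin> ?E q (l q)" by metis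
    define m where "m = Max (insert 0 (l ` percolation_kept n \<omega> k))"
    have "x \<notin> ?E q m" if "q \<in> percolation_kept n \<omega> k" for q
    proof -
      have "l q \<le> m" using that finite_percolation_kept[OF assms] by (auto simp: m_def)
      then show ?thesis using l[OF that] percolation_step_antimono[OF assms, of "l q" m] by blast
    qed
    then have "x \<notin> percolation_step n \<omega> (k + m)" unfolding percolation_step_shift[OF assms] by blast
    then show False using x percolation_limit_subset_step[OF assms] by blast
  qed
qed

lemma percolation_limit_empty_iff:
  assumes "1 \<le> n"
  shows "percolation_limit n \<omega> = {} \<longleftrightarrow>
    (\<forall>q\<in>percolation_kept n \<omega> k. percolation_limit n (percolation_shift n k q \<omega>) = {})"
  by (subst percolation_limit_shift[OF assms, of \<omega> k]) auto

text \<open>The embedded piece is a subset of the limit set, and the similarity can be undone. This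
  is the origin of the inequality \<open>x \<le> f(x)\<close>.\<close>

lemma cuttable_percolation_limit_shift:
  assumes "1 \<le> n" "0 \<le> t" "cuttable t (percolation_limit n \<omega>)" "q \<in> percolation_kept n \<omega> k"
  shows "cuttable t (percolation_limit n (percolation_shift n k q \<omega>))"
proof -
  have "percolation_embed n k q ` percolation_limit n (percolation_shift n k q \<omega>) \<subseteq> percolation_limit n \<omega>"
    using assms percolation_limit_shift[OF assms(1), of \<omega> k] by auto
  then have "cuttable t (percolation_embed n k q ` percolation_limit n (percolation_shift n k q \<omega>))"
    using assms(3) cuttable_subset by blast
  from this[unfolded percolation_embed_def] show ?thesis
    by (rule cuttable_affine[rotated 2]) (use assms in auto)
qed

lemma percolation_limit_mono:
  assumes "\<And>k. percolation_kept n \<omega> k \<subseteq> percolation_kept n \<omega>' k"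
  shows "percolation_limit n \<omega> \<subseteq> percolation_limit n \<omega>'"
proof -
  have "percolation_step n \<omega> k \<subseteq> percolation_step n \<omega>' k" for k
    unfolding percolation_step_def using assms by (intro UN_mono) auto
  then show ?thesis
    unfolding percolation_limit_def by blast
qed

section \<open>The percolation measure\<close>

lemma prob_space_percolation: "prob_space (percolation_space p n)"
  unfolding percolation_space_def by (intro prob_space_PiM prob_space_measure_pmf)

lemma pred_PiM_pmf_component:
  assumes "x \<in> J"
  shows "Measurable.pred (\<Pi>\<^sub>M _\<in>J. measure_pmf D) (\<lambda>\<omega>. \<omega> x)"
proof -
  have "(\<lambda>\<omega>. \<omega> x) \<in> measurable (\<Pi>\<^sub>M _\<in>J. measure_pmf D) (measure_pmf D)"
    using assms by measurable
  then show ?thesis by (simp add: measurable_cong_sets[where M' = "measure_pmf D" and N' = "count_space UNIV"])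
qed

section \<open>Measurability of events about the limit set\<close>

lemma pred_percolation_kept:
  assumes "1 \<le> n"
  shows "Measurable.pred (percolation_space p n) (\<lambda>\<omega>. (i, j) \<in> percolation_kept n \<omega> k)"
proof (induction k arbitrary: i j)
  case (Suc k)
  show ?case
  proof (cases "i < n ^ Suc k \<and> j < n ^ Suc k")
    case True
    then have "(Suc k, i, j) \<in> percolation_indices n" by (simp add: percolation_indices_def)
    then have "Measurable.pred (percolation_space p n) (\<lambda>\<omega>. \<omega> (Suc k, i, j))"
      unfolding percolation_space_def by (rule pred_PiM_pmf_component)
    then show ?thesis using Suc by simp
  next
    \<comment> \<open>Outside the grid nothing is kept, so coordinates outside the index set never
      influence the event.\<close>
    case False
    then have "(\<lambda>\<omega>. (i, j) \<in> percolation_kept n \<omega> (Suc k)) = (\<lambda>\<omega>. False)"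
      using percolation_kept_bound[OF assms] by blast
    then show ?thesis by simp
  qed
qed simp

lemma pred_percolation_limit_disjoint:
  assumes n: "1 \<le> n" and "closed S"
  shows "Measurable.pred (percolation_space p n) (\<lambda>\<omega>. percolation_limit n \<omega> \<inter> S = {})"
proof -
  have "percolation_step n \<omega> k \<inter> S = {} \<longleftrightarrow>
      (\<forall>q\<in>{..<n ^ k} \<times> {..<n ^ k}. (fst q, snd q) \<in> percolation_kept n \<omega> k \<longrightarrow> percolation_square n k (fst q) (snd q) \<inter> S = {})"
    for \<omega> k
    using percolation_kept_bound[OF n, of _ _ \<omega> k] unfolding percolation_step_def by fastforce
  then have "(\<lambda>\<omega>. percolation_limit n \<omega> \<inter> S = {}) =
      (\<lambda>\<omega>. \<exists>k. \<forall>q\<in>{..<n ^ k} \<times> {..<n ^ k}. (fst q, snd q) \<in> percolation_kept n \<omega> k \<longrightarrow> percolation_square n k (fst q) (snd q) \<inter> S = {})"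
    using percolation_limit_disjoint_iff[OF assms] by simp
  also have "Measurable.pred (percolation_space p n) \<dots>"
    by (intro pred_intros_countable pred_intros_finite pred_intros_logic pred_percolation_kept n) auto
  finally show ?thesis .
qed

lemma pred_percolation_limit_empty:
  "1 \<le> n \<Longrightarrow> Measurable.pred (percolation_space p n) (\<lambda>\<omega>. percolation_limit n \<omega> = {})"
  using pred_percolation_limit_disjoint[of n UNIV p] by simp

text \<open>The prescribed sets, the cut and its cover are all replaced by members of one sequence
  of ball unions, and the covering condition becomes disjointness of \<open>K\<close> from a closed
  set.\<close>

lemma cuttable_countable_criterion:
  fixes F :: "nat \<Rightarrow> ('a::euclidean_space \<times> real) set"
  assumes "\<And>i. finite (F i) \<and> (\<forall>(x, r)\<in>F i. 0 < r)"
    and inter: "\<And>A V. compact A \<Longrightarrow> open V \<Longrightarrow> A \<subseteq> V \<Longrightarrow>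
      \<exists>i. A \<subseteq> ball_union (F i) \<and> closure (ball_union (F i)) \<subseteq> V"
    and approx: "\<And>G t. finite G \<Longrightarrow> (\<forall>(x, r)\<in>G. 0 < r) \<Longrightarrow> 0 \<le> t \<Longrightarrow>
      \<exists>i. ball_union G \<subseteq> ball_union (F i) \<and> ball_cost t (F i) \<le> 2 powr t * ball_cost t G"
    and K: "compact K" and t: "0 \<le> t"
  shows "cuttable t K \<longleftrightarrow> (\<forall>a b m. closure (ball_union (F a)) \<subseteq> ball_union (F b) \<longrightarrow>
    (\<exists>u c. ball_union (F a) \<subseteq> ball_union (F u) \<and> closure (ball_union (F u)) \<subseteq> ball_union (F b) \<and>
      ball_cost t (F c) < 1 / real (Suc m) \<and> K \<inter> (frontier (ball_union (F u)) - ball_union (F c)) = {}))"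
    (is "_ \<longleftrightarrow> ?R")
proof
  assume cut: "cuttable t K"
  show ?R
  proof (intro allI impI)
    fix a b m :: nat
    let ?A = "closure (ball_union (F a))" and ?V = "ball_union (F b)"
    \<comment> \<open>Rounding the balls to members of the sequence may multiply the cost by
      \<open>2 powr t\<close>.\<close>
    define \<epsilon> where "\<epsilon> = 1 / real (Suc m) / 2 powr t"
    assume sub: "?A \<subseteq> ?V"
    have "bounded (ball_union (F a))"
      using assms(1)[of a] unfolding ball_union_def by (intro bounded_UN) auto
    then have cA: "compact ?A" by (simp add: compact_closure)
    have "0 < \<epsilon>" by (simp add: \<epsilon>_def)
    then obtain U where U: "open U" "?A \<subseteq> U" "closure U \<subseteq> ?V" "coverable t \<epsilon> (K \<inter> frontier U)"
      using cuttableD[OF cut cA _ sub] by (metis open_ball_union)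
    then obtain G where G: "finite G" "\<forall>(x, r)\<in>G. 0 < r" "K \<inter> frontier U \<subseteq> ball_union G" "ball_cost t G < \<epsilon>"
      unfolding coverable_def by metis
    obtain c where c: "ball_union G \<subseteq> ball_union (F c)" "ball_cost t (F c) \<le> 2 powr t * ball_cost t G"
      using approx[OF G(1,2) t] by blast
    \<comment> \<open>Off the balls, \<open>K\<close> splits into a part inside \<open>U\<close> and
      a part \<open>?R\<close> outside. A ball union squeezed between them replaces
      \<open>U\<close>, and its boundary meets \<open>K\<close> only in the balls.\<close>
    let ?P = "(K \<inter> closure U - ball_union (F c)) \<union> ?A" and ?R = "K - U - ball_union (F c)"
    have "compact ?P" by (intro compact_Un compact_diff compact_Int_closed K cA) auto
    moreover have "open (?V - ?R)"
      using K U(1) by (intro open_Diff closed_Diff compact_imp_closed) auto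
    moreover have "?P \<subseteq> ?V - ?R"
    proof -
      have "K \<inter> closure U - ball_union (F c) \<subseteq> U"
        using G(3) c(1) U(1) by (auto simp: frontier_def interior_open)
      then show ?thesis using U(2,3) closure_subset[of U] by blast
    qed
    ultimately obtain u where u: "?P \<subseteq> ball_union (F u)" "closure (ball_union (F u)) \<subseteq> ?V - ?R"
      using inter by meson
    have "K \<inter> (frontier (ball_union (F u)) - ball_union (F c)) = {}"
    proof -
      have "x \<in> ball_union (F u)" if "x \<in> K" "x \<in> closure (ball_union (F u))" "x \<notin> ball_union (F c)" for x
      proof -
        have "x \<in> U" using u(2) that by blast
        then show ?thesis using u(1) that closure_subset[of U] by blast
      qed
      then show ?thesis by (auto simp: frontier_def interior_open)
    qed
    moreover have "ball_cost t (F c) < 1 / real (Suc m)"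
    proof -
      have "2 powr t * ball_cost t G < 2 powr t * \<epsilon>" using G(4) by simp
      then show ?thesis using c(2) by (simp add: \<epsilon>_def)
    qed
    moreover have "ball_union (F a) \<subseteq> ball_union (F u)" using u(1) closure_subset by fast
    ultimately show "\<exists>u c. ball_union (F a) \<subseteq> ball_union (F u) \<and> closure (ball_union (F u)) \<subseteq> ?V \<and>
      ball_cost t (F c) < 1 / real (Suc m) \<and> K \<inter> (frontier (ball_union (F u)) - ball_union (F c)) = {}"
      using u(2) by blast
  qed
next
  assume R: ?R
  show "cuttable t K"
    unfolding cuttable_def
  proof (intro allI impI, elim conjE)
    fix A V :: "'a set" and \<epsilon> :: real
    assume A: "compact A" "open V" "A \<subseteq> V" "0 < \<epsilon>"
    then obtain b where b: "A \<subseteq> ball_union (F b)" "closure (ball_union (F b)) \<subseteq> V" using inter by meson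
    then obtain a where a: "A \<subseteq> ball_union (F a)" "closure (ball_union (F a)) \<subseteq> ball_union (F b)"
      using inter A(1) by (meson open_ball_union)
    obtain m where m: "1 / real (Suc m) < \<epsilon>" using nat_approx_posE[OF A(4)] by auto
    from R a(2) obtain u c where uc: "ball_union (F a) \<subseteq> ball_union (F u)" "closure (ball_union (F u)) \<subseteq> ball_union (F b)"
      "ball_cost t (F c) < 1 / real (Suc m)" "K \<inter> (frontier (ball_union (F u)) - ball_union (F c)) = {}"
      by meson
    have "coverable t \<epsilon> (K \<inter> frontier (ball_union (F u)))"
      unfolding coverable_def using assms(1)[of c] uc m by (intro exI[of _ "F c"]) auto
    moreover have "A \<subseteq> ball_union (F u)" using a uc by blast
    moreover have "closure (ball_union (F u)) \<subseteq> V" using uc(2) b(2) closure_subset by blast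
    ultimately show "\<exists>U. open U \<and> A \<subseteq> U \<and> closure U \<subseteq> V \<and> coverable t \<epsilon> (K \<inter> frontier U)"
      by blast
  qed
qed

lemma pred_cuttable_percolation_limit:
  assumes n: "1 \<le> n" and t: "0 \<le> t"
  shows "Measurable.pred (percolation_space p n) (\<lambda>\<omega>. cuttable t (percolation_limit n \<omega>))"
proof -
  obtain \<F> :: "((real \<times> real) \<times> real) set set" where \<F>:
    "countable \<F>" "\<And>F. F \<in> \<F> \<Longrightarrow> finite F \<and> (\<forall>(x, r)\<in>F. 0 < r)"
    "\<And>A V. compact A \<Longrightarrow> open V \<Longrightarrow> A \<subseteq> V \<Longrightarrow>
      \<exists>F\<in>\<F>. A \<subseteq> ball_union F \<and> closure (ball_union F) \<subseteq> V"
    "\<And>F t. finite F \<Longrightarrow> (\<forall>(x, r)\<in>F. 0 < r) \<Longrightarrow> 0 \<le> t \<Longrightarrow>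
      \<exists>G\<in>\<F>. ball_union F \<subseteq> ball_union G \<and> ball_cost t G \<le> 2 powr t * ball_cost t F"
    by (rule countable_ball_families) (rule that)
  have "\<F> \<noteq> {}" using \<F>(3)[of "{}" "{}"] by auto
  define F where "F = from_nat_into \<F>"
  have F: "\<F> = range F" using \<F>(1) \<open>\<F> \<noteq> {}\<close> by (simp add: F_def range_from_nat_into)
  have crit: "cuttable t (percolation_limit n \<omega>) \<longleftrightarrow> (\<forall>a b m. closure (ball_union (F a)) \<subseteq> ball_union (F b) \<longrightarrow>
    (\<exists>u c. (ball_union (F a) \<subseteq> ball_union (F u) \<and> closure (ball_union (F u)) \<subseteq> ball_union (F b) \<and>
      ball_cost t (F c) < 1 / real (Suc m)) \<and> percolation_limit n \<omega> \<inter> (frontier (ball_union (F u)) - ball_union (F c)) = {}))"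
    for \<omega>
    unfolding conj_assoc
  proof (rule cuttable_countable_criterion[OF _ _ _ compact_percolation_limit[OF n] t])
    show "finite (F i) \<and> (\<forall>(x, r)\<in>F i. 0 < r)" for i using \<F>(2) F by blast
    show "\<exists>i. A \<subseteq> ball_union (F i) \<and> closure (ball_union (F i)) \<subseteq> V" if "compact A" "open V" "A \<subseteq> V" for A V
      using \<F>(3)[OF that] F by blast
    show "\<exists>i. ball_union G \<subseteq> ball_union (F i) \<and> ball_cost t (F i) \<le> 2 powr t * ball_cost t G"
      if "finite G" "\<forall>(x, r)\<in>G. 0 < r" "0 \<le> t" for G t
      using \<F>(4)[OF that] F by blast
  qed
  have "Measurable.pred (percolation_space p n) (\<lambda>\<omega>. percolation_limit n \<omega> \<inter> (frontier (ball_union (F u)) - ball_union (F c)) = {})" for u c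
    by (intro pred_percolation_limit_disjoint n closed_Diff frontier_closed) auto
  then show ?thesis unfolding crit by measurable
qed

section \<open>Monotone coupling\<close>

lemma PiM_map_pmf:
  fixes f :: "'b \<Rightarrow> 'c"
  assumes "I \<noteq> {}"
  shows "distr (\<Pi>\<^sub>M _\<in>I. measure_pmf D) (\<Pi>\<^sub>M _\<in>I. measure_pmf (map_pmf f D)) (\<lambda>\<omega>. \<lambda>i\<in>I. f (\<omega> i)) =
    (\<Pi>\<^sub>M _\<in>I. measure_pmf (map_pmf f D))"
proof -
  let ?P = "\<Pi>\<^sub>M _\<in>I. measure_pmf D"
  interpret product_prob_space "\<lambda>_. measure_pmf D" I ..
  have meas: "(\<lambda>\<omega>. f (\<omega> i)) \<in> measurable ?P (measure_pmf (map_pmf f D))" if "i \<in> I" for i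
    using that by (intro measurable_compose[OF measurable_component_singleton[OF that]]) simp
  have d: "distr ?P (measure_pmf (map_pmf f D)) (\<lambda>\<omega>. f (\<omega> i)) = measure_pmf (map_pmf f D)" if "i \<in> I" for i
  proof -
    have "distr ?P (measure_pmf (map_pmf f D)) (f \<circ> (\<lambda>\<omega>. \<omega> i)) =
        distr (distr ?P (measure_pmf D) (\<lambda>\<omega>. \<omega> i)) (measure_pmf (map_pmf f D)) f"
      using that by (intro distr_distr[symmetric]) auto
    also have "\<dots> = distr (measure_pmf D) (measure_pmf (map_pmf f D)) f"
      using that by (simp add: PiM_component)
    also have "\<dots> = distr (measure_pmf D) (count_space UNIV) f"
      by (intro distr_cong) auto
    also have "\<dots> = measure_pmf (map_pmf f D)"
      by (simp add: map_pmf_rep_eq)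
    finally show ?thesis by (simp add: comp_def)
  qed
  \<comment> \<open>The coordinates are independent, hence so are their images under
    \<open>f\<close>, and independence means that the joint law is the product of the
    marginals.\<close>
  have "P.indep_vars (\<lambda>_. measure_pmf D) (\<lambda>i \<omega>. \<omega> i) I"
  proof (subst P.indep_vars_iff_distr_eq_PiM'[OF assms])
    have "distr ?P ?P (\<lambda>\<omega>. \<lambda>i\<in>I. \<omega> i) = distr ?P ?P (\<lambda>\<omega>. \<omega>)"
      by (intro distr_cong) (auto simp: space_PiM PiE_restrict)
    then show "distr ?P ?P (\<lambda>\<omega>. \<lambda>i\<in>I. \<omega> i) = (\<Pi>\<^sub>M i\<in>I. distr ?P (measure_pmf D) (\<lambda>\<omega>. \<omega> i))"
      by (simp add: PiM_component cong: PiM_cong)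
  qed auto
  then have "P.indep_vars (\<lambda>_. measure_pmf (map_pmf f D)) (\<lambda>i \<omega>. f (\<omega> i)) I"
    by (rule P.indep_vars_compose2) auto
  then show ?thesis
    using d meas by (subst (asm) P.indep_vars_iff_distr_eq_PiM'[OF assms]) (auto cong: PiM_cong)
qed

lemma percolation_indices_nonempty: "1 \<le> n \<Longrightarrow> percolation_indices n \<noteq> {}"
  by (force simp: percolation_indices_def)

text \<open>Monotone coupling: the percolation with parameter \<open>p * r\<close> is the percolation with parameter
  \<open>p\<close> thinned by an independent one with parameter \<open>r\<close>.\<close>

lemma AE_cuttable_percolation_mono:
  assumes n: "1 \<le> n" and t: "0 \<le> t" and p: "0 < p" "p \<le> p'" "p' \<le> 1"
    and AE: "AE \<omega> in percolation_space p' n. cuttable t (percolation_limit n \<omega>)"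
  shows "AE \<omega> in percolation_space p n. cuttable t (percolation_limit n \<omega>)"
proof -
  define r where "r = p / p'"
  have r: "0 \<le> r" "r \<le> 1" "p' * r = p" using p by (auto simp: r_def)
  \<comment> \<open>A coordinate carries two independent decisions: the first alone has parameter
    \<open>p'\<close>, the conjunction of both has parameter \<open>p' * r = p\<close>.\<close>
  define D where "D = pair_pmf (bernoulli_pmf p') (bernoulli_pmf r)"
  have D1: "map_pmf fst D = bernoulli_pmf p'" by (simp add: D_def map_fst_pair_pmf)
  have D2: "map_pmf (\<lambda>(a, b). a \<and> b) D = bernoulli_pmf p"
  proof (rule pmf_eqI)
    have "(\<lambda>(a, b). a \<and> b) -` {True} = {(True, True)}" by auto
    then have T: "pmf (map_pmf (\<lambda>(a, b). a \<and> b) D) True = pmf (bernoulli_pmf p) True"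
      using p r by (simp add: pmf_map measure_pmf_single D_def pmf_pair)
    show "pmf (map_pmf (\<lambda>(a, b). a \<and> b) D) x = pmf (bernoulli_pmf p) x" for x
      using T by (cases x) (simp_all add: pmf_False_conv_True)
  qed
  let ?I = "percolation_indices n"
  let ?R = "\<Pi>\<^sub>M _\<in>?I. measure_pmf D"
  let ?g = "\<lambda>\<omega>. \<lambda>i\<in>?I. fst (\<omega> i)" and ?h = "\<lambda>\<omega>. \<lambda>i\<in>?I. (\<lambda>(a, b). a \<and> b) (\<omega> i)"
  have g: "distr ?R (percolation_space p' n) ?g = percolation_space p' n"
    using PiM_map_pmf[OF percolation_indices_nonempty[OF n], of D fst] by (simp add: D1 percolation_space_def)
  have h: "distr ?R (percolation_space p n) ?h = percolation_space p n"
    using PiM_map_pmf[OF percolation_indices_nonempty[OF n], of D "\<lambda>(a, b). a \<and> b"] by (simp add: D2 percolation_space_def)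
  have meas: "(\<lambda>\<omega>. \<lambda>i\<in>?I. f (\<omega> i)) \<in> measurable ?R (percolation_space s n)" for f and s :: real
    unfolding percolation_space_def
  proof (rule measurable_restrict)
    show "(\<lambda>\<omega>. f (\<omega> i)) \<in> measurable ?R (measure_pmf (bernoulli_pmf s))" if "i \<in> ?I" for i
      using that by (intro measurable_compose[OF measurable_component_singleton[OF that]]) simp
  qed
  have "AE \<omega> in ?R. cuttable t (percolation_limit n (?g \<omega>))"
    using AE by (subst (asm) g[symmetric]) (rule AE_distrD[OF meas])
  then have "AE \<omega> in ?R. cuttable t (percolation_limit n (?h \<omega>))"
  proof eventually_elim
    case (elim \<omega>)
    have "percolation_kept n (?h \<omega>) k \<subseteq> percolation_kept n (?g \<omega>) k" for k
    proof (induction k)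
      case (Suc k)
      show ?case
      proof
        fix x assume x: "x \<in> percolation_kept n (?h \<omega>) (Suc k)"
        obtain i j where ij: "x = (i, j)" by (cases x)
        have "(Suc k, i, j) \<in> ?I"
          using percolation_kept_bound[OF n x[unfolded ij]]
          unfolding percolation_indices_def by simp
        then have "?h \<omega> (Suc k, i, j) \<Longrightarrow> ?g \<omega> (Suc k, i, j)" by (simp add: case_prod_beta)
        then show "x \<in> percolation_kept n (?g \<omega>) (Suc k)"
          using Suc.IH x unfolding ij percolation_kept.simps by blast
      qed
    qed simp
    then have "percolation_limit n (?h \<omega>) \<subseteq> percolation_limit n (?g \<omega>)"
      by (rule percolation_limit_mono)
    then show ?case using elim cuttable_subset by blast
  qed
  then show ?thesis
    using pred_cuttable_percolation_limit[OF n t, of p]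
    by (subst h[symmetric], subst AE_distr_iff[OF meas]) (auto simp: pred_def)
qed

section \<open>Independence of the sub-percolations\<close>

lemma percolation_indep_vars:
  assumes "1 \<le> n"
  shows "prob_space.indep_vars (percolation_space p n) (\<lambda>_. measure_pmf (bernoulli_pmf p))
    (\<lambda>x \<omega>. \<omega> x) (percolation_indices n)"
proof -
  let ?I = "percolation_indices n" and ?P = "percolation_space p n"
  interpret product_prob_space "\<lambda>_. measure_pmf (bernoulli_pmf p)" ?I ..
  interpret Q: prob_space ?P by (rule prob_space_percolation)
  have "distr ?P ?P (\<lambda>\<omega>. \<lambda>i\<in>?I. \<omega> i) = distr ?P ?P (\<lambda>\<omega>. \<omega>)"
    by (intro distr_cong) (auto simp: percolation_space_def space_PiM PiE_restrict)
  then show ?thesis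
    using percolation_indices_nonempty[OF assms]
    by (subst Q.indep_vars_iff_distr_eq_PiM')
      (auto simp: percolation_space_def PiM_component cong: PiM_cong)
qed

lemma percolation_indep_blocks:
  assumes n: "1 \<le> n" and L: "finite L" "L \<noteq> {}" and J: "disjoint_family_on J L" "\<And>l. l \<in> L \<Longrightarrow> J l \<subseteq> percolation_indices n"
    and A: "\<And>l. l \<in> L \<Longrightarrow> Measurable.pred (\<Pi>\<^sub>M _\<in>J l. measure_pmf (bernoulli_pmf p)) (A l)"
  shows "\<P>(\<omega> in percolation_space p n. \<forall>l\<in>L. A l (restrict \<omega> (J l))) =
    (\<Prod>l\<in>L. \<P>(\<omega> in percolation_space p n. A l (restrict \<omega> (J l))))"
proof -
  let ?P = "percolation_space p n" and ?M = "\<lambda>l. \<Pi>\<^sub>M _\<in>J l. measure_pmf (bernoulli_pmf p)"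
  interpret prob_space ?P by (rule prob_space_percolation)
  have "indep_vars ?M (\<lambda>l \<omega>. restrict \<omega> (J l)) L"
    using indep_vars_restrict[OF percolation_indep_vars[OF n] J(2,1)] by simp
  then have "prob (\<Inter>l\<in>L. (\<lambda>\<omega>. restrict \<omega> (J l)) -` {\<eta>\<in>space (?M l). A l \<eta>} \<inter> space ?P) =
      (\<Prod>l\<in>L. prob ((\<lambda>\<omega>. restrict \<omega> (J l)) -` {\<eta>\<in>space (?M l). A l \<eta>} \<inter> space ?P))"
    using L A by (intro indep_varsD) (auto simp: pred_def)
  moreover have "(\<lambda>\<omega>. restrict \<omega> (J l)) -` {\<eta>\<in>space (?M l). A l \<eta>} \<inter> space ?P = {\<omega>\<in>space ?P. A l (restrict \<omega> (J l))}"
    for l by (auto simp: space_PiM)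
  moreover have "(\<Inter>l\<in>L. {\<omega>\<in>space ?P. A l (restrict \<omega> (J l))}) = {\<omega>\<in>space ?P. \<forall>l\<in>L. A l (restrict \<omega> (J l))}"
    using L(2) by auto
  ultimately show ?thesis by (simp only:)
qed

text \<open>The coordinates read by \<open>percolation_shift n k q\<close>. Their levels exceed
  \<open>k\<close>, so the decision on \<open>q\<close> itself is not among them and is independent
  of the shifted configuration.\<close>

definition percolation_block :: "nat \<Rightarrow> nat \<Rightarrow> nat \<times> nat \<Rightarrow> (nat \<times> nat \<times> nat) set" where
  "percolation_block n k q = (\<lambda>(l, i, j). (k + l, fst q * n ^ l + i, snd q * n ^ l + j)) ` percolation_indices n"

lemma percolation_block_iff:
  assumes "1 \<le> n"
  shows "(m, i, j) \<in> percolation_block n k q \<longleftrightarrow> k < m \<and> q = (i div n ^ (m - k), j div n ^ (m - k))"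
proof
  assume "(m, i, j) \<in> percolation_block n k q"
  then obtain l i' j' where "1 \<le> l" "i' < n ^ l" "j' < n ^ l" "m = k + l" "i = fst q * n ^ l + i'" "j = snd q * n ^ l + j'"
    by (auto simp: percolation_block_def percolation_indices_def)
  then show "k < m \<and> q = (i div n ^ (m - k), j div n ^ (m - k))"
    using assms by (cases q) auto
next
  assume r: "k < m \<and> q = (i div n ^ (m - k), j div n ^ (m - k))"
  have "0 < n ^ (m - k)" "1 \<le> m - k" using assms r by auto
  then have "(m - k, i mod n ^ (m - k), j mod n ^ (m - k)) \<in> percolation_indices n"
    using r by (simp add: percolation_indices_def)
  moreover have "(m, i, j) = (\<lambda>(l, i, j). (k + l, fst q * n ^ l + i, snd q * n ^ l + j)) (m - k, i mod n ^ (m - k), j mod n ^ (m - k))"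
    using r by (simp add: div_mult_mod_eq)
  ultimately show "(m, i, j) \<in> percolation_block n k q"
    unfolding percolation_block_def by blast
qed

lemma percolation_block_subset:
  assumes "1 \<le> n" "fst q < n ^ k" "snd q < n ^ k"
  shows "percolation_block n k q \<subseteq> percolation_indices n"
proof clarify
  fix m i j assume "(m, i, j) \<in> percolation_block n k q"
  then have km: "k < m" and q: "q = (i div n ^ (m - k), j div n ^ (m - k))"
    using percolation_block_iff[OF assms(1)] by auto
  have "n ^ m = n ^ k * n ^ (m - k)" using km by (simp flip: power_add)
  moreover have "0 < n ^ (m - k)" using assms(1) by simp
  ultimately have "i < n ^ m" "j < n ^ m"
    using assms(2,3) q by (simp_all add: div_less_iff_less_mult)
  then show "(m, i, j) \<in> percolation_indices n"
    using km by (simp add: percolation_indices_def)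
qed

lemma percolation_block_disjoint:
  "1 \<le> n \<Longrightarrow> disjoint_family_on (percolation_block n k) Q"
  unfolding disjoint_family_on_def by (auto simp: percolation_block_iff)

lemma measurable_percolation_shift:
  assumes "percolation_block n k q \<subseteq> J"
  shows "percolation_shift n k q \<in> measurable (\<Pi>\<^sub>M _\<in>J. measure_pmf (bernoulli_pmf p)) (percolation_space p n)"
  unfolding percolation_shift_def percolation_space_def
proof (rule measurable_restrict)
  fix x assume x: "x \<in> percolation_indices n"
  obtain l i j where lij: "x = (l, i, j)" by (cases x)
  have "(k + l, fst q * n ^ l + i, snd q * n ^ l + j) \<in> J"
    using assms x lij by (force simp: percolation_block_def)
  then show "(\<lambda>\<omega>. case x of (l, i, j) \<Rightarrow> \<omega> (k + l, fst q * n ^ l + i, snd q * n ^ l + j))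
      \<in> measurable (\<Pi>\<^sub>M _\<in>J. measure_pmf (bernoulli_pmf p)) (measure_pmf (bernoulli_pmf p))"
    unfolding lij case_prod_conv by (rule measurable_component_singleton)
qed

lemma percolation_shift_restrict:
  assumes "percolation_block n k q \<subseteq> J"
  shows "percolation_shift n k q (restrict \<omega> J) = percolation_shift n k q \<omega>"
proof -
  have "restrict \<omega> J (k + l, fst q * n ^ l + i, snd q * n ^ l + j) = \<omega> (k + l, fst q * n ^ l + i, snd q * n ^ l + j)"
    if "(l, i, j) \<in> percolation_indices n" for l i j
    using that assms by (force simp: percolation_block_def)
  then show ?thesis unfolding percolation_shift_def by (auto simp: restrict_def fun_eq_iff)
qed

text \<open>The shift reindexes i.i.d. coordinates by an injective map into the index set.\<close>

lemma distr_percolation_shift: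
  assumes n: "1 \<le> n" and q: "fst q < n ^ k" "snd q < n ^ k"
  shows "distr (percolation_space p n) (percolation_space p n) (percolation_shift n k q) = percolation_space p n"
proof -
  let ?t = "\<lambda>(l, i, j). (k + l, fst q * n ^ l + i, snd q * n ^ l + j)"
  have "inj_on ?t (percolation_indices n)" by (auto simp: inj_on_def)
  moreover have "?t \<in> percolation_indices n \<rightarrow> percolation_indices n"
    using percolation_block_subset[OF n q] by (auto simp: percolation_block_def)
  ultimately have "distr (percolation_space p n) (percolation_space p n) (\<lambda>\<omega>. \<lambda>x\<in>percolation_indices n. \<omega> (?t x)) = percolation_space p n"
    unfolding percolation_space_def
    using distr_PiM_reindex[of "percolation_indices n" "\<lambda>_. measure_pmf (bernoulli_pmf p)" ?t "percolation_indices n"]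
    by (simp add: prob_space_measure_pmf)
  moreover have "(\<lambda>\<omega>. \<lambda>x\<in>percolation_indices n. \<omega> (?t x)) = percolation_shift n k q"
    unfolding percolation_shift_def by (intro ext restrict_ext) (simp add: case_prod_beta)
  ultimately show ?thesis by simp
qed

lemma prob_percolation_shift:
  assumes n: "1 \<le> n" and q: "fst q < n ^ k" "snd q < n ^ k"
    and E: "Measurable.pred (percolation_space p n) E"
  shows "\<P>(\<omega> in percolation_space p n. E (percolation_shift n k q \<omega>)) = \<P>(\<omega> in percolation_space p n. E \<omega>)"
proof -
  have meas: "percolation_shift n k q \<in> measurable (percolation_space p n) (percolation_space p n)"
    using measurable_percolation_shift[OF percolation_block_subset[OF assms(1-3)]] unfolding percolation_space_def .
  have "\<P>(\<omega> in percolation_space p n. E \<omega>) =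
      measure (distr (percolation_space p n) (percolation_space p n) (percolation_shift n k q)) {\<omega>\<in>space (percolation_space p n). E \<omega>}"
    by (simp add: distr_percolation_shift[OF assms(1-3)])
  also have "\<dots> = measure (percolation_space p n) (percolation_shift n k q -` {\<omega>\<in>space (percolation_space p n). E \<omega>} \<inter> space (percolation_space p n))"
    using E meas by (intro measure_distr) (auto simp: pred_def)
  also have "percolation_shift n k q -` {\<omega>\<in>space (percolation_space p n). E \<omega>} \<inter> space (percolation_space p n) =
      {\<omega>\<in>space (percolation_space p n). E (percolation_shift n k q \<omega>)}"
    using measurable_space[OF meas] by auto
  finally show ?thesis by simp
qed

lemma prob_percolation_coordinate:
  assumes "x \<in> percolation_indices n" "0 \<le> p" "p \<le> 1"
  shows "\<P>(\<omega> in percolation_space p n. \<omega> x) = p"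
proof -
  interpret product_prob_space "\<lambda>_. measure_pmf (bernoulli_pmf p)" "percolation_indices n" ..
  have "measure (distr (percolation_space p n) (measure_pmf (bernoulli_pmf p)) (\<lambda>\<omega>. \<omega> x)) {True} =
      measure (percolation_space p n) ((\<lambda>\<omega>. \<omega> x) -` {True} \<inter> space (percolation_space p n))"
    unfolding percolation_space_def using assms(1) by (intro measure_distr) auto
  moreover have "(\<lambda>\<omega>. \<omega> x) -` {True} \<inter> space (percolation_space p n) = {\<omega>\<in>space (percolation_space p n). \<omega> x}" by auto
  moreover have "distr (percolation_space p n) (measure_pmf (bernoulli_pmf p)) (\<lambda>\<omega>. \<omega> x) = measure_pmf (bernoulli_pmf p)"
    unfolding percolation_space_def using PiM_component[OF assms(1)] .
  ultimately show ?thesis using assms by (simp add: measure_pmf_single)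
qed

lemma prob_percolation_shift_pair:
  assumes n: "1 \<le> n" and q: "q \<in> {..<n ^ k} \<times> {..<n ^ k}" "q' \<in> {..<n ^ k} \<times> {..<n ^ k}" "q \<noteq> q'"
    and E: "Measurable.pred (percolation_space p n) E"
  shows "\<P>(\<omega> in percolation_space p n. E (percolation_shift n k q \<omega>) \<and> E (percolation_shift n k q' \<omega>)) =
    \<P>(\<omega> in percolation_space p n. E \<omega>) ^ 2"
proof -
  let ?J = "percolation_block n k" and ?A = "\<lambda>q \<omega>. E (percolation_shift n k q \<omega>)"
  have r: "?A q (restrict \<omega> (?J q)) = ?A q \<omega>" for q \<omega>
    by (simp add: percolation_shift_restrict)
  have "\<P>(\<omega> in percolation_space p n. \<forall>q\<in>{q, q'}. ?A q (restrict \<omega> (?J q))) =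
      (\<Prod>q\<in>{q, q'}. \<P>(\<omega> in percolation_space p n. ?A q (restrict \<omega> (?J q))))"
  proof (rule percolation_indep_blocks[OF n])
    show "?J l \<subseteq> percolation_indices n" if "l \<in> {q, q'}" for l
      using q that by (intro percolation_block_subset n) auto
    show "Measurable.pred (\<Pi>\<^sub>M _\<in>?J l. measure_pmf (bernoulli_pmf p)) (?A l)" for l
      using measurable_compose[OF measurable_percolation_shift[OF order_refl] E] by simp
  qed (auto intro: percolation_block_disjoint n)
  also have "\<dots> = \<P>(\<omega> in percolation_space p n. ?A q \<omega>) * \<P>(\<omega> in percolation_space p n. ?A q' \<omega>)"
    using q(3) by (simp only: r) simp
  also have "\<dots> = \<P>(\<omega> in percolation_space p n. E \<omega>) ^ 2"
    using q E n by (simp add: prob_percolation_shift power2_eq_square mem_Times_iff)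
  finally show ?thesis by (simp only: r) simp
qed

text \<open>Each of the \<open>n\<^sup>2\<close> possible children contributes the condition that it
  is erased or satisfies \<open>E\<close> below. These conditions depend on disjoint sets of
  coordinates and have probability \<open>1 - p + p * x\<close> each, where \<open>x\<close> is the
  probability of \<open>E\<close>.\<close>

lemma prob_percolation_children:
  assumes n: "1 \<le> n" and p: "0 \<le> p" "p \<le> 1" and E: "Measurable.pred (percolation_space p n) E"
  shows "\<P>(\<omega> in percolation_space p n. \<forall>q\<in>percolation_kept n \<omega> 1. E (percolation_shift n 1 q \<omega>)) =
    (1 - p + p * \<P>(\<omega> in percolation_space p n. E \<omega>)) ^ (n\<^sup>2)"
proof -
  let ?P = "percolation_space p n"
  interpret prob_space ?P by (rule prob_space_percolation)
  define x where "x = \<P>(\<omega> in ?P. E \<omega>)"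
  let ?Q = "{..<n} \<times> {..<n}"
  define c where "c q = (1::nat, fst q, snd q)" for q :: "nat \<times> nat"
  define J where "J q = insert (c q) (percolation_block n 1 q)" for q
  define A where "A q \<omega> \<longleftrightarrow> (\<omega> (c q) \<longrightarrow> E (percolation_shift n 1 q \<omega>))" for q and \<omega> :: "nat \<times> nat \<times> nat \<Rightarrow> bool"
  have cI: "c q \<in> percolation_indices n" if "q \<in> ?Q" for q
    using that by (auto simp: c_def percolation_indices_def)
  have bI: "percolation_block n 1 q \<subseteq> percolation_indices n" if "q \<in> ?Q" for q
    using that by (intro percolation_block_subset n) auto
  have cb: "c q \<notin> percolation_block n 1 q'" for q q'
    by (cases q) (simp add: c_def percolation_block_iff[OF n])
  have r: "A q (restrict \<omega> (J q)) = A q \<omega>" for q \<omega>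
    unfolding A_def J_def by (subst percolation_shift_restrict) auto
  have dis: "disjoint_family_on J ?Q"
    using percolation_block_disjoint[OF n, of 1 ?Q] cb
    by (auto simp: disjoint_family_on_def J_def c_def)
  have pA: "Measurable.pred (\<Pi>\<^sub>M _\<in>J q. measure_pmf (bernoulli_pmf p)) (A q)" for q
  proof -
    have "Measurable.pred (\<Pi>\<^sub>M _\<in>J q. measure_pmf (bernoulli_pmf p)) (\<lambda>\<omega>. \<omega> (c q))"
      by (rule pred_PiM_pmf_component) (simp add: J_def)
    moreover have "Measurable.pred (\<Pi>\<^sub>M _\<in>J q. measure_pmf (bernoulli_pmf p)) (\<lambda>\<omega>. E (percolation_shift n 1 q \<omega>))"
      using measurable_compose[OF measurable_percolation_shift E] by (simp add: J_def subset_insertI)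
    ultimately show ?thesis unfolding A_def by (rule pred_intros_logic(4))
  qed
  have "\<P>(\<omega> in ?P. \<forall>q\<in>?Q. A q (restrict \<omega> (J q))) = (\<Prod>q\<in>?Q. \<P>(\<omega> in ?P. A q (restrict \<omega> (J q))))"
  proof (rule percolation_indep_blocks[OF n _ _ dis _ pA])
    show "?Q \<noteq> {}" using n by (simp add: lessThan_empty_iff)
    show "J q \<subseteq> percolation_indices n" if "q \<in> ?Q" for q
      using cI[OF that] bI[OF that] by (simp add: J_def)
  qed auto
  then have prod: "\<P>(\<omega> in ?P. \<forall>q\<in>?Q. A q \<omega>) = (\<Prod>q\<in>?Q. \<P>(\<omega> in ?P. A q \<omega>))"
    by (simp only: r)
  have one: "\<P>(\<omega> in ?P. A q \<omega>) = 1 - p + p * x" if q: "q \<in> ?Q" for q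
  proof -
    \<comment> \<open>The failure, kept but without \<open>E\<close> below, joins an event of the
      child's own decision (\<open>b = True\<close>) and one of the block below
      (\<open>b = False\<close>); by independence its probability is
      \<open>p * (1 - x)\<close>.\<close>
    let ?B = "\<lambda>b \<omega>. if b then \<omega> (c q) else \<not> E (percolation_shift n 1 q \<omega>)"
    let ?K = "\<lambda>b. if b then {c q} else percolation_block n 1 q"
    have rr: "?B b (restrict \<omega> (?K b)) = ?B b \<omega>" for b \<omega>
      by (simp add: percolation_shift_restrict)
    have pB: "Measurable.pred (\<Pi>\<^sub>M _\<in>?K b. measure_pmf (bernoulli_pmf p)) (?B b)" for b
      using measurable_compose[OF measurable_percolation_shift[OF order_refl] E, of 1 q]
      by (cases b) (auto intro!: pred_PiM_pmf_component pred_intros_logic)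
    have "\<P>(\<omega> in ?P. \<forall>b\<in>UNIV. ?B b (restrict \<omega> (?K b))) = (\<Prod>b\<in>UNIV. \<P>(\<omega> in ?P. ?B b (restrict \<omega> (?K b))))"
      using cI[OF q] bI[OF q] cb pB
      by (intro percolation_indep_blocks n) (auto simp: disjoint_family_on_def)
    then have "\<P>(\<omega> in ?P. \<forall>b\<in>UNIV. ?B b \<omega>) = (\<Prod>b\<in>UNIV. \<P>(\<omega> in ?P. ?B b \<omega>))"
      by (simp only: rr)
    then have fail: "\<P>(\<omega> in ?P. \<omega> (c q) \<and> \<not> E (percolation_shift n 1 q \<omega>)) =
        \<P>(\<omega> in ?P. \<omega> (c q)) * \<P>(\<omega> in ?P. \<not> E (percolation_shift n 1 q \<omega>))"
      by (simp only: ball_UNIV all_bool_eq if_True if_False)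
        (simp add: UNIV_bool conj_commute mult.commute)
    have q': "fst q < n ^ 1" "snd q < n ^ 1" using q by auto
    have "\<P>(\<omega> in ?P. \<not> E (percolation_shift n 1 q \<omega>)) = \<P>(\<omega> in ?P. \<not> E \<omega>)"
      using E by (intro prob_percolation_shift[OF n q', where E = "\<lambda>\<omega>. \<not> E \<omega>"] pred_intros_logic)
    also have "\<dots> = 1 - x"
      unfolding x_def using E by (intro prob_neg) (simp add: pred_def)
    finally have "\<P>(\<omega> in ?P. \<omega> (c q) \<and> \<not> E (percolation_shift n 1 q \<omega>)) = p * (1 - x)"
      using fail prob_percolation_coordinate[OF cI[OF q] p] by simp
    moreover have "\<P>(\<omega> in ?P. \<not> A q \<omega>) = 1 - \<P>(\<omega> in ?P. A q \<omega>)"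
    proof (rule prob_neg)
      have "Measurable.pred ?P (\<lambda>\<omega>. \<omega> (c q))"
        unfolding percolation_space_def using cI[OF q] by (rule pred_PiM_pmf_component)
      moreover have "Measurable.pred ?P (\<lambda>\<omega>. E (percolation_shift n 1 q \<omega>))"
        using measurable_compose[OF measurable_percolation_shift[OF bI[OF q]] E] by (simp add: percolation_space_def)
      ultimately have "Measurable.pred ?P (A q)" unfolding A_def by (rule pred_intros_logic(4))
      then show "{\<omega> \<in> space ?P. A q \<omega>} \<in> events" by (simp add: pred_def)
    qed
    ultimately show ?thesis by (simp add: A_def algebra_simps)
  qed
  have "(\<forall>q\<in>percolation_kept n \<omega> 1. E (percolation_shift n 1 q \<omega>)) \<longleftrightarrow> (\<forall>q\<in>?Q. A q \<omega>)" for \<omega>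
    using n by (auto simp: A_def c_def div_eq_0_iff)
  then show ?thesis
    using prod one by (simp add: x_def power2_eq_square)
qed

section \<open>Zero-one law\<close>

text \<open>Strict convexity of \<open>y \<mapsto> (1 - p + p * y) ^ N\<close>, through the increasing chord slopes towards the
  fixed point \<open>1\<close>.\<close>

lemma generating_function_chord:
  fixes p y :: real
  shows "1 - (1 - p + p * y) ^ N = p * (1 - y) * (\<Sum>i<N. (1 - p + p * y) ^ i)"
  using one_diff_power_eq[of "1 - p + p * y" N] by (simp add: algebra_simps)

text \<open>The chord slope towards \<open>1\<close> equals \<open>1\<close> at the fixed point
  \<open>y\<close> and is at most \<open>1\<close> at \<open>x\<close>; as it increases strictly,
  \<open>y < x\<close> is impossible. Strictness comes from the summand \<open>i = 1\<close>,
  present because \<open>2 \<le> N\<close>.\<close>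

lemma generating_function_fixed_point:
  fixes p x y :: real
  assumes p: "0 < p" "p < 1" and N: "2 \<le> N" and y: "0 \<le> y" "y \<le> x" "x < 1"
    and fy: "y = (1 - p + p * y) ^ N" and fx: "x \<le> (1 - p + p * x) ^ N"
  shows "x = y"
proof (rule ccontr)
  assume "x \<noteq> y"
  then have "y < x" using y by simp
  have pos: "0 < 1 - p + p * y" using p y by (simp add: add_pos_nonneg)
  have less: "1 - p + p * y < 1 - p + p * x" using p \<open>y < x\<close> by simp
  have slope: "p * (\<Sum>i<N. (1 - p + p * z) ^ i) = (1 - (1 - p + p * z) ^ N) / (1 - z)" if "z < 1" for z
    using that generating_function_chord[of p z N] by (simp add: field_simps)
  have "(\<Sum>i<N. (1 - p + p * y) ^ i) < (\<Sum>i<N. (1 - p + p * x) ^ i)"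
  proof (rule sum_strict_mono_ex1)
    show "\<forall>i\<in>{..<N}. (1 - p + p * y) ^ i \<le> (1 - p + p * x) ^ i"
      using less pos by (auto intro!: power_mono)
    show "\<exists>i\<in>{..<N}. (1 - p + p * y) ^ i < (1 - p + p * x) ^ i"
      using less N by (intro bexI[of _ 1]) auto
  qed simp
  then have "p * (\<Sum>i<N. (1 - p + p * y) ^ i) < p * (\<Sum>i<N. (1 - p + p * x) ^ i)" using p by simp
  moreover have "p * (\<Sum>i<N. (1 - p + p * y) ^ i) = 1"
    using slope[of y] fy y by simp
  moreover have "p * (\<Sum>i<N. (1 - p + p * x) ^ i) \<le> 1"
    using slope[of x] fx y by (simp add: divide_le_eq)
  ultimately show False by simp
qed

section \<open>Extinction probability\<close>

lemma prob_percolation_limit_empty: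
  assumes "1 \<le> n" "0 \<le> p" "p \<le> 1"
  shows "\<P>(\<omega> in percolation_space p n. percolation_limit n \<omega> = {}) =
    (1 - p + p * \<P>(\<omega> in percolation_space p n. percolation_limit n \<omega> = {})) ^ (n\<^sup>2)"
  using prob_percolation_children[OF assms pred_percolation_limit_empty[OF assms(1)]]
  by (simp only: percolation_limit_empty_iff[OF assms(1), of _ 1, symmetric])

text \<open>Subcritical branching: on \<open>[0, 1)\<close> every chord slope towards
  \<open>1\<close> is at most \<open>p * n\<^sup>2 < 1\<close>, whereas a fixed point below
  \<open>1\<close> would need slope \<open>1\<close>.\<close>

lemma AE_percolation_limit_empty:
  assumes n: "1 \<le> n" and p: "0 \<le> p" "p < 1 / real n ^ 2"
  shows "AE \<omega> in percolation_space p n. percolation_limit n \<omega> = {}"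
proof -
  let ?P = "percolation_space p n"
  interpret prob_space ?P by (rule prob_space_percolation)
  define y where "y = \<P>(\<omega> in ?P. percolation_limit n \<omega> = {})"
  have p1: "p \<le> 1" using p n by (smt (verit) divide_le_eq_1_pos of_nat_1 of_nat_mono one_le_power)
  have y: "0 \<le> y" "y \<le> 1" by (simp_all add: y_def)
  have "y = 1"
  proof (rule ccontr)
    assume "y \<noteq> 1"
    then have "y < 1" using y by simp
    have fy: "y = (1 - p + p * y) ^ (n\<^sup>2)" unfolding y_def by (rule prob_percolation_limit_empty[OF n p(1) p1])
    have "p * y \<le> p" using p y by (simp add: mult_left_le)
    moreover have "0 \<le> p * y" using p y by simp
    ultimately have "(1 - p + p * y) ^ i \<le> 1" for i using p1 by (intro power_le_one) auto
    then have "(\<Sum>i<n\<^sup>2. (1 - p + p * y) ^ i) \<le> (\<Sum>i<n\<^sup>2. 1)"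
      by (intro sum_mono)
    then have "p * (1 - y) * (\<Sum>i<n\<^sup>2. (1 - p + p * y) ^ i) \<le> p * (1 - y) * (\<Sum>i<n\<^sup>2. 1)"
      using p \<open>y < 1\<close> by (intro mult_left_mono) auto
    moreover have "1 - y = p * (1 - y) * (\<Sum>i<n\<^sup>2. (1 - p + p * y) ^ i)"
      using generating_function_chord[of p y "n\<^sup>2"] by (simp only: fy[symmetric])
    ultimately have "1 - y \<le> p * (1 - y) * real (n\<^sup>2)" by simp
    then have "1 \<le> p * real n ^ 2" using \<open>y < 1\<close> by (simp add: mult.assoc mult.left_commute[of _ "1 - y"])
    then show False using p n by (simp add: field_simps)
  qed
  then show ?thesis
    using pred_percolation_limit_empty[OF n, of p]
    by (subst (asm) y_def, subst (asm) prob_Collect_eq_1) (simp_all add: pred_def)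
qed

lemma cuttable_zero_one:
  assumes n: "2 \<le> n" and p: "0 < p" "p < 1" and t: "0 \<le> t"
  shows "(AE \<omega> in percolation_space p n. cuttable t (percolation_limit n \<omega>)) \<or>
    (AE \<omega> in percolation_space p n. cuttable t (percolation_limit n \<omega>) \<longrightarrow> percolation_limit n \<omega> = {})"
proof -
  let ?P = "percolation_space p n"
  interpret prob_space ?P by (rule prob_space_percolation)
  have n1: "1 \<le> n" using n by simp
  define y where "y = \<P>(\<omega> in ?P. percolation_limit n \<omega> = {})"
  define x where "x = \<P>(\<omega> in ?P. cuttable t (percolation_limit n \<omega>))"
  have mx: "{\<omega>\<in>space ?P. cuttable t (percolation_limit n \<omega>)} \<in> sets ?P"
    using pred_cuttable_percolation_limit[OF n1 t, of p] by (simp add: pred_def)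
  have my: "{\<omega>\<in>space ?P. percolation_limit n \<omega> = {}} \<in> sets ?P"
    using pred_percolation_limit_empty[OF n1, of p] by (simp add: pred_def)
  have sub: "{\<omega>\<in>space ?P. percolation_limit n \<omega> = {}} \<subseteq> {\<omega>\<in>space ?P. cuttable t (percolation_limit n \<omega>)}"
    using cuttable_empty[of t] by auto
  have "y \<le> x" unfolding x_def y_def by (rule finite_measure_mono[OF sub mx])
  have fy: "y = (1 - p + p * y) ^ (n\<^sup>2)"
    unfolding y_def using prob_percolation_limit_empty[OF n1] p by simp
  have fx: "x \<le> (1 - p + p * x) ^ (n\<^sup>2)"
  proof -
    have "\<P>(\<omega> in ?P. \<forall>q\<in>percolation_kept n \<omega> 1. cuttable t (percolation_limit n (percolation_shift n 1 q \<omega>))) =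
      (1 - p + p * x) ^ (n\<^sup>2)"
      unfolding x_def using p by (intro prob_percolation_children n1 pred_cuttable_percolation_limit t) auto
    moreover have "x \<le> \<P>(\<omega> in ?P. \<forall>q\<in>percolation_kept n \<omega> 1. cuttable t (percolation_limit n (percolation_shift n 1 q \<omega>)))"
      unfolding x_def
    proof (rule finite_measure_mono)
      show "{\<omega>\<in>space ?P. cuttable t (percolation_limit n \<omega>)} \<subseteq>
          {\<omega>\<in>space ?P. \<forall>q\<in>percolation_kept n \<omega> 1. cuttable t (percolation_limit n (percolation_shift n 1 q \<omega>))}"
        using cuttable_percolation_limit_shift[OF n1 t] by blast
      have "Measurable.pred ?P (\<lambda>\<omega>. \<forall>q\<in>{..<n ^ 1} \<times> {..<n ^ 1}. (fst q, snd q) \<in> percolation_kept n \<omega> 1 \<longrightarrow>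
          cuttable t (percolation_limit n (percolation_shift n 1 q \<omega>)))"
      proof (intro pred_intros_finite pred_intros_logic pred_percolation_kept n1)
        fix q assume "q \<in> {..<n ^ 1} \<times> {..<n ^ 1}"
        then have "percolation_block n 1 q \<subseteq> percolation_indices n"
          by (intro percolation_block_subset n1) auto
        from measurable_compose[OF measurable_percolation_shift[OF this] pred_cuttable_percolation_limit[OF n1 t]]
        show "Measurable.pred ?P (\<lambda>\<omega>. cuttable t (percolation_limit n (percolation_shift n 1 q \<omega>)))"
          by (simp add: percolation_space_def)
      qed simp
      moreover have "(\<forall>q\<in>{..<n ^ 1} \<times> {..<n ^ 1}. (fst q, snd q) \<in> percolation_kept n \<omega> 1 \<longrightarrow>
          cuttable t (percolation_limit n (percolation_shift n 1 q \<omega>))) \<longleftrightarrow>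
          (\<forall>q\<in>percolation_kept n \<omega> 1. cuttable t (percolation_limit n (percolation_shift n 1 q \<omega>)))" for \<omega>
        unfolding prod.collapse using percolation_kept_subset[OF n1, of \<omega> 1] by blast
      ultimately have "Measurable.pred ?P (\<lambda>\<omega>. \<forall>q\<in>percolation_kept n \<omega> 1. cuttable t (percolation_limit n (percolation_shift n 1 q \<omega>)))"
        by (simp only:)
      then show "{\<omega>\<in>space ?P. \<forall>q\<in>percolation_kept n \<omega> 1. cuttable t (percolation_limit n (percolation_shift n 1 q \<omega>))} \<in> sets ?P"
        by (simp only: pred_def)
    qed
    ultimately show ?thesis by (simp only:)
  qed
  show ?thesis
  proof (cases "x < 1")
    case False
    then have "x = 1" unfolding x_def by (simp add: order_antisym)
    then show ?thesis using mx unfolding x_def by (subst (asm) prob_Collect_eq_1) auto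
  next
    case True
    have "2 \<le> n\<^sup>2" using n self_le_power[of n 2] by simp
    then have "x = y"
      using generating_function_fixed_point[OF p _ _ \<open>y \<le> x\<close> True fy fx] by (simp add: y_def)
    \<comment> \<open>Extinction is contained in cuttability, so equal probabilities make the
      difference a null set.\<close>
    let ?D = "{\<omega>\<in>space ?P. cuttable t (percolation_limit n \<omega>)} - {\<omega>\<in>space ?P. percolation_limit n \<omega> = {}}"
    have "prob ?D = 0" using finite_measure_Diff[OF mx my sub] \<open>x = y\<close> by (simp add: x_def y_def)
    then have "?D \<in> null_sets ?P" using mx my by (simp add: null_sets_def emeasure_eq_measure)
    then have "AE \<omega> in ?P. \<omega> \<notin> ?D" by (rule AE_not_in)
    then show ?thesis by (auto elim: AE_mp)
  qed
qed

section \<open>Renormalization\<close>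

text \<open>Squares live on the \<open>N\<close>-adic grid. \<open>X l i j\<close> marks the forbidden squares of level \<open>l\<close>; the
  arguments \<open>l\<close> and \<open>r\<close> are the level of a square and the number of further subdivisions that are
  inspected.\<close>

primrec blocked :: "nat \<Rightarrow> nat \<Rightarrow> (nat \<Rightarrow> nat \<Rightarrow> nat \<Rightarrow> bool) \<Rightarrow> nat \<Rightarrow> nat \<Rightarrow> nat \<Rightarrow> nat \<Rightarrow> bool" where
  "blocked N b X 0 l i j = X l i j"
| "blocked N b X (Suc r) l i j = (X l i j \<or>
    b < card {q \<in> {..<N} \<times> {..<N}. blocked N b X r (Suc l) (i * N + fst q) (j * N + snd q)})"

definition free_column :: "nat \<Rightarrow> nat \<Rightarrow> (nat \<Rightarrow> nat \<Rightarrow> nat \<Rightarrow> bool) \<Rightarrow> nat \<Rightarrow> nat \<Rightarrow> nat \<Rightarrow> nat \<Rightarrow> nat \<Rightarrow> bool" where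
  "free_column N b X r l i j x \<longleftrightarrow> (\<forall>y<N. \<not> blocked N b X r (Suc l) (i * N + x) (j * N + y))"

definition free_row :: "nat \<Rightarrow> nat \<Rightarrow> (nat \<Rightarrow> nat \<Rightarrow> nat \<Rightarrow> bool) \<Rightarrow> nat \<Rightarrow> nat \<Rightarrow> nat \<Rightarrow> nat \<Rightarrow> nat \<Rightarrow> bool" where
  "free_row N b X r l i j y \<longleftrightarrow> (\<forall>x<N. \<not> blocked N b X r (Suc l) (i * N + x) (j * N + y))"

text \<open>If \<open>2 * b < N\<close>, more than half of the rows and of the columns of an unblocked square are free. So
  neighbouring unblocked squares have a free row or column in common, and their passages meet.\<close>

primrec passage :: "nat \<Rightarrow> nat \<Rightarrow> (nat \<Rightarrow> nat \<Rightarrow> nat \<Rightarrow> bool) \<Rightarrow> nat \<Rightarrow> nat \<Rightarrow> nat \<Rightarrow> nat \<Rightarrow> (real \<times> real) set" where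
  "passage N b X 0 l i j = percolation_square N l i j"
| "passage N b X (Suc r) l i j =
    (\<Union>(x, y)\<in>{(x, y). x < N \<and> y < N \<and> (free_column N b X r l i j x \<or> free_row N b X r l i j y)}.
      passage N b X r (Suc l) (i * N + x) (j * N + y))"

section \<open>Passages through unblocked squares\<close>

lemma free_card:
  assumes "\<not> blocked N b X (Suc r) l i j" "2 * b < N"
  shows "N < 2 * card {x\<in>{..<N}. free_column N b X r l i j x}"
    and "N < 2 * card {y\<in>{..<N}. free_row N b X r l i j y}"
proof -
  let ?B = "{q \<in> {..<N} \<times> {..<N}. blocked N b X r (Suc l) (i * N + fst q) (j * N + snd q)}"
  have B: "card ?B \<le> b" using assms(1) by simp
  have split: "card {x\<in>{..<N}. P x} + card {x\<in>{..<N}. \<not> P x} = N" for P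
  proof -
    have "card ({x\<in>{..<N}. P x} \<union> {x\<in>{..<N}. \<not> P x}) = card {x\<in>{..<N}. P x} + card {x\<in>{..<N}. \<not> P x}"
      by (intro card_Un_disjoint) auto
    moreover have "{x\<in>{..<N}. P x} \<union> {x\<in>{..<N}. \<not> P x} = {..<N}" by auto
    ultimately show ?thesis by simp
  qed
  \<comment> \<open>One blocked child spoils at most one column and one row, so at most
    \<open>b < N / 2\<close> of each are lost.\<close>
  have small: "card S \<le> b" if "S \<subseteq> f ` ?B" for S :: "nat set" and f
  proof -
    have "finite ?B" by simp
    then have "card S \<le> card (f ` ?B)" using that by (intro card_mono) auto
    also have "\<dots> \<le> card ?B" by (rule card_image_le) simp
    finally show ?thesis using B by simp
  qed
  have "{x\<in>{..<N}. \<not> free_column N b X r l i j x} \<subseteq> fst ` ?B"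
    by (force simp: free_column_def)
  from small[OF this] show "N < 2 * card {x\<in>{..<N}. free_column N b X r l i j x}"
    using split[of "free_column N b X r l i j"] assms(2) by linarith
  have "{y\<in>{..<N}. \<not> free_row N b X r l i j y} \<subseteq> snd ` ?B"
    by (force simp: free_row_def)
  from small[OF this] show "N < 2 * card {y\<in>{..<N}. free_row N b X r l i j y}"
    using split[of "free_row N b X r l i j"] assms(2) by linarith
qed

lemma majorities_meet:
  assumes "N < 2 * card {x\<in>{..<N}. P x}" "N < 2 * card {x\<in>{..<N}. Q x}"
  obtains x :: nat where "x < N" "P x" "Q x"
proof -
  have "{x\<in>{..<N}. P x} \<inter> {x\<in>{..<N}. Q x} \<noteq> {}"
  proof
    assume "{x\<in>{..<N}. P x} \<inter> {x\<in>{..<N}. Q x} = {}"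
    then have "card {x\<in>{..<N}. P x} + card {x\<in>{..<N}. Q x} = card ({x\<in>{..<N}. P x} \<union> {x\<in>{..<N}. Q x})"
      by (intro card_Un_disjoint[symmetric]) auto
    also have "\<dots> \<le> card {..<N}" by (intro card_mono) auto
    finally show False using assms by simp
  qed
  then show thesis using that by blast
qed

lemma not_blocked_free:
  assumes "\<not> blocked N b X (Suc r) l i j" "2 * b < N"
  obtains x y where "x < N" "free_column N b X r l i j x" "y < N" "free_row N b X r l i j y"
  using majorities_meet[OF free_card(1)[OF assms] free_card(1)[OF assms]]
    majorities_meet[OF free_card(2)[OF assms] free_card(2)[OF assms]] by metis

lemma percolation_square_child:
  assumes "x < N" "y < N"
  shows "percolation_square N (Suc l) (i * N + x) (j * N + y) \<subseteq> percolation_square N l i j"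
  using percolation_square_child_subset[of N l 1 "i * N + x" "j * N + y"] assms by simp

lemma passage_subset: "passage N b X r l i j \<subseteq> percolation_square N l i j"
proof (induction r arbitrary: l i j)
  case (Suc r)
  show ?case
  proof
    fix z assume "z \<in> passage N b X (Suc r) l i j"
    then obtain x y where "x < N" "y < N" "z \<in> passage N b X r (Suc l) (i * N + x) (j * N + y)" by auto
    then show "z \<in> percolation_square N l i j"
      using Suc percolation_square_child[of x N y l i j] by blast
  qed
qed simp

lemma passage_child:
  assumes "x < N" "y < N" "free_column N b X r l i j x \<or> free_row N b X r l i j y"
  shows "passage N b X r (Suc l) (i * N + x) (j * N + y) \<subseteq> passage N b X (Suc r) l i j"
proof
  fix z assume "z \<in> passage N b X r (Suc l) (i * N + x) (j * N + y)"
  then show "z \<in> passage N b X (Suc r) l i j"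
    unfolding passage.simps using assms by (intro UN_I[of "(x, y)"]) auto
qed

text \<open>Both squares have a majority of free rows, hence a common one. Its last cell in the left
  square and its first cell in the right square are adjacent unblocked squares of the next
  level.\<close>

lemma passage_meets_right:
  assumes N: "2 * b < N"
  shows "\<not> blocked N b X r l i j \<Longrightarrow> \<not> blocked N b X r l (Suc i) j \<Longrightarrow>
      passage N b X r l i j \<inter> passage N b X r l (Suc i) j \<noteq> {}"
proof (induction r arbitrary: l i j)
  case 0
  have "(real (Suc i) / real N ^ l, real j / real N ^ l) \<in> percolation_square N l i j \<inter> percolation_square N l (Suc i) j"
    by (auto simp: percolation_square_def divide_right_mono)
  then show ?case by auto
next
  case (Suc r)
  obtain y where y: "y < N" "free_row N b X r l i j y" "free_row N b X r l (Suc i) j y"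
    using majorities_meet[OF free_card(2)[OF Suc.prems(1) N] free_card(2)[OF Suc.prems(2) N]] .
  have last: "0 < N" "N - 1 < N" using N by auto
  have e: "Suc (i * N + (N - 1)) = Suc i * N + 0" using N by simp
  have nb: "\<not> blocked N b X r (Suc l) (i * N + (N - 1)) (j * N + y)"
      "\<not> blocked N b X r (Suc l) (Suc i * N + 0) (j * N + y)"
    using y last unfolding free_row_def by blast+
  have "passage N b X r (Suc l) (i * N + (N - 1)) (j * N + y) \<inter> passage N b X r (Suc l) (Suc i * N + 0) (j * N + y) \<noteq> {}"
    using Suc.IH[OF nb(1)] nb(2) unfolding e by blast
  moreover have "passage N b X r (Suc l) (i * N + (N - 1)) (j * N + y) \<subseteq> passage N b X (Suc r) l i j"
    using y last by (intro passage_child) auto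
  moreover have "passage N b X r (Suc l) (Suc i * N + 0) (j * N + y) \<subseteq> passage N b X (Suc r) l (Suc i) j"
    using y last by (intro passage_child) auto
  ultimately show ?case by blast
qed

lemma passage_meets_above:
  assumes N: "2 * b < N"
  shows "\<not> blocked N b X r l i j \<Longrightarrow> \<not> blocked N b X r l i (Suc j) \<Longrightarrow>
      passage N b X r l i j \<inter> passage N b X r l i (Suc j) \<noteq> {}"
proof (induction r arbitrary: l i j)
  case 0
  have "(real i / real N ^ l, real (Suc j) / real N ^ l) \<in> percolation_square N l i j \<inter> percolation_square N l i (Suc j)"
    by (auto simp: percolation_square_def divide_right_mono)
  then show ?case by auto
next
  case (Suc r)
  obtain x where x: "x < N" "free_column N b X r l i j x" "free_column N b X r l i (Suc j) x"
    using majorities_meet[OF free_card(1)[OF Suc.prems(1) N] free_card(1)[OF Suc.prems(2) N]] .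
  have last: "0 < N" "N - 1 < N" using N by auto
  have e: "Suc (j * N + (N - 1)) = Suc j * N + 0" using N by simp
  have nb: "\<not> blocked N b X r (Suc l) (i * N + x) (j * N + (N - 1))"
      "\<not> blocked N b X r (Suc l) (i * N + x) (Suc j * N + 0)"
    using x last unfolding free_column_def by blast+
  have "passage N b X r (Suc l) (i * N + x) (j * N + (N - 1)) \<inter> passage N b X r (Suc l) (i * N + x) (Suc j * N + 0) \<noteq> {}"
    using Suc.IH[OF nb(1)] nb(2) unfolding e by blast
  moreover have "passage N b X r (Suc l) (i * N + x) (j * N + (N - 1)) \<subseteq> passage N b X (Suc r) l i j"
    using x last by (intro passage_child) auto
  moreover have "passage N b X r (Suc l) (i * N + x) (Suc j * N + 0) \<subseteq> passage N b X (Suc r) l i (Suc j)"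
    using x last by (intro passage_child) auto
  ultimately show ?case by blast
qed

lemma connected_chain:
  fixes S :: "nat \<Rightarrow> 'a::topological_space set"
  assumes "\<And>x. x < m \<Longrightarrow> connected (S x)" "\<And>x. Suc x < m \<Longrightarrow> S x \<inter> S (Suc x) \<noteq> {}"
  shows "connected (\<Union>x<m. S x)"
  using assms
proof (induction m)
  case (Suc m)
  have IH: "connected (\<Union>x<m. S x)" using Suc by simp
  show ?case
  proof (cases m)
    case 0
    then show ?thesis using Suc.prems by (simp add: lessThan_Suc)
  next
    case (Suc m')
    then have "S m' \<inter> S m \<noteq> {}" using Suc.prems by simp
    then have "(\<Union>x<m. S x) \<inter> S m \<noteq> {}" using Suc by blast
    then have "connected ((\<Union>x<m. S x) \<union> S m)"
      using IH Suc.prems by (intro connected_Un) auto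
    then show ?thesis by (simp add: lessThan_Suc Un_commute)
  qed
qed simp

text \<open>A free row and a free column share a cell, whose passage is non-empty by induction. So
  every free column is tied to a fixed free row \<open>y0\<close>, and every free row is tied to
  \<open>y0\<close> through a fixed free column \<open>x0\<close>.\<close>

lemma connected_passage:
  assumes N: "2 * b < N"
  shows "\<not> blocked N b X r l i j \<Longrightarrow> connected (passage N b X r l i j) \<and> passage N b X r l i j \<noteq> {}"
proof (induction r arbitrary: l i j)
  case 0
  have "convex (percolation_square N l i j)"
    unfolding percolation_square_def by (intro convex_Times) auto
  moreover have "(real i / real N ^ l, real j / real N ^ l) \<in> percolation_square N l i j"
    by (simp add: percolation_square_def divide_right_mono)
  ultimately show ?case by (auto intro: convex_connected)
next
  case (Suc r)
  let ?S = "\<lambda>x y. passage N b X r (Suc l) (i * N + x) (j * N + y)"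
  let ?col = "\<lambda>x. \<Union>y<N. ?S x y" and ?row = "\<lambda>y. \<Union>x<N. ?S x y"
  have col: "connected (?col x)" if "free_column N b X r l i j x" for x
  proof (rule connected_chain)
    show "connected (?S x y)" if "y < N" for y
      using Suc.IH \<open>free_column N b X r l i j x\<close> that unfolding free_column_def by blast
    show "?S x y \<inter> ?S x (Suc y) \<noteq> {}" if "Suc y < N" for y
    proof -
      have "\<not> blocked N b X r (Suc l) (i * N + x) (j * N + y)"
          "\<not> blocked N b X r (Suc l) (i * N + x) (j * N + Suc y)"
        using \<open>free_column N b X r l i j x\<close> that unfolding free_column_def by auto
      then show ?thesis unfolding add_Suc_right by (rule passage_meets_above[OF N])
    qed
  qed
  have row: "connected (?row y)" if "free_row N b X r l i j y" for y
  proof (rule connected_chain)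
    show "connected (?S x y)" if "x < N" for x
      using Suc.IH \<open>free_row N b X r l i j y\<close> that unfolding free_row_def by blast
    show "?S x y \<inter> ?S (Suc x) y \<noteq> {}" if "Suc x < N" for x
    proof -
      have "\<not> blocked N b X r (Suc l) (i * N + x) (j * N + y)"
          "\<not> blocked N b X r (Suc l) (i * N + Suc x) (j * N + y)"
        using \<open>free_row N b X r l i j y\<close> that unfolding free_row_def by auto
      then show ?thesis unfolding add_Suc_right by (rule passage_meets_right[OF N])
    qed
  qed
  have meet: "?col x \<inter> ?row y \<noteq> {}" if "x < N" "free_column N b X r l i j x" "y < N" "free_row N b X r l i j y" for x y
  proof -
    have "?S x y \<noteq> {}" using Suc.IH that unfolding free_column_def by blast
    then show ?thesis using that by blast
  qed
  obtain x0 y0 where x0: "x0 < N" "free_column N b X r l i j x0" and y0: "y0 < N" "free_row N b X r l i j y0"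
    using not_blocked_free[OF Suc.prems N] .
  \<comment> \<open>All members contain the row \<open>y0\<close>, hence the point \<open>z\<close>,
    and connected sets with a common point have a connected union.\<close>
  define T where "T = {?row y0 \<union> ?col x |x. x < N \<and> free_column N b X r l i j x}
    \<union> {(?row y0 \<union> ?col x0) \<union> ?row y |y. y < N \<and> free_row N b X r l i j y}"
  obtain z where z: "z \<in> ?row y0" using meet[OF x0 y0] by blast
  have "connected (\<Union>T)"
  proof (rule connected_Union)
    show "connected s" if "s \<in> T" for s
      using that unfolding T_def
    proof (elim UnE CollectE exE conjE)
      fix x assume x: "x < N" "free_column N b X r l i j x" and s: "s = ?row y0 \<union> ?col x"
      have "?row y0 \<inter> ?col x \<noteq> {}" using meet[OF x y0] by blast
      then show ?thesis unfolding s by (intro connected_Un row col y0 x)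
    next
      fix y assume y: "y < N" "free_row N b X r l i j y" and s: "s = (?row y0 \<union> ?col x0) \<union> ?row y"
      have "?row y0 \<inter> ?col x0 \<noteq> {}" using meet[OF x0 y0] by blast
      then have "connected (?row y0 \<union> ?col x0)" by (intro connected_Un row col y0 x0)
      moreover have "(?row y0 \<union> ?col x0) \<inter> ?row y \<noteq> {}" using meet[OF x0 y] by blast
      ultimately show ?thesis unfolding s using row[OF y(2)] by (metis connected_Un)
    qed
    show "\<Inter>T \<noteq> {}"
    proof -
      have "z \<in> s" if "s \<in> T" for s using that z unfolding T_def by blast
      then show ?thesis by blast
    qed
  qed
  moreover have "\<Union>T = passage N b X (Suc r) l i j"
  proof
    show "\<Union>T \<subseteq> passage N b X (Suc r) l i j"
      using x0 y0 unfolding T_def by fastforce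
    show "passage N b X (Suc r) l i j \<subseteq> \<Union>T"
    proof
      fix w assume "w \<in> passage N b X (Suc r) l i j"
      then obtain x y where xy: "x < N" "y < N" "free_column N b X r l i j x \<or> free_row N b X r l i j y" "w \<in> ?S x y"
        by auto
      then have "w \<in> ?col x" "w \<in> ?row y" by auto
      from xy(3) show "w \<in> \<Union>T"
      proof
        assume "free_column N b X r l i j x"
        then have "?row y0 \<union> ?col x \<in> T" using xy(1) unfolding T_def by blast
        then show ?thesis using \<open>w \<in> ?col x\<close> by blast
      next
        assume "free_row N b X r l i j y"
        then have "(?row y0 \<union> ?col x0) \<union> ?row y \<in> T" using xy(2) unfolding T_def by blast
        then show ?thesis using \<open>w \<in> ?row y\<close> by blast
      qed
    qed
  qed
  moreover have "z \<in> \<Union>T" using z x0 unfolding T_def by blast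
  ultimately show ?case by auto
qed

lemma passage_meets_left_side:
  assumes N: "2 * b < N"
  shows "\<not> blocked N b X r l i j \<Longrightarrow> \<exists>z\<in>passage N b X r l i j. fst z = real i / real N ^ l"
proof (induction r arbitrary: l i j)
  case 0
  show ?case
    by (rule bexI[of _ "(real i / real N ^ l, real j / real N ^ l)"]) (auto simp: percolation_square_def divide_right_mono)
next
  case (Suc r)
  have last: "0 < N" "N - 1 < N" using N by auto
  obtain x y where y: "y < N" "free_row N b X r l i j y" using not_blocked_free[OF Suc.prems N] .
  then have "\<not> blocked N b X r (Suc l) (i * N + 0) (j * N + y)" using last unfolding free_row_def by blast
  then obtain z where z: "z \<in> passage N b X r (Suc l) (i * N + 0) (j * N + y)" "fst z = real (i * N + 0) / real N ^ Suc l"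
    using Suc.IH by blast
  have "z \<in> passage N b X (Suc r) l i j"
    using z(1) y last passage_child[of _ N y b X r l i j] by blast
  moreover have "fst z = real i / real N ^ l" using z(2) N by simp
  ultimately show ?case by blast
qed

lemma passage_meets_right_side:
  assumes N: "2 * b < N"
  shows "\<not> blocked N b X r l i j \<Longrightarrow> \<exists>z\<in>passage N b X r l i j. fst z = (real i + 1) / real N ^ l"
proof (induction r arbitrary: l i j)
  case 0
  show ?case
    by (rule bexI[of _ "((real i + 1) / real N ^ l, real j / real N ^ l)"]) (auto simp: percolation_square_def divide_right_mono)
next
  case (Suc r)
  have last: "0 < N" "N - 1 < N" using N by auto
  obtain x y where y: "y < N" "free_row N b X r l i j y" using not_blocked_free[OF Suc.prems N] .
  then have "\<not> blocked N b X r (Suc l) (i * N + (N - 1)) (j * N + y)" using last unfolding free_row_def by blast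
  then obtain z where z: "z \<in> passage N b X r (Suc l) (i * N + (N - 1)) (j * N + y)"
      "fst z = (real (i * N + (N - 1)) + 1) / real N ^ Suc l"
    using Suc.IH by blast
  have "z \<in> passage N b X (Suc r) l i j"
    using z(1) y last passage_child[of _ N y b X r l i j] by blast
  moreover have "real (i * N + (N - 1)) + 1 = (real i + 1) * real N"
    using N by (simp add: of_nat_diff algebra_simps)
  then have "fst z = (real i + 1) / real N ^ l" using z(2) N by simp
  ultimately show ?case by blast
qed

section \<open>Cost of blocked squares and avoidance of the cover\<close>

definition grid_descendants :: "nat \<Rightarrow> nat \<Rightarrow> nat \<Rightarrow> nat \<Rightarrow> (nat \<times> nat \<times> nat) set" where
  "grid_descendants N l i j = {(m, i', j'). l \<le> m \<and> i' div N ^ (m - l) = i \<and> j' div N ^ (m - l) = j}"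

text \<open>A blocked square costs at least as much as covering it by itself: replacing a square of the cover
  by its blocked children does not lower the cost, as \<open>N powr t \<le> b\<close>.\<close>

lemma blocked_cost:
  assumes N: "1 \<le> N" and b: "real N powr t \<le> real b" and S: "finite S"
    and X: "\<And>l i j. X l i j \<longleftrightarrow> \<not> G l i j \<or> (l, i, j) \<in> S"
    and G: "\<And>l i j q q'. G l i j \<Longrightarrow> q \<in> {..<N} \<times> {..<N} \<Longrightarrow> q' \<in> {..<N} \<times> {..<N} \<Longrightarrow> q \<noteq> q' \<Longrightarrow>
      G (Suc l) (i * N + fst q) (j * N + snd q) \<or> G (Suc l) (i * N + fst q') (j * N + snd q')"
  shows "blocked N b X r l i j \<Longrightarrow> G l i j \<Longrightarrow>
    real N powr (- t * real l) \<le> (\<Sum>s\<in>S \<inter> grid_descendants N l i j. real N powr (- t * real (fst s)))"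
proof (induction r arbitrary: l i j)
  case self: (0 l i j)
  \<comment> \<open>A square counts among its own descendants, with \<open>m = l\<close>.\<close>
  then have "(l, i, j) \<in> S \<inter> grid_descendants N l i j" using X by (auto simp: grid_descendants_def)
  from member_le_sum[OF this, of "\<lambda>s. real N powr (- t * real (fst s))"] show ?case using S by simp
next
  case (Suc r)
  let ?w = "\<lambda>s :: nat \<times> nat \<times> nat. real N powr (- t * real (fst s))"
  let ?Q = "{..<N} \<times> {..<N}"
  show ?case
  proof (cases "(l, i, j) \<in> S")
    case True
    then have "(l, i, j) \<in> S \<inter> grid_descendants N l i j" by (auto simp: grid_descendants_def)
    from member_le_sum[OF this, of ?w] show ?thesis using S by simp
  next
    case False
    let ?D = "\<lambda>q. grid_descendants N (Suc l) (i * N + fst q) (j * N + snd q)"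
    define B where "B = {q \<in> ?Q. blocked N b X r (Suc l) (i * N + fst q) (j * N + snd q)}"
    define B' where "B' = {q \<in> B. G (Suc l) (i * N + fst q) (j * N + snd q)}"
    have fB: "finite B" by (auto simp: B_def)
    have "\<not> X l i j" using X False Suc.prems(2) by blast
    then have "b < card B" using Suc.prems(1) by (simp add: B_def)
    \<comment> \<open>By \<open>G\<close> at most one child is defective, so the strict inequality
      \<open>b < card B\<close> leaves at least \<open>b\<close> blocked children to which the
      induction applies.\<close>
    moreover have "card B \<le> card B' + 1"
    proof -
      have "card (B - B') \<le> 1"
      proof (rule card_le_Suc0_iff_eq[THEN iffD2, simplified One_nat_def[symmetric]])
        show "finite (B - B')" using fB by simp
        show "\<forall>x\<in>B - B'. \<forall>y\<in>B - B'. x = y"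
          using G[OF Suc.prems(2)] unfolding B'_def B_def by blast
      qed
      moreover have "B' \<subseteq> B" by (auto simp: B'_def)
      ultimately show ?thesis using card_Diff_subset[of B' B] fB finite_subset by fastforce
    qed
    ultimately have "b \<le> card B'" by simp
    \<comment> \<open>The child is recovered from any of its descendants as a digit in base
      \<open>N\<close>. Hence distinct children have disjoint sets of descendants and no square of
      \<open>S\<close> is counted twice.\<close>
    have child: "(m, i', j') \<in> grid_descendants N l i j \<and> q = (i' div N ^ (m - Suc l) mod N, j' div N ^ (m - Suc l) mod N)"
      if "q \<in> ?Q" "(m, i', j') \<in> ?D q" for q m i' j'
    proof -
      have m: "Suc l \<le> m" and e: "i' div N ^ (m - Suc l) = i * N + fst q" "j' div N ^ (m - Suc l) = j * N + snd q"
        using that by (auto simp: grid_descendants_def)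
      have "N ^ (m - l) = N ^ (m - Suc l) * N" using m by (simp add: Suc_diff_Suc flip: power_Suc2)
      then have "i' div N ^ (m - l) = (i * N + fst q) div N" "j' div N ^ (m - l) = (j * N + snd q) div N"
        using e by (simp_all add: div_mult2_eq)
      then show ?thesis using that m e by (cases q) (auto simp: grid_descendants_def)
    qed
    have "real N powr (- t * real l) \<le> real (card B') * real N powr (- t * real (Suc l))"
    proof -
      have "real N powr (- t * real l) = real N powr t * real N powr (- t * real (Suc l))"
        by (simp add: powr_add[symmetric] algebra_simps)
      also have "\<dots> \<le> real (card B') * real N powr (- t * real (Suc l))"
        using b \<open>b \<le> card B'\<close> by (intro mult_right_mono) auto
      finally show ?thesis .
    qed
    also have "\<dots> = (\<Sum>q\<in>B'. real N powr (- t * real (Suc l)))" by simp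
    also have "\<dots> \<le> (\<Sum>q\<in>B'. \<Sum>s\<in>S \<inter> ?D q. ?w s)"
      by (intro sum_mono Suc.IH) (auto simp: B'_def B_def)
    also have "\<dots> = sum ?w (\<Union>q\<in>B'. S \<inter> ?D q)"
    proof (rule sum.UNION_disjoint[symmetric])
      show "finite B'" using fB by (simp add: B'_def)
      show "\<forall>q\<in>B'. finite (S \<inter> ?D q)" using S by simp
      show "\<forall>q\<in>B'. \<forall>q'\<in>B'. q \<noteq> q' \<longrightarrow> (S \<inter> ?D q) \<inter> (S \<inter> ?D q') = {}"
      proof (intro ballI impI equals0I)
        fix q q' s assume qq: "q \<in> B'" "q' \<in> B'" "q \<noteq> q'" and s: "s \<in> (S \<inter> ?D q) \<inter> (S \<inter> ?D q')"
        obtain m i' j' where m: "s = (m, i', j')" by (cases s)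
        have "q \<in> ?Q" "q' \<in> ?Q" using qq by (auto simp: B'_def B_def)
        then show False using child[of q m i' j'] child[of q' m i' j'] s m qq(3) by auto
      qed
    qed
    also have "\<dots> \<le> sum ?w (S \<inter> grid_descendants N l i j)"
    proof (rule sum_mono2)
      show "(\<Union>q\<in>B'. S \<inter> ?D q) \<subseteq> S \<inter> grid_descendants N l i j"
      proof
        fix s assume "s \<in> (\<Union>q\<in>B'. S \<inter> ?D q)"
        then obtain q where "q \<in> ?Q" "s \<in> S" "s \<in> ?D q" by (auto simp: B'_def B_def)
        then show "s \<in> S \<inter> grid_descendants N l i j" using child by (cases s) auto
      qed
    qed (use S in auto)
    finally show ?thesis .
  qed
qed

text \<open>The passage lies in unblocked squares of every level from \<open>l\<close> to
  \<open>l + r\<close>. At level \<open>m\<close> such a square cannot meet \<open>W\<close>, since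
  \<open>X\<close> marks all squares that do.\<close>

lemma passage_avoids:
  assumes X: "\<And>i j. W \<inter> percolation_square N m i j \<noteq> {} \<Longrightarrow> X m i j" and N: "2 * b < N"
  shows "\<not> blocked N b X r l i j \<Longrightarrow> l \<le> m \<Longrightarrow> m \<le> l + r \<Longrightarrow> passage N b X r l i j \<inter> W = {}"
proof (induction r arbitrary: l i j)
  case 0
  then show ?case using X by auto
next
  case (Suc r)
  show ?case
  proof (cases "l = m")
    case True
    then have "W \<inter> percolation_square N l i j = {}" using X Suc.prems by auto
    then show ?thesis using passage_subset[of N b X "Suc r" l i j] by blast
  next
    case False
    have "passage N b X r (Suc l) (i * N + x) (j * N + y) \<inter> W = {}"
      if "x < N" "y < N" "free_column N b X r l i j x \<or> free_row N b X r l i j y" for x y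
      using that Suc False by (intro Suc.IH) (auto simp: free_column_def free_row_def)
    then show ?thesis by fastforce
  qed
qed

section \<open>Good percolations\<close>

definition percolation_top :: "nat \<Rightarrow> nat \<Rightarrow> (nat \<times> nat \<times> nat) set" where
  "percolation_top n k = {x \<in> percolation_indices n. fst x \<le> k}"

text \<open>The next \<open>k\<close> levels are complete and at most one of the
  \<open>n ^ k * n ^ k\<close> children is bad. The pairwise form suits a union bound over pairs of
  independent failures; the truncation at depth \<open>m\<close> makes the event accessible to
  induction.\<close>

primrec good_depth :: "nat \<Rightarrow> nat \<Rightarrow> nat \<Rightarrow> (nat \<times> nat \<times> nat \<Rightarrow> bool) \<Rightarrow> bool" where
  "good_depth n k 0 \<omega> = True"
| "good_depth n k (Suc m) \<omega> = ((\<forall>x\<in>percolation_top n k. \<omega> x) \<and>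
    (\<forall>q\<in>{..<n ^ k} \<times> {..<n ^ k}. \<forall>q'\<in>{..<n ^ k} \<times> {..<n ^ k}. q \<noteq> q' \<longrightarrow>
      good_depth n k m (percolation_shift n k q \<omega>) \<or> good_depth n k m (percolation_shift n k q' \<omega>)))"

definition good :: "nat \<Rightarrow> nat \<Rightarrow> (nat \<times> nat \<times> nat \<Rightarrow> bool) \<Rightarrow> bool" where
  "good n k \<omega> \<longleftrightarrow> (\<forall>m. good_depth n k m \<omega>)"

lemma good_depth_Suc: "good_depth n k (Suc m) \<omega> \<Longrightarrow> good_depth n k m \<omega>"
proof (induction m arbitrary: \<omega>)
  case (Suc m)
  have "(\<forall>x\<in>percolation_top n k. \<omega> x) \<and> (\<forall>q\<in>{..<n ^ k} \<times> {..<n ^ k}. \<forall>q'\<in>{..<n ^ k} \<times> {..<n ^ k}. q \<noteq> q' \<longrightarrow>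
      good_depth n k (Suc m) (percolation_shift n k q \<omega>) \<or> good_depth n k (Suc m) (percolation_shift n k q' \<omega>))"
    using Suc.prems good_depth.simps(2)[of n k "Suc m" \<omega>] by blast
  then show ?case
    unfolding good_depth.simps(2)[of n k m \<omega>] using Suc.IH by blast
qed simp

lemma good_depth_antimono: "m \<le> m' \<Longrightarrow> good_depth n k m' \<omega> \<Longrightarrow> good_depth n k m \<omega>"
  by (induction m' rule: dec_induct) (use good_depth_Suc in blast)+

text \<open>By monotonicity in the depth, failures of two children at different depths both persist
  at the larger depth.\<close>

lemma good_children:
  assumes "good n k \<omega>" "q \<in> {..<n ^ k} \<times> {..<n ^ k}" "q' \<in> {..<n ^ k} \<times> {..<n ^ k}" "q \<noteq> q'"
  shows "good n k (percolation_shift n k q \<omega>) \<or> good n k (percolation_shift n k q' \<omega>)"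
proof (rule ccontr)
  assume "\<not> ?thesis"
  then obtain m m' where "\<not> good_depth n k m (percolation_shift n k q \<omega>)" "\<not> good_depth n k m' (percolation_shift n k q' \<omega>)"
    unfolding good_def by blast
  then have "\<not> good_depth n k (max m m') (percolation_shift n k q \<omega>)" "\<not> good_depth n k (max m m') (percolation_shift n k q' \<omega>)"
    using good_depth_antimono[of m "max m m'"] good_depth_antimono[of m' "max m m'"] by auto
  moreover have "good_depth n k (Suc (max m m')) \<omega>" using assms(1) unfolding good_def by blast
  ultimately show False using assms(2-4) unfolding good_depth.simps by blast
qed

lemma good_kept:
  assumes n: "1 \<le> n" and good: "good n k \<omega>"
  shows "l \<le> k \<Longrightarrow> i < n ^ l \<Longrightarrow> j < n ^ l \<Longrightarrow> (i, j) \<in> percolation_kept n \<omega> l"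
proof (induction l arbitrary: i j)
  case (Suc l)
  have "good_depth n k (Suc 0) \<omega>" using good unfolding good_def by blast
  then have top: "\<forall>x\<in>percolation_top n k. \<omega> x" by simp
  have "(Suc l, i, j) \<in> percolation_top n k"
    unfolding percolation_top_def percolation_indices_def using Suc.prems by simp
  then have "\<omega> (Suc l, i, j)" using top by blast
  moreover have "i div n < n ^ l" "j div n < n ^ l"
    using Suc.prems n by (simp_all add: div_less_iff_less_mult mult.commute)
  ultimately show ?case using Suc.IH Suc.prems by simp
qed simp

lemma percolation_square_power: "percolation_square (n ^ k) l i j = percolation_square n (k * l) i j"
  by (simp add: percolation_square_def power_mult)

lemma percolation_shift_shift:
  assumes n: "1 \<le> n" and q: "fst q < n ^ k" "snd q < n ^ k"
  shows "percolation_shift n k q (percolation_shift n m (i, j) \<omega>) =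
    percolation_shift n (m + k) (i * n ^ k + fst q, j * n ^ k + snd q) \<omega>"
proof -
  have "percolation_shift n m (i, j) \<omega> (k + l, fst q * n ^ l + x, snd q * n ^ l + y) =
      \<omega> (m + k + l, (i * n ^ k + fst q) * n ^ l + x, (j * n ^ k + snd q) * n ^ l + y)"
    if "(l, x, y) \<in> percolation_indices n" for l x y
  proof -
    have "(k + l, fst q * n ^ l + x, snd q * n ^ l + y) \<in> percolation_block n k q"
      unfolding percolation_block_def using that by (rule rev_image_eqI) simp
    then have "(k + l, fst q * n ^ l + x, snd q * n ^ l + y) \<in> percolation_indices n"
      using percolation_block_subset[OF assms] by blast
    then show ?thesis
      by (simp add: percolation_shift_def power_add algebra_simps)
  qed
  then show ?thesis
    unfolding percolation_shift_def[of n k] percolation_shift_def[of n "m + k"]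
    by (intro restrict_ext) (auto split: prod.split)
qed

text \<open>An unblocked square is good, so all its cells \<open>k\<close> levels further down are
  kept; one renormalized level stands for \<open>k\<close> levels of the percolation.\<close>

lemma passage_subset_step:
  assumes n: "1 \<le> n" and X: "\<And>l i j. \<not> X l i j \<Longrightarrow> good n k (percolation_shift n (k * l) (i, j) \<omega>)"
  shows "\<not> blocked (n ^ k) b X r l i j \<Longrightarrow> (i, j) \<in> percolation_kept n \<omega> (k * l) \<Longrightarrow>
    passage (n ^ k) b X r l i j \<subseteq> percolation_step n \<omega> (k * (l + r))"
proof (induction r arbitrary: l i j)
  case 0
  then show ?case by (auto simp: percolation_step_def percolation_square_power)
next
  case (Suc r)
  have "passage (n ^ k) b X r (Suc l) (i * n ^ k + x) (j * n ^ k + y) \<subseteq> percolation_step n \<omega> (k * (l + Suc r))"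
    if xy: "x < n ^ k" "y < n ^ k" and free: "free_column (n ^ k) b X r l i j x \<or> free_row (n ^ k) b X r l i j y" for x y
  proof -
    have "\<not> X l i j" using Suc.prems(1) by simp
    then have "(x, y) \<in> percolation_kept n (percolation_shift n (k * l) (i, j) \<omega>) k"
      using X good_kept[OF n _ order_refl] xy by blast
    then have "(i * n ^ k + x, j * n ^ k + y) \<in> percolation_kept n \<omega> (k * Suc l)"
      using percolation_kept_shift[OF n Suc.prems(2) xy] by (simp add: add.commute)
    moreover have "\<not> blocked (n ^ k) b X r (Suc l) (i * n ^ k + x) (j * n ^ k + y)"
      using free xy unfolding free_column_def free_row_def by blast
    ultimately show ?thesis using Suc.IH[of "Suc l"] by simp
  qed
  then show ?case by fastforce
qed

section \<open>From balls to grid squares\<close>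

lemma exists_grid_level:
  fixes x N :: real
  assumes "1 < N" "0 < x" "x < 1"
  shows "\<exists>l. (1 / N) ^ Suc l \<le> x \<and> x < (1 / N) ^ l"
proof -
  have "\<exists>l. (1 / N) ^ Suc l \<le> x"
  proof -
    obtain l where "(1 / N) ^ l < x" using real_arch_pow_inv[of x "1 / N"] assms by auto
    moreover have "(1 / N) ^ Suc l \<le> (1 / N) ^ l" using assms by (simp add: mult_left_le_one_le field_simps)
    ultimately show ?thesis by (intro exI[of _ l]) linarith
  qed
  then have L: "(1 / N) ^ Suc (LEAST l. (1 / N) ^ Suc l \<le> x) \<le> x" by (rule LeastI_ex)
  moreover have "x < (1 / N) ^ (LEAST l. (1 / N) ^ Suc l \<le> x)"
  proof (cases "LEAST l. (1 / N) ^ Suc l \<le> x")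
    case 0
    then show ?thesis using assms by simp
  next
    case (Suc l)
    then have "\<not> (1 / N) ^ Suc l \<le> x" using not_less_Least[of l "\<lambda>l. (1 / N) ^ Suc l \<le> x"] by simp
    then show ?thesis using Suc by simp
  qed
  ultimately show ?thesis by blast
qed

lemma card_nat_near:
  fixes z :: real
  shows "finite {i::nat. z - 3/2 < real i \<and> real i < z + 1/2}" "card {i::nat. z - 3/2 < real i \<and> real i < z + 1/2} \<le> 3"
proof -
  have sub: "{i::nat. z - 3/2 < real i \<and> real i < z + 1/2} \<subseteq> nat ` {\<lfloor>z\<rfloor> - 1..\<lfloor>z\<rfloor> + 1}"
  proof
    fix i assume "i \<in> {i::nat. z - 3/2 < real i \<and> real i < z + 1/2}"
    then have "int i \<in> {\<lfloor>z\<rfloor> - 1..\<lfloor>z\<rfloor> + 1}" by simp linarith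
    then show "i \<in> nat ` {\<lfloor>z\<rfloor> - 1..\<lfloor>z\<rfloor> + 1}" by (intro image_eqI[of _ _ "int i"]) auto
  qed
  then show "finite {i::nat. z - 3/2 < real i \<and> real i < z + 1/2}" by (rule finite_subset) simp
  have "card {i::nat. z - 3/2 < real i \<and> real i < z + 1/2} \<le> card (nat ` {\<lfloor>z\<rfloor> - 1..\<lfloor>z\<rfloor> + 1})"
    using sub by (intro card_mono) auto
  also have "\<dots> \<le> card {\<lfloor>z\<rfloor> - 1..\<lfloor>z\<rfloor> + 1}" by (intro card_image_le) simp
  finally show "card {i::nat. z - 3/2 < real i \<and> real i < z + 1/2} \<le> 3" by simp
qed

text \<open>Scaled by \<open>N ^ l\<close> the ball has radius below \<open>1 / 2\<close>. In each
  coordinate the lower index of a square that it meets lies in an interval of length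
  \<open>2\<close>, which leaves at most three values.\<close>

lemma card_squares_meeting_ball:
  fixes c :: "real \<times> real"
  assumes N: "1 \<le> N" and \<rho>: "2 * \<rho> < (1 / real N) ^ l"
  shows "finite {(i, j). ball c \<rho> \<inter> percolation_square N l i j \<noteq> {}}"
    and "card {(i, j). ball c \<rho> \<inter> percolation_square N l i j \<noteq> {}} \<le> 9"
proof -
  let ?I = "\<lambda>z. {i::nat. z - 3/2 < real i \<and> real i < z + 1/2}"
  let ?B = "?I (fst c * real N ^ l) \<times> ?I (snd c * real N ^ l)"
  have P: "0 < real N ^ l" using N by simp
  have \<rho>': "\<rho> * real N ^ l < 1 / 2" using \<rho> P by (simp add: power_divide field_simps)
  have near: "i \<in> ?I (a * real N ^ l)" if "\<bar>a - x\<bar> < \<rho>" "real i / real N ^ l \<le> x" "x \<le> (real i + 1) / real N ^ l" for i a x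
  proof -
    have "real i \<le> x * real N ^ l" "x * real N ^ l \<le> real i + 1"
      using that(2,3) P by (simp_all add: field_simps)
    moreover have "\<bar>a - x\<bar> * real N ^ l < \<rho> * real N ^ l" using that(1) P by simp
    moreover have "\<bar>a * real N ^ l - x * real N ^ l\<bar> = \<bar>a - x\<bar> * real N ^ l"
      using P by (simp add: abs_mult left_diff_distrib[symmetric])
    ultimately have "\<bar>a * real N ^ l - x * real N ^ l\<bar> < 1 / 2" "real i \<le> x * real N ^ l" "x * real N ^ l \<le> real i + 1"
      using \<rho>' by linarith+
    then show ?thesis unfolding mem_Collect_eq by linarith
  qed
  have sub: "{(i, j). ball c \<rho> \<inter> percolation_square N l i j \<noteq> {}} \<subseteq> ?B"
  proof (rule subrelI, unfold mem_Collect_eq case_prod_conv)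
    fix i j assume "ball c \<rho> \<inter> percolation_square N l i j \<noteq> {}"
    then obtain x y where p: "(x, y) \<in> ball c \<rho>" "(x, y) \<in> percolation_square N l i j" by auto
    have "\<bar>fst c - x\<bar> < \<rho>" "\<bar>snd c - y\<bar> < \<rho>"
      using p(1) dist_fst_le[of c "(x, y)"] dist_snd_le[of c "(x, y)"] by (auto simp: dist_real_def)
    then show "(i, j) \<in> ?B"
      using p(2) near unfolding percolation_square_def by auto
  qed
  have fin: "finite ?B" by (intro finite_cartesian_product card_nat_near(1))
  show "finite {(i, j). ball c \<rho> \<inter> percolation_square N l i j \<noteq> {}}" using sub fin by (rule finite_subset)
  have "card {(i, j). ball c \<rho> \<inter> percolation_square N l i j \<noteq> {}} \<le> card ?B" using sub fin by (intro card_mono)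
  also have "\<dots> \<le> 3 * 3"
    unfolding card_cartesian_product by (intro mult_le_mono card_nat_near(2))
  finally show "card {(i, j). ball c \<rho> \<inter> percolation_square N l i j \<noteq> {}} \<le> 9" by simp
qed

text \<open>The cover of a cheap cut by balls is turned into a cover by grid squares; its cost is below that of
  the unit square, so the unit square is not blocked and a passage crosses it, missing the cut.\<close>

lemma good_not_cuttable:
  assumes n: "2 \<le> n" and k: "1 \<le> k" and t: "0 < t"
    and b: "real (n ^ k) powr t \<le> real b" "2 * b < n ^ k"
    and good: "good n k \<omega>" and ext: "\<omega> \<in> extensional (percolation_indices n)"
  shows "\<not> cuttable t (percolation_limit n \<omega>)"
proof
  assume cut: "cuttable t (percolation_limit n \<omega>)"
  define N where "N = n ^ k"
  have n1: "1 \<le> n" using n by simp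
  have N2: "2 \<le> N" using n k self_le_power[of n k] unfolding N_def by simp
  \<comment> \<open>A ball of radius \<open>r\<close> is traded for at most \<open>9\<close> squares
    of side at most \<open>2 * N * r\<close>. This budget keeps the total cost of the squares below
    \<open>1\<close> and the radii below \<open>1 / 2\<close>.\<close>
  define \<epsilon> where "\<epsilon> = 1 / (9 * (2 * real N) powr t)"
  have \<epsilon>: "0 < \<epsilon>" using N2 by (simp add: \<epsilon>_def)
  \<comment> \<open>The cut has to separate the left side of the unit square from its right side,
    which lies outside \<open>?V\<close>.\<close>
  let ?A = "{0} \<times> {0..1::real} :: (real \<times> real) set" and ?V = "{z :: real \<times> real. fst z < 1}"
  have "open ?V" by (intro open_Collect_less continuous_intros)
  moreover have "compact ?A" by (intro compact_Times) auto
  moreover have "?A \<subseteq> ?V" by auto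
  ultimately obtain U where U: "open U" "?A \<subseteq> U" "closure U \<subseteq> ?V" "coverable t \<epsilon> (percolation_limit n \<omega> \<inter> frontier U)"
    using cuttableD[OF cut _ _ _ \<epsilon>] by metis
  then obtain F where F: "finite F" "\<forall>(x, r)\<in>F. 0 < r" "percolation_limit n \<omega> \<inter> frontier U \<subseteq> ball_union F" "ball_cost t F < \<epsilon>"
    unfolding coverable_def by metis
  have rad: "0 < snd p" "2 * snd p < 1" if "p \<in> F" for p
  proof -
    show pos: "0 < snd p" using F(2) that by auto
    have "snd p powr t < \<epsilon>" using radius_powr_le_cost[of F "fst p" "snd p" t] F that by simp
    also have "\<epsilon> \<le> (1 / 2) powr t"
    proof -
      have "2 powr t \<le> (2 * real N) powr t" using N2 t by (intro powr_mono2) auto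
      then have "2 powr t \<le> 9 * (2 * real N) powr t" by (smt (verit) powr_ge_zero)
      then show ?thesis by (simp add: \<epsilon>_def powr_divide frac_le)
    qed
    finally have "snd p < 1 / 2" using t by (meson not_less powr_mono2 less_imp_le zero_le_divide_1_iff zero_le_numeral)
    then show "2 * snd p < 1" by simp
  qed
  have "\<exists>l. (1 / real N) ^ Suc l \<le> 2 * snd p \<and> 2 * snd p < (1 / real N) ^ l" if "p \<in> F" for p
    using rad[OF that] N2 by (intro exists_grid_level) auto
  then obtain lv where lv: "\<And>p. p \<in> F \<Longrightarrow> (1 / real N) ^ Suc (lv p) \<le> 2 * snd p"
      "\<And>p. p \<in> F \<Longrightarrow> 2 * snd p < (1 / real N) ^ lv p" by metis
  define Q where "Q p = {(i, j). ball (fst p) (snd p) \<inter> percolation_square N (lv p) i j \<noteq> {}}" for p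
  have Q: "finite (Q p)" "card (Q p) \<le> 9" if "p \<in> F" for p
    using card_squares_meeting_ball[of N "snd p" "lv p" "fst p"] lv(2)[OF that] N2 unfolding Q_def by auto
  define S where "S = (\<lambda>(p, i, j). (lv p, i, j)) ` Sigma F Q"
  let ?w = "\<lambda>s :: nat \<times> nat \<times> nat. real N powr (- t * real (fst s))"
  have finS: "finite S" unfolding S_def using F(1) Q(1) by (intro finite_imageI finite_SigmaI) auto
  have sumS: "sum ?w S < 1"
  proof -
    have "sum ?w S \<le> (\<Sum>x\<in>Sigma F Q. ?w ((\<lambda>(p, i, j). (lv p, i, j)) x))"
      unfolding S_def using F(1) Q(1) sum_image_le[of "Sigma F Q" ?w "\<lambda>(p, i, j). (lv p, i, j)"] by (simp add: comp_def)
    also have "\<dots> = (\<Sum>p\<in>F. \<Sum>x\<in>Q p. real N powr (- t * real (lv p)))"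
      using F(1) Q(1) by (subst sum.Sigma) (auto intro!: sum.cong)
    also have "\<dots> \<le> (\<Sum>p\<in>F. 9 * ((2 * real N) powr t * snd p powr t))"
    proof (intro sum_mono)
      fix p assume p: "p \<in> F"
      have "(1 / real N) ^ lv p = real N powr (- real (lv p))"
        using N2 by (simp add: powr_minus powr_realpow power_divide inverse_eq_divide)
      then have "real N powr (- t * real (lv p)) = ((1 / real N) ^ lv p) powr t"
        by (simp add: powr_powr mult.commute)
      also have "\<dots> \<le> (2 * real N * snd p) powr t"
        using lv(1)[OF p] N2 t by (intro powr_mono2) (auto simp: field_simps)
      also have "\<dots> = (2 * real N) powr t * snd p powr t"
        by (rule powr_mult)
      finally have "real N powr (- t * real (lv p)) \<le> (2 * real N) powr t * snd p powr t" .
      then show "(\<Sum>x\<in>Q p. real N powr (- t * real (lv p))) \<le> 9 * ((2 * real N) powr t * snd p powr t)"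
        using Q(2)[OF p] by (simp add: mult_mono)
    qed
    also have "\<dots> = 9 * (2 * real N) powr t * ball_cost t F"
      by (simp add: ball_cost_def case_prod_beta sum_distrib_left mult.assoc)
    also have "\<dots> < 9 * (2 * real N) powr t * \<epsilon>" using F(4) N2 by simp
    also have "\<dots> = 1" using N2 by (simp add: \<epsilon>_def)
    finally show ?thesis .
  qed
  define G where "G l i j \<longleftrightarrow> good n k (percolation_shift n (k * l) (i, j) \<omega>)" for l i j
  define X where "X l i j \<longleftrightarrow> \<not> G l i j \<or> (l, i, j) \<in> S" for l i j
  \<comment> \<open>Extensionality enters here: the trivial shift restricts \<open>\<omega>\<close>
    to the index set.\<close>
  have "percolation_shift n 0 (0, 0) \<omega> = \<omega>"
    using ext by (auto simp: percolation_shift_def fun_eq_iff extensional_def)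
  then have G0: "G 0 0 0" using good by (simp add: G_def)
  have Gstep: "G (Suc l) (i * N + fst q) (j * N + snd q) \<or> G (Suc l) (i * N + fst q') (j * N + snd q')"
    if "G l i j" "q \<in> {..<N} \<times> {..<N}" "q' \<in> {..<N} \<times> {..<N}" "q \<noteq> q'" for l i j q q'
  proof -
    have "percolation_shift n k x (percolation_shift n (k * l) (i, j) \<omega>) =
        percolation_shift n (k * Suc l) (i * N + fst x, j * N + snd x) \<omega>" if "x \<in> {..<N} \<times> {..<N}" for x
      using percolation_shift_shift[OF n1, of x k "k * l" i j \<omega>] that by (simp add: N_def mem_Times_iff add.commute)
    then show ?thesis using good_children[of n k _ q q'] that unfolding G_def N_def by metis
  qed
  \<comment> \<open>Some finite step already misses the frontier outside the balls, so a passage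
    through the squares of that step is enough and no crossing of the limit set itself has to be
    built.\<close>
  obtain k0 where k0: "percolation_step n \<omega> k0 \<inter> (frontier U - ball_union F) = {}"
    using F(3) percolation_limit_disjoint_iff[OF n1, of "frontier U - ball_union F" \<omega>]
    by (auto simp: closed_Diff)
  \<comment> \<open>Deep enough for the passage to lie in step \<open>k0\<close> and to resolve
    every level used by the cover.\<close>
  define r where "r = Max (insert k0 (lv ` F))"
  have r: "k0 \<le> r" "\<And>p. p \<in> F \<Longrightarrow> lv p \<le> r" using F(1) by (auto simp: r_def)
  have nb: "\<not> blocked N b X r 0 0 0"
  proof
    assume "blocked N b X r 0 0 0"
    then have "real N powr (- t * real 0) \<le> sum ?w (S \<inter> grid_descendants N 0 0 0)"
      using N2 b(1) finS X_def Gstep G0 by (intro blocked_cost[where G = G]) (auto simp: N_def)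
    also have "\<dots> \<le> sum ?w S" using finS by (intro sum_mono2) auto
    finally show False using sumS N2 by simp
  qed
  define Z where "Z = passage N b X r 0 0 0"
  have b2: "2 * b < N" using b(2) by (simp add: N_def)
  have "Z \<subseteq> percolation_step n \<omega> (k * (0 + r))"
    unfolding Z_def N_def
  proof (rule passage_subset_step[OF n1])
    show "good n k (percolation_shift n (k * l) (i, j) \<omega>)" if "\<not> X l i j" for l i j
      using that by (simp add: X_def G_def)
    show "\<not> blocked (n ^ k) b X r 0 0 0" using nb by (simp add: N_def)
  qed simp
  moreover have "k0 \<le> k * (0 + r)" using r(1) k by (metis add_0 le_trans mult_le_mono1 nat_mult_1)
  ultimately have Zstep: "Z \<subseteq> percolation_step n \<omega> k0"
    using percolation_step_antimono[OF n1] by blast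
  have "Z \<inter> ball (fst p) (snd p) = {}" if "p \<in> F" for p
    unfolding Z_def
  proof (rule passage_avoids[OF _ b2 nb])
    show "X (lv p) i j" if "ball (fst p) (snd p) \<inter> percolation_square N (lv p) i j \<noteq> {}" for i j
    proof -
      have "(p, i, j) \<in> Sigma F Q" using that \<open>p \<in> F\<close> by (simp add: Q_def)
      then have "(lv p, i, j) \<in> S" unfolding S_def by (rule rev_image_eqI) simp
      then show ?thesis by (simp add: X_def)
    qed
  qed (use r(2) that in auto)
  then have "Z \<inter> ball_union F = {}" by (auto simp: ball_union_def case_prod_beta)
  then have Zfr: "Z \<inter> frontier U = {}" using Zstep k0 by blast
  obtain z where z: "z \<in> Z" "fst z = 0"
    using passage_meets_left_side[OF b2 nb] unfolding Z_def by auto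
  obtain z' where z': "z' \<in> Z" "fst z' = 1"
    using passage_meets_right_side[OF b2 nb] unfolding Z_def by auto
  have "z \<in> percolation_square N 0 0 0" using z(1) passage_subset unfolding Z_def by blast
  then have "z \<in> ?A" using z(2) by (cases z) (auto simp: percolation_square_def)
  \<comment> \<open>\<open>Z\<close> is connected, meets \<open>U\<close> on the left side and has a
    point outside \<open>U\<close> on the right side, so it must cross the frontier that it was
    shown to miss.\<close>
  then have "Z \<inter> U \<noteq> {}" using z(1) U(2) by blast
  moreover have "Z - U \<noteq> {}" using z' U(3) closure_subset[of U] by fastforce
  ultimately have "Z \<inter> frontier U \<noteq> {}"
    using connected_passage[OF b2 nb] unfolding Z_def by (intro connected_Int_frontier) auto
  then show False using Zfr by blast
qed

section \<open>Probability of a good percolation\<close>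

lemma finite_percolation_top: 
  assumes "1 \<le> n"
  shows "finite (percolation_top n k)"
proof (rule finite_subset)
  show "percolation_top n k \<subseteq> {..k} \<times> {..<n ^ k} \<times> {..<n ^ k}"
  proof clarify
    fix l i j assume "(l, i, j) \<in> percolation_top n k"
    then have "l \<le> k" "i < n ^ l" "j < n ^ l" by (auto simp: percolation_top_def percolation_indices_def)
    moreover have "n ^ l \<le> n ^ k" using assms \<open>l \<le> k\<close> by (intro power_increasing) auto
    ultimately show "l \<in> {..k} \<and> (i, j) \<in> {..<n ^ k} \<times> {..<n ^ k}" by simp
  qed
qed simp

lemma pred_good_depth:
  assumes n: "1 \<le> n"
  shows "Measurable.pred (percolation_space p n) (good_depth n k m)"
proof (induction m)
  case (Suc m)
  have c: "Measurable.pred (percolation_space p n) (\<lambda>\<omega>. \<omega> x)" if "x \<in> percolation_top n k" for x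
    unfolding percolation_space_def using that by (intro pred_PiM_pmf_component) (simp add: percolation_top_def)
  have s: "Measurable.pred (percolation_space p n) (\<lambda>\<omega>. good_depth n k m (percolation_shift n k q \<omega>))"
    if "q \<in> {..<n ^ k} \<times> {..<n ^ k}" for q
  proof -
    have "percolation_block n k q \<subseteq> percolation_indices n" using that by (intro percolation_block_subset n) auto
    from measurable_compose[OF measurable_percolation_shift[OF this] Suc] show ?thesis
      by (simp add: percolation_space_def)
  qed
  show ?case
    unfolding good_depth.simps
    by (intro pred_intros_logic pred_intros_finite finite_percolation_top n c s) auto
next
  case 0
  have "good_depth n k 0 = (\<lambda>\<omega>. True)" by auto
  then show ?case by simp
qed

text \<open>The bound \<open>\<delta>\<close> reproduces itself: depth \<open>Suc m\<close> fails
  only if a top square is missing or two different children fail at depth \<open>m\<close>. There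
  are at most \<open>(n ^ k) ^ 4\<close> ordered pairs, each failing with probability at most
  \<open>\<delta>\<^sup>2\<close> by independence.\<close>

lemma prob_not_good_depth:
  assumes n: "1 \<le> n" and p: "0 \<le> p" "p \<le> 1" and \<delta>: "0 \<le> \<delta>"
    and small: "real (card (percolation_top n k)) * (1 - p) + real (n ^ k) ^ 4 * \<delta>\<^sup>2 \<le> \<delta>"
  shows "\<P>(\<omega> in percolation_space p n. \<not> good_depth n k m \<omega>) \<le> \<delta>"
proof (induction m)
  case 0
  then show ?case using \<delta> by simp
next
  case (Suc m)
  let ?P = "percolation_space p n" and ?Q = "{..<n ^ k} \<times> {..<n ^ k}" and ?T = "percolation_top n k"
  let ?QQ = "{x \<in> ?Q \<times> ?Q. fst x \<noteq> snd x}"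
  interpret prob_space ?P by (rule prob_space_percolation)
  let ?E = "\<lambda>x. {\<omega>\<in>space ?P. \<not> \<omega> x}"
  let ?H = "\<lambda>x. {\<omega>\<in>space ?P. \<not> good_depth n k m (percolation_shift n k (fst x) \<omega>) \<and>
      \<not> good_depth n k m (percolation_shift n k (snd x) \<omega>)}"
  have pc: "{\<omega>\<in>space ?P. \<omega> x} \<in> events" if "x \<in> ?T" for x
  proof -
    have "Measurable.pred ?P (\<lambda>\<omega>. \<omega> x)"
      unfolding percolation_space_def using that by (intro pred_PiM_pmf_component) (simp add: percolation_top_def)
    then show ?thesis by (simp only: pred_def)
  qed
  have E: "prob (?E x) = 1 - p" "?E x \<in> events" if "x \<in> ?T" for x
  proof -
    have "x \<in> percolation_indices n" using that by (simp add: percolation_top_def)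
    then show "prob (?E x) = 1 - p"
      using prob_neg[OF pc[OF that]] prob_percolation_coordinate[OF _ p] by simp
    show "?E x \<in> events" using pc[OF that] by (rule sets.sets_Collect_neg)
  qed
  have sh: "Measurable.pred ?P (\<lambda>\<omega>. \<not> good_depth n k m (percolation_shift n k q \<omega>))" if "q \<in> ?Q" for q
  proof -
    have "percolation_block n k q \<subseteq> percolation_indices n" using that by (intro percolation_block_subset n) auto
    from measurable_compose[OF measurable_percolation_shift[OF this] pred_good_depth[OF n]]
    have "Measurable.pred ?P (\<lambda>\<omega>. good_depth n k m (percolation_shift n k q \<omega>))"
      by (simp add: percolation_space_def)
    then show ?thesis by (rule pred_intros_logic(2))
  qed
  have H: "prob (?H x) \<le> \<delta>\<^sup>2" "?H x \<in> events" if "x \<in> ?QQ" for x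
  proof -
    have q: "fst x \<in> ?Q" "snd x \<in> ?Q" "fst x \<noteq> snd x" using that by auto
    have "Measurable.pred ?P (\<lambda>\<omega>. \<not> good_depth n k m \<omega>)"
      using pred_good_depth[OF n] by (rule pred_intros_logic(2))
    from prob_percolation_shift_pair[OF n q this]
    have "prob (?H x) = prob {\<omega>\<in>space ?P. \<not> good_depth n k m \<omega>} ^ 2" by simp
    also have "\<dots> \<le> \<delta>\<^sup>2" using Suc.IH by (intro power_mono) auto
    finally show "prob (?H x) \<le> \<delta>\<^sup>2" .
    have "Measurable.pred ?P (\<lambda>\<omega>. \<not> good_depth n k m (percolation_shift n k (fst x) \<omega>) \<and>
      \<not> good_depth n k m (percolation_shift n k (snd x) \<omega>))"
      using sh[OF q(1)] sh[OF q(2)] by (rule pred_intros_logic(3))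
    then show "?H x \<in> events" by (simp only: pred_def)
  qed
  have fin: "finite ?T" "finite ?QQ" using finite_percolation_top[OF n] by auto
  have "{\<omega>\<in>space ?P. \<not> good_depth n k (Suc m) \<omega>} \<subseteq> (\<Union>x\<in>?T. ?E x) \<union> (\<Union>x\<in>?QQ. ?H x)"
  proof
    fix \<omega> assume w: "\<omega> \<in> {\<omega>\<in>space ?P. \<not> good_depth n k (Suc m) \<omega>}"
    show "\<omega> \<in> (\<Union>x\<in>?T. ?E x) \<union> (\<Union>x\<in>?QQ. ?H x)"
    proof (cases "\<forall>x\<in>?T. \<omega> x")
      case True
      then obtain q q' where "q \<in> ?Q" "q' \<in> ?Q" "q \<noteq> q'"
        "\<not> good_depth n k m (percolation_shift n k q \<omega>)" "\<not> good_depth n k m (percolation_shift n k q' \<omega>)"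
        using w unfolding good_depth.simps by blast
      then have "\<omega> \<in> ?H (q, q')" "(q, q') \<in> ?QQ" using w by auto
      then show ?thesis by blast
    next
      case False
      then show ?thesis using w by blast
    qed
  qed
  then have "prob {\<omega>\<in>space ?P. \<not> good_depth n k (Suc m) \<omega>} \<le> prob ((\<Union>x\<in>?T. ?E x) \<union> (\<Union>x\<in>?QQ. ?H x))"
    using E(2) H(2) fin by (intro finite_measure_mono sets.Un sets.finite_UN) auto
  also have "\<dots> \<le> prob (\<Union>x\<in>?T. ?E x) + prob (\<Union>x\<in>?QQ. ?H x)"
    using E(2) H(2) fin by (intro measure_Un_le sets.finite_UN) auto
  also have "\<dots> \<le> (\<Sum>x\<in>?T. prob (?E x)) + (\<Sum>x\<in>?QQ. prob (?H x))"
    using E(2) H(2) fin by (intro add_mono measure_UNION_le) auto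
  also have "\<dots> \<le> (\<Sum>x\<in>?T. 1 - p) + (\<Sum>x\<in>?QQ. \<delta>\<^sup>2)"
    using E(1) H(1) by (intro add_mono sum_mono) auto
  also have "\<dots> \<le> real (card ?T) * (1 - p) + real (n ^ k) ^ 4 * \<delta>\<^sup>2"
  proof -
    have "card ?QQ \<le> card (?Q \<times> ?Q)" by (intro card_mono) auto
    also have "\<dots> = (n ^ k) ^ 4" by (simp add: card_cartesian_product power4_eq_xxxx)
    finally have "real (card ?QQ) \<le> real ((n ^ k) ^ 4)" by (simp only: of_nat_le_iff)
    then have "real (card ?QQ) * \<delta>\<^sup>2 \<le> real (n ^ k) ^ 4 * \<delta>\<^sup>2" by (intro mult_right_mono) auto
    then show ?thesis by simp
  qed
  also have "\<dots> \<le> \<delta>" by (rule small)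
  finally show ?case .
qed

text \<open>As \<open>t < 1\<close>, some \<open>k\<close> gives \<open>N powr (1 - t) > 4\<close>,
  that is \<open>4 * N powr t < N\<close>, and also \<open>4 < N\<close>. Rounding
  \<open>N powr t\<close> up to \<open>b\<close> then yields
  \<open>2 * b < 2 * N powr t + 2 < N / 2 + 2 < N\<close>.\<close>

lemma exists_scale:
  assumes n: "2 \<le> n" and t: "0 < t" "t < 1"
  obtains k b where "1 \<le> k" "real (n ^ k) powr t \<le> real b" "2 * b < n ^ k"
proof -
  have "1 < real n powr (1 - t)" using n t by (intro gr_one_powr) auto
  then obtain k where k: "4 < (real n powr (1 - t)) ^ k" using real_arch_pow by blast
  define N where "N = real (n ^ k)"
  have N1: "1 \<le> N" using n by (simp add: N_def)
  have "(real n powr (1 - t)) ^ k = N powr (1 - t)"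
    using n by (simp add: N_def powr_realpow[symmetric] powr_powr mult.commute)
  then have N: "4 < N powr (1 - t)" using k by simp
  also have "N powr (1 - t) \<le> N powr 1" using N1 t by (intro powr_mono) auto
  finally have "4 < N" using N1 by simp
  have "N = N powr t * N powr (1 - t)" using N1 by (simp add: powr_add[symmetric])
  moreover have "N powr t * 4 < N powr t * N powr (1 - t)" using N N1 by simp
  ultimately have small: "4 * N powr t < N" by simp
  define b where "b = nat \<lceil>N powr t\<rceil>"
  have b: "N powr t \<le> real b" "real b < N powr t + 1"
    using ceiling_correct[of "N powr t"] powr_ge_zero[of N t] unfolding b_def by linarith+
  then have "real (2 * b) < real (n ^ k)" using small \<open>4 < N\<close> by (simp add: N_def)
  then have "2 * b < n ^ k" by (simp only: of_nat_less_iff)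
  moreover have "1 \<le> k" using k by (cases k) auto
  ultimately show thesis using that b(1) unfolding N_def by blast
qed

lemma exists_parameter_not_cuttable:
  assumes n: "2 \<le> n" and t: "0 < t" "t < 1"
  obtains p where "0 < p" "p < 1" "\<not> (AE \<omega> in percolation_space p n. cuttable t (percolation_limit n \<omega>))"
proof -
  have n1: "1 \<le> n" using n by simp
  obtain k b where k: "1 \<le> k" "real (n ^ k) powr t \<le> real b" "2 * b < n ^ k"
    using exists_scale[OF assms] .
  define N where "N = real (n ^ k)"
  have N: "1 \<le> N" using n by (simp add: N_def)
  \<comment> \<open>Chosen so that the quadratic term \<open>N ^ 4 * \<delta>\<^sup>2\<close> equals
    \<open>\<delta> / 2\<close>; the choice of \<open>p\<close> below leaves the other half for
    missing squares.\<close>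
  define \<delta> where "\<delta> = 1 / (2 * N ^ 4)"
  have "1 \<le> N ^ 4" using N by simp
  then have "1 / N ^ 4 \<le> 1" by (simp add: divide_le_eq_1)
  then have \<delta>: "0 < \<delta>" "\<delta> \<le> 1 / 2" using N by (simp_all add: \<delta>_def)
  define c where "c = real (card (percolation_top n k))"
  have c: "0 \<le> c" by (simp add: c_def)
  define p where "p = 1 - \<delta> / (2 * (c + 1))"
  have "\<delta> / (2 * (c + 1)) < 1" using \<delta> c by (simp add: divide_less_eq)
  moreover have "0 < \<delta> / (2 * (c + 1))" using \<delta> c by simp
  ultimately have p: "0 < p" "p < 1" by (auto simp: p_def)
  have "c * (1 - p) \<le> \<delta> / 2"
    using c \<delta> by (simp add: p_def field_simps)
  moreover have "N ^ 4 * \<delta> = 1 / 2" using N by (simp add: \<delta>_def)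
  then have "N ^ 4 * \<delta>\<^sup>2 = \<delta> / 2" by (simp add: power2_eq_square flip: mult.assoc)
  ultimately have small: "c * (1 - p) + N ^ 4 * \<delta>\<^sup>2 \<le> \<delta>" by simp
  let ?P = "percolation_space p n"
  interpret prob_space ?P by (rule prob_space_percolation)
  let ?A = "\<lambda>m. {\<omega>\<in>space ?P. good_depth n k m \<omega>}"
  have A: "?A m \<in> events" for m using pred_good_depth[OF n1, where p = p and k = k and m = m] by (simp only: pred_def)
  have lower: "1 / 2 \<le> prob (?A m)" for m
    using prob_not_good_depth[OF n1, where p = p and \<delta> = \<delta> and k = k and m = m] small p \<delta> prob_neg[OF A[of m]]
    by (simp add: c_def N_def)
  \<comment> \<open>The lower bound is uniform in the depth, so it survives in the decreasing limit,
    the event of being good at all depths.\<close>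
  have "(\<lambda>m. prob (?A m)) \<longlonglongrightarrow> prob (\<Inter>m. ?A m)"
    using A good_depth_antimono by (intro finite_Lim_measure_decseq) (auto simp: decseq_def)
  then have ge: "1 / 2 \<le> prob (\<Inter>m. ?A m)" by (rule LIMSEQ_le_const) (use lower in auto)
  have "\<not> (AE \<omega> in ?P. cuttable t (percolation_limit n \<omega>))"
  proof
    assume AE: "AE \<omega> in ?P. cuttable t (percolation_limit n \<omega>)"
    have "AE \<omega> in ?P. \<omega> \<notin> (\<Inter>m. ?A m)"
      using AE AE_space
    proof eventually_elim
      case (elim \<omega>)
      have "\<omega> \<in> extensional (percolation_indices n)"
        using elim(2) by (auto simp: percolation_space_def space_PiM PiE_def)
      then have "\<not> good n k \<omega>" using good_not_cuttable[OF n k(1) t(1) k(2,3)] elim(1) by blast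
      then show ?case by (auto simp: good_def)
    qed
    moreover have "(\<Inter>m. ?A m) \<in> events" using A by (intro sets.countable_INT) auto
    ultimately have "prob (\<Inter>m. ?A m) = 0" using prob_eq_0 by blast
    then show False using ge by simp
  qed
  then show thesis using that p by blast
qed

section \<open>The critical probability\<close>

lemma topological_hausdorff_dim_percolation_limit_le_iff:
  assumes "1 \<le> n" "0 \<le> d"
  shows "topological_hausdorff_dim (percolation_limit n \<omega>) \<le> ereal d \<longleftrightarrow>
    (\<forall>t\<in>{t\<in>\<rat>. 0 \<le> t \<and> d - 1 < t}. cuttable t (percolation_limit n \<omega>))"
  using assms by (intro topological_hausdorff_dim_le_iff compact_percolation_limit)

lemma countable_exponents: "countable {t::real. t \<in> \<rat> \<and> P t}"
  using countable_rat by (rule countable_subset[rotated]) auto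

lemma AE_topological_hausdorff_dim_le_iff:
  assumes "1 \<le> n" "0 \<le> d"
  shows "(AE \<omega> in percolation_space p n. topological_hausdorff_dim (percolation_limit n \<omega>) \<le> ereal d) \<longleftrightarrow>
    (\<forall>t\<in>{t\<in>\<rat>. 0 \<le> t \<and> d - 1 < t}. AE \<omega> in percolation_space p n. cuttable t (percolation_limit n \<omega>))"
  unfolding topological_hausdorff_dim_percolation_limit_le_iff[OF assms]
  by (rule AE_ball_countable[OF countable_exponents])

lemma pred_topological_hausdorff_dim_less:
  assumes "1 \<le> n" "0 \<le> d"
  shows "Measurable.pred (percolation_space p n) (\<lambda>\<omega>. ereal d < topological_hausdorff_dim (percolation_limit n \<omega>))"
proof -
  have "Measurable.pred (percolation_space p n) (\<lambda>\<omega>. \<forall>t\<in>{t\<in>\<rat>. 0 \<le> t \<and> d - 1 < t}. cuttable t (percolation_limit n \<omega>))"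
    unfolding pred_def
    using pred_cuttable_percolation_limit[OF assms(1)]
    by (intro sets.sets_Collect_countable_All' countable_exponents) (auto simp: pred_def)
  then show ?thesis
    unfolding not_le[symmetric] topological_hausdorff_dim_percolation_limit_le_iff[OF assms]
    by (rule pred_intros_logic(2))
qed

text \<open>A single exponent \<open>t\<close> at which cuttability is not almost sure suffices: by
  the zero-one law a non-empty limit set is then almost surely not cuttable at \<open>t\<close>,
  which forces its dimension above \<open>d\<close>.\<close>

lemma supercritical_cond_prob:
  assumes n: "2 \<le> n" and d: "0 \<le> d" and p: "0 < p" "p < 1"
    and not: "\<not> (AE \<omega> in percolation_space p n. topological_hausdorff_dim (percolation_limit n \<omega>) \<le> ereal d)"
  shows "\<P>(\<omega> in completion (percolation_space p n).
      topological_hausdorff_dim (percolation_limit n \<omega>) > ereal d \<bar> percolation_limit n \<omega> \<noteq> {}) = 1"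
proof -
  let ?P = "percolation_space p n"
  interpret prob_space ?P by (rule prob_space_percolation)
  have n1: "1 \<le> n" using n by simp
  let ?D = "{\<omega>\<in>space ?P. topological_hausdorff_dim (percolation_limit n \<omega>) > ereal d \<and> percolation_limit n \<omega> \<noteq> {}}"
  let ?E = "{\<omega>\<in>space ?P. percolation_limit n \<omega> \<noteq> {}}"
  have pE: "Measurable.pred ?P (\<lambda>\<omega>. percolation_limit n \<omega> \<noteq> {})"
    using pred_percolation_limit_empty[OF n1] by (rule pred_intros_logic(2))
  then have E: "?E \<in> events" by (simp only: pred_def)
  have D: "?D \<in> events"
    using pred_intros_logic(3)[OF pred_topological_hausdorff_dim_less[OF n1 d] pE] by (simp only: pred_def)
  obtain t where t: "0 \<le> t" "d - 1 < t" "t \<in> \<rat>" "\<not> (AE \<omega> in ?P. cuttable t (percolation_limit n \<omega>))"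
    using not unfolding AE_topological_hausdorff_dim_le_iff[OF n1 d] by blast
  then have "AE \<omega> in ?P. cuttable t (percolation_limit n \<omega>) \<longrightarrow> percolation_limit n \<omega> = {}"
    using cuttable_zero_one[OF n p t(1)] by blast
  then have AE: "AE \<omega> in ?P. percolation_limit n \<omega> \<noteq> {} \<longrightarrow> ereal d < topological_hausdorff_dim (percolation_limit n \<omega>)"
  proof eventually_elim
    case (elim \<omega>)
    then show ?case
      using t topological_hausdorff_dim_percolation_limit_le_iff[OF n1 d, of \<omega>] by (auto simp: not_le[symmetric])
  qed
  have "prob ?D = prob ?E"
    using AE by (intro finite_measure_eq_AE D E) auto
  \<comment> \<open>The quotient must not degenerate: almost sure extinction would make cuttability
    almost sure.\<close>
  moreover have "prob ?E \<noteq> 0"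
  proof
    assume "prob ?E = 0"
    then have "AE \<omega> in ?P. \<omega> \<notin> ?E" using prob_eq_0[OF E] by simp
    then have "AE \<omega> in ?P. cuttable t (percolation_limit n \<omega>)"
      using AE_space by eventually_elim (auto simp: cuttable_empty)
    then show False using t by simp
  qed
  \<comment> \<open>Both events are measurable, so the completion gives them the same
    probabilities.\<close>
  ultimately show ?thesis
    using D E by (simp add: cond_prob_def measure_completion)
qed

theorem theorem6p2:
  fixes n :: nat and d :: real
  assumes "2 \<le> n" and "0 \<le> d" and "d < 2"
  shows "\<exists>p\<^sub>c\<in>{0<..<1::real}. \<forall>p\<in>{0<..<1::real}.
      (p < p\<^sub>c \<longrightarrow>
        (AE \<omega> in percolation_space p n.
          topological_hausdorff_dim (percolation_limit n \<omega>) \<le> ereal d)) \<and>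
      (p > p\<^sub>c \<longrightarrow>
        \<P>(\<omega> in completion (percolation_space p n).
          topological_hausdorff_dim (percolation_limit n \<omega>) > ereal d
          \<bar> percolation_limit n \<omega> \<noteq> {}) = 1)"
proof -
  have n1: "1 \<le> n" using assms(1) by simp
  \<comment> \<open>By the coupling this is an initial segment of the unit interval; its supremum is
    the critical probability.\<close>
  define S where "S = {p\<in>{0<..<1::real}.
    AE \<omega> in percolation_space p n. topological_hausdorff_dim (percolation_limit n \<omega>) \<le> ereal d}"
  have down: "p \<in> S" if "p' \<in> S" "0 < p" "p \<le> p'" for p p'
    using that AE_cuttable_percolation_mono[OF n1 _ that(2,3)]
    unfolding S_def AE_topological_hausdorff_dim_le_iff[OF n1 assms(2)] by auto
  \<comment> \<open>Half of the extinction bound \<open>1 / n\<^sup>2\<close>, so that the limit set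
    is almost surely empty and \<open>S\<close> is non-empty.\<close>
  define p\<^sub>0 where "p\<^sub>0 = 1 / (2 * real n ^ 2)"
  define c where "c = 1 / real n ^ 2"
  have c: "0 < c" "c \<le> 1" using n1 by (simp_all add: c_def divide_le_eq_1)
  have "p\<^sub>0 = c / 2" by (simp add: p\<^sub>0_def c_def)
  then have p0: "0 < p\<^sub>0" "p\<^sub>0 < 1 / real n ^ 2" "p\<^sub>0 < 1"
    using c by (simp_all add: c_def[symmetric])
  have "p\<^sub>0 \<in> S"
  proof -
    have "AE \<omega> in percolation_space p\<^sub>0 n. percolation_limit n \<omega> = {}"
      using AE_percolation_limit_empty[OF n1] p0 by simp
    then have "AE \<omega> in percolation_space p\<^sub>0 n. cuttable t (percolation_limit n \<omega>)" for t
      by eventually_elim (simp add: cuttable_empty)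
    then show ?thesis
      using p0 by (simp add: S_def AE_topological_hausdorff_dim_le_iff[OF n1 assms(2)])
  qed
  \<comment> \<open>Here \<open>d < 2\<close> enters: it leaves room for an exponent above
    \<open>d - 1\<close> and below \<open>1\<close>.\<close>
  obtain t where t: "t \<in> \<rat>" "max 0 (d - 1) < t" "t < 1"
    using Rats_dense_in_real[of "max 0 (d - 1)" 1] assms(3) by auto
  obtain p\<^sub>1 where p1: "0 < p\<^sub>1" "p\<^sub>1 < 1" "\<not> (AE \<omega> in percolation_space p\<^sub>1 n. cuttable t (percolation_limit n \<omega>))"
    using exists_parameter_not_cuttable[OF assms(1), of t] t by auto
  have "p\<^sub>1 \<notin> S"
    using p1(3) t by (auto simp: S_def AE_topological_hausdorff_dim_le_iff[OF n1 assms(2)])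
  then have upper: "p \<le> p\<^sub>1" if "p \<in> S" for p
    using down[OF that p1(1)] by linarith
  have bdd: "bdd_above S" using upper by (rule bdd_aboveI)
  have "p\<^sub>0 \<le> Sup S" using \<open>p\<^sub>0 \<in> S\<close> bdd by (rule cSup_upper)
  moreover have "Sup S \<le> p\<^sub>1" using \<open>p\<^sub>0 \<in> S\<close> upper by (intro cSup_least) auto
  ultimately have "Sup S \<in> {0<..<1}" using p0 p1 by auto
  moreover have "AE \<omega> in percolation_space p n. topological_hausdorff_dim (percolation_limit n \<omega>) \<le> ereal d"
    if "p \<in> {0<..<1}" "p < Sup S" for p
  proof -
    obtain p' where "p' \<in> S" "p < p'" using less_cSup_iff[of S p] bdd \<open>p\<^sub>0 \<in> S\<close> \<open>p < Sup S\<close> by auto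
    then have "p \<in> S" using down[of p' p] that(1) by simp
    then show ?thesis by (simp add: S_def)
  qed
  moreover have "\<P>(\<omega> in completion (percolation_space p n).
      topological_hausdorff_dim (percolation_limit n \<omega>) > ereal d \<bar> percolation_limit n \<omega> \<noteq> {}) = 1"
    if "p \<in> {0<..<1}" "p > Sup S" for p
  proof -
    have "p \<notin> S" using cSup_upper[OF _ bdd, of p] that(2) by auto
    then show ?thesis using that(1) assms by (intro supercritical_cond_prob) (auto simp: S_def)
  qed
  ultimately show ?thesis by blast
qed

end
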